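(* Let $m\ge 3$ and $1\le a<m$. Then there is a countably infinite collection of $1$-parameter families, each parametrized by $c\in\mathbb R$, of distinct special Lagrangian $m$-folds $N=N_c$ in $\mathbb C^m$, each family arising from a periodic datum $(\alpha_1,\dots,\alpha_m,A,u,\theta_1,\dots,\theta_m)$ (as defined in the context) by $$N=\Bigl\{\bigl(x_1e^{i\theta_1(t)}\sqrt{\alpha_1+u(t)},\dots,x_ae^{i\theta_a(t)}\sqrt{\alpha_a+u(t)},\;x_{a+1}e^{i\theta_{a+1}(t)}\sqrt{\alpha_{a+1}-u(t)},\dots,x_me^{i\theta_m(t)}\sqrt{\alpha_m-u(t)}\,\bigr):\ t\in\mathbb R,\ x_j\in\mathbb R,\ x_1^2+\cdots+x_a^2-x_{a+1}^2-\cdots-x_m^2=c\Bigr\},$$ such that (a) if $c>0$ then $N$ is a closed, nonsingular, immersed submanifold diffeomorphic to $\mathcal S^{a-1}\times\mathbb R^{m-a}\times\mathcal S^1$, or to a free quotient of this by $\mathbb Z_2$; (b) if $c<0$ then $N$ is a closed, nonsingular, immersed submanifold diffeomorphic to $\mathbb R^a\times\mathcal S^{m-a-1}\times\mathcal S^1$, or to a free quotient of this by $\mathbb Z_2$; and (c) if $c=0$ then $N$ is a closed, immersed cone with an isolated singular point at $0$, diffeomorphic to the cone on $\mathcal S^{a-1}\times\mathcal S^{m-a-1}\times\mathcal S^1$, or to a cone on a free quotient of this by $\mathbb Z_2$.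
   Context: $\mathbb C^m$ has coordinates $(z_1,\dots,z_m)$, metric $g=\sum|dz_j|^2$, $2$-form $\omega=\frac i2\sum dz_j\wedge d\bar z_j$ and complex $m$-form $\Omega=dz_1\wedge\cdots\wedge dz_m$. An oriented real $m$-dimensional submanifold $L$ is special Lagrangian (an SL $m$-fold) if $\mathrm{Re}\,\Omega|_{T_xL}=\mathrm{vol}_{T_xL}$ for all $x\in L$; a real $m$-dimensional submanifold $L$ admits an orientation making it special Lagrangian iff $\omega|_L\equiv0$ and $\mathrm{Im}\,\Omega|_L\equiv 0$. For $c=0$ this is required away from the singular point $0$. "Immersed submanifold diffeomorphic to $X$" means that $N$ is the image of an immersion of $X$; "closed" means closed in $\mathbb C^m$. Periodic datum. Constants $\alpha_1,\dots,\alpha_m>0$ and $A$ satisfy $$\sum_{j=1}^a\frac1{\alpha_j}=\sum_{j=a+1}^m\frac1{\alpha_j},\qquad 0<A<(\alpha_1\cdots\alpha_m)^{1/2}.$$ Put $Q(u)=\prod_{j=1}^a(\alpha_j+u)\prod_{j=a+1}^m(\alpha_j-u)$. Functions $u,\theta_1,\dots,\theta_m:\mathbb R\to\mathbb R$, with $\theta=\theta_1+\cdots+\theta_m$, satisfy $\alpha_j+u>0$ for $j\le a$, $\alpha_j-u>0$ for $j>a$, $Q(u)^{1/2}\sin\theta\equiv A$, and $$\frac{du}{dt}=2Q(u)^{1/2}\cos\theta,\qquad \frac{d\theta_j}{dt}=-\frac{Q(u)^{1/2}\sin\theta}{\alpha_j+u}\ (j\le a),\qquad \frac{d\theta_j}{dt}=\frac{Q(u)^{1/2}\sin\theta}{\alpha_j-u}\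 (j>a).$$ For such data $u$ and $\theta$ are nonconstant and periodic with a period $T>0$, and there are real constants $\beta_j$ with $\theta_j(t+T)=\theta_j(t)+\beta_j$ for all $t$. The datum is called a periodic datum if $\beta_1,\dots,\beta_m\in\pi\mathbb Q$. *)

theory Defs
  imports "HOL-Analysis.Analysis"
begin

text \<open>
  Throughout, \<open>\<complex>\<^sup>m\<close> is the type \<open>complex ^ 'n\<close> with \<open>m = CARD('n)\<close>, whose library inner product is the
  real part of the Hermitian product, i.e. the metric \<open>g = \<Sum>\<^sub>j |dz\<^sub>j|\<^sup>2\<close>.
\<close>

section \<open>Smooth maps on subsets of normed spaces\<close>

primrec Ck_on :: "nat \<Rightarrow> ('a::real_normed_vector \<Rightarrow> 'b::real_normed_vector) \<Rightarrow> 'a set \<Rightarrow> bool" where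
  "Ck_on 0 f U \<longleftrightarrow> continuous_on U f"
| "Ck_on (Suc k) f U \<longleftrightarrow>
     (\<exists>D. (\<forall>x\<in>U. (f has_derivative D x) (at x)) \<and> (\<forall>v. Ck_on k (\<lambda>x. D x v) U))"

text \<open>Only used for open \<open>U\<close> in finite-dimensional spaces, where it is the usual \<open>C\<^sup>\<infinity>\<close>.\<close>

definition smooth_on :: "('a::real_normed_vector \<Rightarrow> 'b::real_normed_vector) \<Rightarrow> 'a set \<Rightarrow> bool" where
  "smooth_on f U \<longleftrightarrow> (\<forall>k. Ck_on k f U)"

text \<open>
  Manifolds are given as embedded submanifolds \<open>X\<close> of a Euclidean space. A map on \<open>X\<close> is smooth iff
  it extends smoothly to the ambient space near every point of \<open>X\<close>.
\<close>

definition smooth_map_on :: "'a set \<Rightarrow> ('a::real_normed_vector \<Rightarrow> 'b::real_normed_vector) \<Rightarrow> bool" where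
  "smooth_map_on X f \<longleftrightarrow>
     (\<forall>x\<in>X. \<exists>U g. open U \<and> x \<in> U \<and> smooth_on g U \<and> (\<forall>y\<in>X \<inter> U. f y = g y))"

definition tangent_space :: "'a::real_normed_vector set \<Rightarrow> 'a \<Rightarrow> 'a set" where
  "tangent_space X x =
     {v. \<exists>\<gamma> e. 0 < e \<and> smooth_on \<gamma> {-e<..<e::real} \<and> \<gamma> ` {-e<..<e} \<subseteq> X \<and> \<gamma> 0 = x
           \<and> (\<gamma> has_vector_derivative v) (at 0)}"

text \<open>
  A derivative \<open>D\<close> of \<open>f\<close> at \<open>x\<close> within \<open>X\<close> is a linear map on the ambient space which is
  not unique, but its restriction to the tangent space of \<open>X\<close> is the differential of \<open>f\<close>.
\<close>

definition immersion_on :: "'a set \<Rightarrow> ('a::real_normed_vector \<Rightarrow> 'b::real_normed_vector) \<Rightarrow> bool" where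
  "immersion_on X f \<longleftrightarrow> smooth_map_on X f \<and>
     (\<forall>x\<in>X. \<exists>D. (f has_derivative D) (at x within X) \<and> inj_on D (tangent_space X x))"

section \<open>Orientations\<close>

definition tangent_frame :: "'a::real_normed_vector set \<Rightarrow> 'a \<Rightarrow> ('n::finite \<Rightarrow> 'a) \<Rightarrow> bool" where
  "tangent_frame X x e \<longleftrightarrow>
     inj e \<and> independent (range e) \<and> span (range e) = tangent_space X x"

text \<open>
  An orientation of an \<open>m\<close>-manifold, \<open>m = CARD('n)\<close>, selects at each point one of the two classes of
  bases of the tangent space modulo change of basis with positive determinant, in such a way that
  near every point there is a continuous frame in the selected classes.
\<close>

definition orientation_on ::
  "'a::real_normed_vector set \<Rightarrow> ('a \<Rightarrow> ('n::finite \<Rightarrow> 'a) set) \<Rightarrow> bool" where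
  "orientation_on X Or \<longleftrightarrow>
     (\<forall>x\<in>X. Or x \<noteq> {} \<and> (\<forall>e\<in>Or x. tangent_frame X x e \<and>
        Or x = {(\<lambda>i. \<Sum>j\<in>UNIV. M $ i $ j *\<^sub>R e j) | M :: real^'n^'n. det M > 0})) \<and>
     (\<forall>x\<in>X. \<exists>U E. open U \<and> x \<in> U \<and> (\<forall>i. continuous_on (X \<inter> U) (\<lambda>y. E y i)) \<and>
        (\<forall>y\<in>X \<inter> U. E y \<in> Or y))"

section \<open>Special Lagrangian immersions\<close>

text \<open>
  \<open>Hol_vol v\<close> is \<open>\<Omega>(v\<^sub>1,\<dots>,v\<^sub>m)\<close> for \<open>\<Omega> = dz\<^sub>1 \<and> \<dots> \<and> dz\<^sub>m\<close>. Vectors and coordinates are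
  indexed by the same type, so no choice of order of the index type enters.
\<close>

definition Hol_vol :: "('n::finite \<Rightarrow> complex ^ 'n) \<Rightarrow> complex" where
  "Hol_vol v = det (\<chi> i j. v i $ j)"

text \<open>The value of the Riemannian volume form of an oriented subspace on a positively oriented basis.\<close>

definition gram_vol :: "('n::finite \<Rightarrow> complex ^ 'n) \<Rightarrow> real" where
  "gram_vol v = sqrt (det ((\<chi> i j. v i \<bullet> v j) :: real ^ 'n ^ 'n))"

text \<open>
  The immersed submanifold \<open>f: X \<rightarrow> \<complex>\<^sup>m\<close> admits an orientation for which \<open>Re \<Omega>\<close> restricts to its
  volume form. Being stated for \<open>f\<close>, this refers to each sheet separately at self-intersections.
\<close>

definition SL_immersion :: "'a set \<Rightarrow> ('a::real_normed_vector \<Rightarrow> complex ^ 'n::finite) \<Rightarrow> bool" where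
  "SL_immersion X f \<longleftrightarrow> immersion_on X f \<and>
     (\<exists>Or :: 'a \<Rightarrow> ('n \<Rightarrow> 'a) set. orientation_on X Or \<and>
        (\<forall>x\<in>X. \<forall>D. (f has_derivative D) (at x within X) \<longrightarrow>
           (\<forall>e\<in>Or x. Re (Hol_vol (\<lambda>i. D (e i))) = gram_vol (\<lambda>i. D (e i)))))"

text \<open>A free smooth \<open>\<int>\<^sub>2\<close>-action on \<open>X\<close>, given by its generator.\<close>

definition free_involution_on :: "'a::real_normed_vector set \<Rightarrow> ('a \<Rightarrow> 'a) \<Rightarrow> bool" where
  "free_involution_on X \<sigma> \<longleftrightarrow> smooth_map_on X \<sigma> \<and> (\<forall>x\<in>X. \<sigma> x \<in> X \<and> \<sigma> (\<sigma> x) = x \<and> \<sigma> x \<noteq> x)"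

text \<open>
  \<open>N\<close> is the image of a special Lagrangian immersion of \<open>X\<close>, or of a quotient \<open>X/\<sigma>\<close> by a free
  involution. As \<open>X \<rightarrow> X/\<sigma>\<close> is a local diffeomorphism, immersions of \<open>X/\<sigma>\<close> are precisely the
  \<open>\<sigma>\<close>-invariant immersions of \<open>X\<close>; the orientation in \<open>SL_immersion\<close> is determined by
  \<open>Re \<Omega> > 0\<close>, hence is then \<open>\<sigma>\<close>-invariant as well.
\<close>

definition SL_immersed_image :: "'a::real_normed_vector set \<Rightarrow> (complex ^ 'n::finite) set \<Rightarrow> bool" where
  "SL_immersed_image X N \<longleftrightarrow>
     (\<exists>f. SL_immersion X f \<and> N = f ` X) \<or>
     (\<exists>\<sigma> f. free_involution_on X \<sigma> \<and> (\<forall>x\<in>X. f (\<sigma> x) = f x) \<and> SL_immersion X f \<and> N = f ` X)"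

section \<open>Cones\<close>

text \<open>
  The cone on \<open>\<Sigma>\<close>, minus its vertex, is \<open>\<Sigma> \<times> (0,\<infinity>)\<close>. \<open>N\<close> is the image of the cone on \<open>\<Sigma>\<close>, or on
  \<open>\<Sigma>/\<sigma>\<close>, under a map which takes the vertex to \<open>0\<close>, respects dilations, and is a special
  Lagrangian immersion away from the vertex.
\<close>

definition SL_immersed_cone :: "'a::real_normed_vector set \<Rightarrow> (complex ^ 'n::finite) set \<Rightarrow> bool" where
  "SL_immersed_cone \<Sigma> N \<longleftrightarrow>
     (\<exists>f :: 'a \<times> real \<Rightarrow> complex ^ 'n.
        SL_immersion (\<Sigma> \<times> {0<..}) f \<and> (\<forall>s\<in>\<Sigma>. \<forall>r>0. f (s, r) = r *\<^sub>R f (s, 1)) \<and>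
        0 \<in> N \<and> N - {0} = f ` (\<Sigma> \<times> {0<..})) \<or>
     (\<exists>\<sigma>. \<exists>f :: 'a \<times> real \<Rightarrow> complex ^ 'n.
        free_involution_on \<Sigma> \<sigma> \<and> (\<forall>s\<in>\<Sigma>. \<forall>r>0. f (\<sigma> s, r) = f (s, r)) \<and>
        SL_immersion (\<Sigma> \<times> {0<..}) f \<and> (\<forall>s\<in>\<Sigma>. \<forall>r>0. f (s, r) = r *\<^sub>R f (s, 1)) \<and>
        0 \<in> N \<and> N - {0} = f ` (\<Sigma> \<times> {0<..}))"

text \<open>
  Near \<open>p\<close>, \<open>N\<close> is the image of an immersed (second countable) \<open>m\<close>-manifold. Such a manifold is
  covered by countably many charts, and a countable disjoint union of balls is diffeomorphic to an
  open subset \<open>W\<close> of \<open>\<real>\<^sup>m\<close>, so it suffices to consider such \<open>W\<close> as domains.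
\<close>

definition immersed_near :: "(complex ^ 'n::finite) set \<Rightarrow> complex ^ 'n \<Rightarrow> bool" where
  "immersed_near N p \<longleftrightarrow>
     (\<exists>U W. \<exists>g :: real ^ 'n \<Rightarrow> complex ^ 'n.
        open U \<and> p \<in> U \<and> open W \<and> immersion_on W g \<and> g ` W = N \<inter> U)"

definition isolated_singular_point :: "(complex ^ 'n::finite) set \<Rightarrow> complex ^ 'n \<Rightarrow> bool" where
  "isolated_singular_point N p \<longleftrightarrow> p \<in> N \<and> \<not> immersed_near N p \<and>
     (\<exists>r>0. \<forall>q \<in> N \<inter> ball p r - {p}. immersed_near N q)"

section \<open>Periodic data and the associated families\<close>

text \<open>
  The index set \<open>{1,\<dots>,m}\<close> is the sum type \<open>'p + 'q\<close>, with \<open>Inl\<close> giving the first \<open>a = CARD('p)\<close>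
  indices and \<open>Inr\<close> the remaining \<open>m - a = CARD('q)\<close>.
\<close>

definition Q_poly :: "('p::finite + 'q::finite \<Rightarrow> real) \<Rightarrow> real \<Rightarrow> real" where
  "Q_poly \<alpha> x = (\<Prod>j\<in>UNIV. \<alpha> (Inl j) + x) * (\<Prod>j\<in>UNIV. \<alpha> (Inr j) - x)"

definition evolution_datum ::
  "('p::finite + 'q::finite \<Rightarrow> real) \<Rightarrow> real \<Rightarrow> (real \<Rightarrow> real) \<Rightarrow> ('p + 'q \<Rightarrow> real \<Rightarrow> real) \<Rightarrow> bool" where
  "evolution_datum \<alpha> A u \<theta> \<longleftrightarrow>
     (\<forall>j. \<alpha> j > 0) \<and>
     (\<Sum>j\<in>UNIV. 1 / \<alpha> (Inl j)) = (\<Sum>j\<in>UNIV. 1 / \<alpha> (Inr j)) \<and>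
     0 < A \<and> A < sqrt (\<Prod>j\<in>UNIV. \<alpha> j) \<and>
     (\<forall>t. (\<forall>j. \<alpha> (Inl j) + u t > 0) \<and> (\<forall>j. \<alpha> (Inr j) - u t > 0) \<and>
        sqrt (Q_poly \<alpha> (u t)) * sin (\<Sum>j\<in>UNIV. \<theta> j t) = A \<and>
        (u has_real_derivative 2 * sqrt (Q_poly \<alpha> (u t)) * cos (\<Sum>j\<in>UNIV. \<theta> j t)) (at t) \<and>
        (\<forall>j. (\<theta> (Inl j) has_real_derivative
           - (sqrt (Q_poly \<alpha> (u t)) * sin (\<Sum>i\<in>UNIV. \<theta> i t)) / (\<alpha> (Inl j) + u t)) (at t)) \<and>
        (\<forall>j. (\<theta> (Inr j) has_real_derivative
           (sqrt (Q_poly \<alpha> (u t)) * sin (\<Sum>i\<in>UNIV. \<theta> i t)) / (\<alpha> (Inr j) - u t)) (at t)))"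

text \<open>
  Replacing the period \<open>T\<close> by a positive multiple multiplies all \<open>\<beta> j\<close> by that multiple, so whether
  they lie in \<open>\<pi>\<rat>\<close> does not depend on the period used.
\<close>

definition periodic_datum ::
  "('p::finite + 'q::finite \<Rightarrow> real) \<Rightarrow> real \<Rightarrow> (real \<Rightarrow> real) \<Rightarrow> ('p + 'q \<Rightarrow> real \<Rightarrow> real) \<Rightarrow> bool" where
  "periodic_datum \<alpha> A u \<theta> \<longleftrightarrow> evolution_datum \<alpha> A u \<theta> \<and>
     (\<exists>T \<beta>. T > 0 \<and> (\<forall>t. u (t + T) = u t) \<and>
        (\<forall>t. (\<Sum>j\<in>UNIV. \<theta> j (t + T)) = (\<Sum>j\<in>UNIV. \<theta> j t)) \<and>
        (\<forall>j t. \<theta> j (t + T) = \<theta> j t + \<beta> j) \<and>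
        (\<forall>j. \<exists>q\<in>\<rat>. \<beta> j = pi * q))"

definition quadric_family ::
  "('p::finite + 'q::finite \<Rightarrow> real) \<Rightarrow> (real \<Rightarrow> real) \<Rightarrow> ('p + 'q \<Rightarrow> real \<Rightarrow> real)
     \<Rightarrow> real \<Rightarrow> (complex ^ ('p + 'q)) set" where
  "quadric_family \<alpha> u \<theta> c =
     {z. \<exists>t. \<exists>x :: 'p + 'q \<Rightarrow> real.
        (\<Sum>j\<in>UNIV. (x (Inl j))\<^sup>2) - (\<Sum>j\<in>UNIV. (x (Inr j))\<^sup>2) = c \<and>
        (\<forall>j. z $ Inl j = of_real (x (Inl j)) * exp (\<i> * of_real (\<theta> (Inl j) t))
                           * of_real (sqrt (\<alpha> (Inl j) + u t))) \<and>
        (\<forall>j. z $ Inr j = of_real (x (Inr j)) * exp (\<i> * of_real (\<theta> (Inr j) t))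
                           * of_real (sqrt (\<alpha> (Inr j) - u t)))}"

end

theory Submission
  imports Defs "HOL-Complex_Analysis.Cauchy_Integral_Formula"
begin

text \<open>
  Take all \<open>\<alpha>\<^sub>j\<close>, \<open>j \<le> a\<close>, equal to \<open>a\<close> and the others equal to \<open>b = m - a\<close>, so that only one
  rotation angle per period has to be made rational. With \<open>ln (Q(0)/Q(u)) = h\<^sup>2\<close> and
  \<open>-2 ln (sin \<theta>) = k\<^sup>2\<close> for signed square roots \<open>h\<close>, \<open>k\<close>, the conserved quantity
  \<open>Q(u)\<^sup>1\<^sup>/\<^sup>2 sin \<theta> = A\<close> becomes a circle \<open>h\<^sup>2 + k\<^sup>2 = E\<^sup>2\<close>, and the flow a positive speed on it; this
  solves the evolution equations by quadrature, and shows that \<open>a |\<beta>\<^sub>1|\<close> extends continuously to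
  \<open>E = 0\<close>, with value \<open>\<pi> sqrt (2ab/(a+b)) > \<pi>\<close>. As \<open>E \<rightarrow> \<infinity>\<close> its upper limit is at most \<open>\<pi>\<close>, so by the
  intermediate value theorem it is a rational multiple of \<open>\<pi>\<close> for infinitely many \<open>E\<close>.

  For such a datum \<open>w\<^sub>j = exp (\<i> \<theta>\<^sub>j) sqrt (\<alpha>\<^sub>j \<plusminus> u)\<close> is periodic and satisfies
  \<open>w\<^sub>j' = \<plusminus> cnj (\<Prod>\<^sub>k\<^sub>\<noteq>\<^sub>j w\<^sub>k)\<close>, which makes \<open>(x, t) \<mapsto> (x\<^sub>j w\<^sub>j(t))\<^sub>j\<close> on quadric times circle a special
  Lagrangian immersion; its image is already \<open>N\<close>, so that no quotient by \<open>\<int>\<^sub>2\<close> is needed. The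
  parameters \<open>E\<close> and \<open>c\<close> are read off from the points of \<open>N\<close> on coordinate axes and planes.
\<close>

section \<open>Calculus of smooth maps\<close>

text \<open>Written over u, the integrals for the period and the rotation angles carry the weight 1
  / sqrt (Q - A^2). They are singular at end points that move with A and merge at the equilibrium.
  Using the angle on the circle in the (h, k)-plane as parameter removes both obstacles: the
  integrand is jointly continuous in radius and angle, also at radius 0, so continuity of the
  rotation angle becomes a general fact about parameter integrals. Taking \<alpha> equal to a and b
  on the two blocks makes both sums of 1/\<alpha> equal to 1, and periodicity of \<theta> ties the
  increments of the two angles together. For large E no asymptotics of the angle are computed. The
  total rotation is bounded by the range (0, \<pi>) of \<theta> plus A times the elapsed time, and
  the latter is absorbed. The hypothesis m \<ge> 3 enters twice: it gives 2ab > a + b, which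
  separates the two ends of the intermediate value argument, and in the case a = b it provides two
  coordinates of equal phase in one block, which makes the cone singular.\<close>

lemma Ck_on_SucI:
  "(\<And>x. x \<in> U \<Longrightarrow> (f has_derivative D x) (at x)) \<Longrightarrow> (\<And>v. Ck_on k (\<lambda>x. D x v) U) \<Longrightarrow> Ck_on (Suc k) f U"
  by auto

lemma Ck_on_SucE:
  assumes "Ck_on (Suc k) f U"
  obtains D where "\<And>x. x \<in> U \<Longrightarrow> (f has_derivative D x) (at x)" "\<And>v. Ck_on k (\<lambda>x. D x v) U"
  using assms by auto

lemma Ck_on_SucD: "Ck_on (Suc k) f U \<Longrightarrow> Ck_on k f U"
proof (induction k arbitrary: f)
  case 0
  then show ?case
    by (metis Ck_on.simps continuous_at_imp_continuous_on has_derivative_continuous)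
next
  case (Suc k)
  obtain D where D: "\<And>x. x \<in> U \<Longrightarrow> (f has_derivative D x) (at x)" "\<And>v. Ck_on (Suc k) (\<lambda>x. D x v) U"
    using Ck_on_SucE[OF Suc.prems] by blast
  show ?case
    by (rule Ck_on_SucI[OF D(1) Suc.IH[OF D(2)]])
qed

lemma Ck_on_subset: "Ck_on k f U \<Longrightarrow> V \<subseteq> U \<Longrightarrow> Ck_on k f V"
proof (induction k arbitrary: f)
  case 0
  then show ?case by (auto intro: continuous_on_subset)
next
  case (Suc k)
  obtain D where D: "\<And>x. x \<in> U \<Longrightarrow> (f has_derivative D x) (at x)" "\<And>v. Ck_on k (\<lambda>x. D x v) U"
    using Ck_on_SucE[OF Suc.prems(1)] by blast
  show ?case
    using Suc.prems(2) by (intro Ck_on_SucI[OF D(1) Suc.IH[OF D(2)]]) auto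
qed

lemma Ck_on_cong:
  assumes "open U" "\<And>x. x \<in> U \<Longrightarrow> f x = g x" "Ck_on k f U"
  shows "Ck_on k g U"
proof (cases k)
  case 0
  then show ?thesis using assms by (simp cong: continuous_on_cong)
next
  case (Suc l)
  then obtain D where D: "\<And>x. x \<in> U \<Longrightarrow> (f has_derivative D x) (at x)" "\<And>v. Ck_on l (\<lambda>x. D x v) U"
    using Ck_on_SucE assms(3) by blast
  have "(g has_derivative D x) (at x)" if "x \<in> U" for x
    using D(1) that assms(1,2) has_derivative_transform_within_open by blast
  then show ?thesis
    unfolding Suc using D(2) by (rule Ck_on_SucI)
qed

lemma Ck_on_const: "Ck_on k (\<lambda>x. c) U"
proof (induction k arbitrary: c)
  case (Suc k)
  then show ?case by (intro Ck_on_SucI[where D = "\<lambda>x v. 0"]) auto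
qed simp

lemma Ck_on_bounded_linear: "bounded_linear h \<Longrightarrow> Ck_on k h U"
proof (cases k)
  case 0
  assume "bounded_linear h"
  with 0 show ?thesis by (auto intro: linear_continuous_on)
next
  case (Suc l)
  assume "bounded_linear h"
  with Suc show ?thesis
    by (auto intro!: Ck_on_SucI[where D = "\<lambda>x. h"] bounded_linear_imp_has_derivative Ck_on_const
        simp del: Ck_on.simps)
qed

lemma Ck_on_bounded_linear_compose:
  assumes "bounded_linear h"
  shows "Ck_on k f U \<Longrightarrow> Ck_on k (\<lambda>x. h (f x)) U"
proof (induction k arbitrary: f)
  case 0
  then show ?case by (auto intro: bounded_linear.continuous_on[OF assms])
next
  case (Suc k)
  obtain D where D: "\<And>x. x \<in> U \<Longrightarrow> (f has_derivative D x) (at x)" "\<And>v. Ck_on k (\<lambda>x. D x v) U"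
    using Ck_on_SucE[OF Suc.prems] by blast
  show ?case
    by (rule Ck_on_SucI[OF bounded_linear.has_derivative[OF assms D(1)] Suc.IH[OF D(2)]])
qed

lemma Ck_on_add: "Ck_on k f U \<Longrightarrow> Ck_on k g U \<Longrightarrow> Ck_on k (\<lambda>x. f x + g x) U"
proof (induction k arbitrary: f g)
  case 0
  then show ?case by (auto intro: continuous_intros)
next
  case (Suc k)
  obtain D where D: "\<And>x. x \<in> U \<Longrightarrow> (f has_derivative D x) (at x)" "\<And>v. Ck_on k (\<lambda>x. D x v) U"
    using Ck_on_SucE[OF Suc.prems(1)] by blast
  obtain D' where D': "\<And>x. x \<in> U \<Longrightarrow> (g has_derivative D' x) (at x)" "\<And>v. Ck_on k (\<lambda>x. D' x v) U"
    using Ck_on_SucE[OF Suc.prems(2)] by blast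
  show ?case
    by (rule Ck_on_SucI[OF has_derivative_add[OF D(1) D'(1)] Suc.IH[OF D(2) D'(2)]])
qed

lemma Ck_on_bilinear:
  fixes B :: "'a::real_normed_vector \<Rightarrow> 'b::real_normed_vector \<Rightarrow> 'c::real_normed_vector"
  assumes "bounded_bilinear B"
  shows "Ck_on k f U \<Longrightarrow> Ck_on k g U \<Longrightarrow> Ck_on k (\<lambda>x. B (f x) (g x)) U"
proof (induction k arbitrary: f g)
  case 0
  then show ?case by (auto intro: bounded_bilinear.continuous_on[OF assms])
next
  case (Suc k)
  obtain D where D: "\<And>x. x \<in> U \<Longrightarrow> (f has_derivative D x) (at x)" "\<And>v. Ck_on k (\<lambda>x. D x v) U"
    using Ck_on_SucE[OF Suc.prems(1)] by blast
  obtain D' where D': "\<And>x. x \<in> U \<Longrightarrow> (g has_derivative D' x) (at x)" "\<And>v. Ck_on k (\<lambda>x. D' x v) U"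
    using Ck_on_SucE[OF Suc.prems(2)] by blast
  show ?case
    by (rule Ck_on_SucI[OF bounded_bilinear.FDERIV[OF assms D(1) D'(1)]
          Ck_on_add[OF Suc.IH[OF Ck_on_SucD[OF Suc.prems(1)] D'(2)]
            Suc.IH[OF D(2) Ck_on_SucD[OF Suc.prems(2)]]]])
qed

lemma Ck_on_sum: "(\<And>i. i \<in> I \<Longrightarrow> Ck_on k (f i) U) \<Longrightarrow> Ck_on k (\<lambda>x. \<Sum>i\<in>I. f i x) U"
  by (induction I rule: infinite_finite_induct) (simp_all add: Ck_on_const Ck_on_add)

lemma Ck_on_prod:
  fixes f :: "'i \<Rightarrow> 'a::real_normed_vector \<Rightarrow> 'b::{real_normed_algebra,comm_ring_1}"
  shows "(\<And>i. i \<in> I \<Longrightarrow> Ck_on k (f i) U) \<Longrightarrow> Ck_on k (\<lambda>x. \<Prod>i\<in>I. f i x) U"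
  by (induction I rule: infinite_finite_induct)
    (simp_all add: Ck_on_const Ck_on_bilinear[OF bounded_bilinear_mult])

text \<open>\<open>Ck_on\<close> only controls \<open>D x v\<close> for a fixed \<open>v\<close>,
  whereas the chain rule applies \<open>D' (f x)\<close> to the moving vector \<open>D x v\<close>.
  Expanding that vector in the finite basis turns the derivative into a sum of products covered by
  the induction hypothesis.\<close>

lemma Ck_on_compose:
  fixes f :: "'a::real_normed_vector \<Rightarrow> 'b::euclidean_space"
  shows "Ck_on k f U \<Longrightarrow> Ck_on k g V \<Longrightarrow> f ` U \<subseteq> V \<Longrightarrow> Ck_on k (\<lambda>x. g (f x)) U"
proof (induction k arbitrary: f g)
  case 0
  then show ?case by (auto intro: continuous_on_compose2)
next
  case (Suc k)
  obtain D where D: "\<And>x. x \<in> U \<Longrightarrow> (f has_derivative D x) (at x)" "\<And>v. Ck_on k (\<lambda>x. D x v) U"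
    using Ck_on_SucE[OF Suc.prems(1)] by blast
  obtain D' where D': "\<And>x. x \<in> V \<Longrightarrow> (g has_derivative D' x) (at x)" "\<And>v. Ck_on k (\<lambda>x. D' x v) V"
    using Ck_on_SucE[OF Suc.prems(2)] by blast
  have V: "f x \<in> V" if "x \<in> U" for x
    using Suc.prems(3) that by blast
  have *: "D' (f x) (D x v) = (\<Sum>b\<in>Basis. (D x v \<bullet> b) *\<^sub>R D' (f x) b)" if "x \<in> U" for x v
  proof -
    have "linear (D' (f x))"
      using D'(1)[OF V[OF that]] has_derivative_linear by blast
    then have "D' (f x) (\<Sum>b\<in>Basis. (D x v \<bullet> b) *\<^sub>R b) = (\<Sum>b\<in>Basis. (D x v \<bullet> b) *\<^sub>R D' (f x) b)"
      by (simp add: linear_sum linear_cmul)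
    then show ?thesis by (simp add: euclidean_representation)
  qed
  have f: "Ck_on k f U"
    using Suc.prems(1) by (rule Ck_on_SucD)
  have 1: "Ck_on k (\<lambda>x. \<Sum>b\<in>Basis. (D x v \<bullet> b) *\<^sub>R D' (f x) b) U" for v
    by (intro Ck_on_sum Ck_on_bilinear[OF bounded_bilinear_scaleR]
        Ck_on_bounded_linear_compose[OF bounded_linear_inner_left] D(2)
        Suc.IH[OF f D'(2) Suc.prems(3)])
  have "((\<lambda>x. g (f x)) has_derivative (\<lambda>v. \<Sum>b\<in>Basis. (D x v \<bullet> b) *\<^sub>R D' (f x) b)) (at x)"
    if "x \<in> U" for x
    using has_derivative_compose[OF D(1)[OF that] D'(1)[OF V[OF that]]] *[OF that] by simp
  from Ck_on_SucI[OF this 1] show ?case .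
qed

lemma smooth_on_Ck: "smooth_on f U \<Longrightarrow> Ck_on k f U"
  by (simp add: smooth_on_def)

lemma smooth_on_subset: "smooth_on f U \<Longrightarrow> V \<subseteq> U \<Longrightarrow> smooth_on f V"
  by (auto simp: smooth_on_def intro: Ck_on_subset)

lemma smooth_on_cong: "open U \<Longrightarrow> (\<And>x. x \<in> U \<Longrightarrow> f x = g x) \<Longrightarrow> smooth_on f U \<Longrightarrow> smooth_on g U"
  unfolding smooth_on_def using Ck_on_cong by blast

lemma smooth_on_const: "smooth_on (\<lambda>x. c) U"
  by (simp add: smooth_on_def Ck_on_const)

lemma smooth_on_bounded_linear: "bounded_linear h \<Longrightarrow> smooth_on h U"
  by (simp add: smooth_on_def Ck_on_bounded_linear)

lemma smooth_on_id: "smooth_on (\<lambda>x. x) U"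
  by (simp add: smooth_on_bounded_linear)

lemma smooth_on_bounded_linear_compose:
  "bounded_linear h \<Longrightarrow> smooth_on f U \<Longrightarrow> smooth_on (\<lambda>x. h (f x)) U"
  by (simp add: smooth_on_def Ck_on_bounded_linear_compose)

lemma smooth_on_add: "smooth_on f U \<Longrightarrow> smooth_on g U \<Longrightarrow> smooth_on (\<lambda>x. f x + g x) U"
  by (simp add: smooth_on_def Ck_on_add)

lemma smooth_on_bilinear:
  "bounded_bilinear B \<Longrightarrow> smooth_on f U \<Longrightarrow> smooth_on g U \<Longrightarrow> smooth_on (\<lambda>x. B (f x) (g x)) U"
  by (simp add: smooth_on_def Ck_on_bilinear)

lemmas smooth_on_mult = smooth_on_bilinear[OF bounded_bilinear_mult]
lemmas smooth_on_scaleR = smooth_on_bilinear[OF bounded_bilinear_scaleR]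
lemmas smooth_on_inner = smooth_on_bilinear[OF bounded_bilinear_inner]

lemma smooth_on_uminus: "smooth_on f U \<Longrightarrow> smooth_on (\<lambda>x. - f x) U"
  by (rule smooth_on_bounded_linear_compose[OF bounded_linear_minus[OF bounded_linear_ident]])

lemma smooth_on_diff: "smooth_on f U \<Longrightarrow> smooth_on g U \<Longrightarrow> smooth_on (\<lambda>x. f x - g x) U"
  using smooth_on_add[OF _ smooth_on_uminus] by simp

lemma smooth_on_sum: "(\<And>i. i \<in> I \<Longrightarrow> smooth_on (f i) U) \<Longrightarrow> smooth_on (\<lambda>x. \<Sum>i\<in>I. f i x) U"
  by (simp add: smooth_on_def Ck_on_sum)

lemma smooth_on_compose:
  fixes f :: "'a::real_normed_vector \<Rightarrow> 'b::euclidean_space"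
  shows "smooth_on f U \<Longrightarrow> smooth_on g V \<Longrightarrow> f ` U \<subseteq> V \<Longrightarrow> smooth_on (\<lambda>x. g (f x)) U"
  unfolding smooth_on_def using Ck_on_compose by blast

lemma smooth_on_Pair:
  assumes "smooth_on f U" "smooth_on g U"
  shows "smooth_on (\<lambda>x. (f x, g x)) U"
proof -
  have "smooth_on (\<lambda>x. (f x, 0) + (0, g x)) U"
    using assms
    by (intro smooth_on_add
        smooth_on_bounded_linear_compose[OF bounded_linear_Pair[OF bounded_linear_ident bounded_linear_zero], where f = f]
        smooth_on_bounded_linear_compose[OF bounded_linear_Pair[OF bounded_linear_zero bounded_linear_ident], where f = g])
  then show ?thesis by simp
qed

lemma bounded_linear_axis: "bounded_linear (\<lambda>x::'a::euclidean_space. axis j x)"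
  by (auto simp: linear_conv_bounded_linear[symmetric] axis_def vec_eq_iff intro!: linearI)

lemma smooth_on_vec_lambda:
  fixes f :: "'n::finite \<Rightarrow> 'a::real_normed_vector \<Rightarrow> 'b::euclidean_space"
  assumes "\<And>j. smooth_on (f j) U"
  shows "smooth_on (\<lambda>x. \<chi> j. f j x) U"
proof -
  have "smooth_on (\<lambda>x. \<Sum>j\<in>UNIV. axis j (f j x)) U"
    by (intro smooth_on_sum smooth_on_bounded_linear_compose[OF bounded_linear_axis] assms)
  moreover have "(\<Sum>j\<in>UNIV. axis j (f j x)) = (\<chi> j. f j x)" for x
    by (simp add: vec_eq_iff axis_def)
  ultimately show ?thesis by simp
qed

lemma smooth_on_vec_nth:
  fixes f :: "'a::real_normed_vector \<Rightarrow> 'b::real_normed_vector ^ 'n::finite"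
  shows "smooth_on f U \<Longrightarrow> smooth_on (\<lambda>x. f x $ j) U"
  by (rule smooth_on_bounded_linear_compose[OF bounded_linear_vec_nth])

lemma smooth_on_holomorphic:
  assumes "open U" "f holomorphic_on U"
  shows "smooth_on f U"
proof -
  \<comment> \<open>The derivative in direction \<open>v\<close> is \<open>v\<close> times
    \<open>deriv f\<close>, so a constant factor has to be carried through the induction.\<close>
  have "Ck_on k (\<lambda>z. c * f z) U" if "f holomorphic_on U" for k f c
    using that
  proof (induction k arbitrary: f c)
    case 0
    then show ?case
      by (simp add: holomorphic_on_imp_continuous_on continuous_on_mult_left)
  next
    case (Suc k)
    have "((\<lambda>z. c * f z) has_derivative (\<lambda>v. (c * v) * deriv f z)) (at z)" if "z \<in> U" for z
      using has_field_derivative_imp_has_derivative[OF holomorphic_derivI[OF Suc.prems assms(1) that],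
          THEN has_derivative_mult_right, of c]
      by (simp add: mult_ac)
    moreover have "Ck_on k (\<lambda>z. (c * v) * deriv f z) U" for v
      using Suc.IH[of "deriv f" "c * v"] Suc.prems assms(1) by (simp add: holomorphic_deriv)
    ultimately show ?case
      by (auto intro!: exI[of _ "\<lambda>z v. (c * v) * deriv f z"])
  qed
  from this[OF assms(2), of _ 1] show ?thesis
    by (simp add: smooth_on_def)
qed

lemma smooth_on_holomorphic_compose:
  assumes "open V" "g holomorphic_on V" "smooth_on f U" "f ` U \<subseteq> V"
  shows "smooth_on (\<lambda>x. g (f x)) U"
  by (rule smooth_on_compose[OF assms(3) smooth_on_holomorphic[OF assms(1,2)] assms(4)])

lemma smooth_on_of_real: "smooth_on f U \<Longrightarrow> smooth_on (\<lambda>x. complex_of_real (f x)) U"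
  by (rule smooth_on_bounded_linear_compose[OF bounded_linear_of_real])

text \<open>The principal complex root is holomorphic off the nonpositive axis, which replaces an
  induction over the derivatives of the real root.\<close>

lemma smooth_on_sqrt: "smooth_on sqrt {0<..}"
proof -
  have "smooth_on (\<lambda>x. csqrt (complex_of_real x)) {0<..}"
    by (rule smooth_on_holomorphic_compose[where V = "- \<real>\<^sub>\<le>\<^sub>0"])
      (auto intro: holomorphic_on_csqrt smooth_on_of_real[OF smooth_on_id] simp: complex_nonpos_Reals_iff)
  then have "smooth_on (\<lambda>x. Re (csqrt (complex_of_real x))) {0<..}"
    by (rule smooth_on_bounded_linear_compose[OF bounded_linear_Re])
  then show ?thesis
    by (rule smooth_on_cong[rotated 2]) auto
qed

lemma smooth_on_sqrt_compose:
  "smooth_on f U \<Longrightarrow> (\<And>x. x \<in> U \<Longrightarrow> 0 < f x) \<Longrightarrow> smooth_on (\<lambda>x. sqrt (f x)) U"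
  by (rule smooth_on_compose[OF _ smooth_on_sqrt]) auto

lemma smooth_on_cis:
  assumes "smooth_on f U"
  shows "smooth_on (\<lambda>x. cis (f x)) U"
proof -
  have "smooth_on (\<lambda>x. exp (\<i> * complex_of_real (f x))) U"
    by (rule smooth_on_holomorphic_compose[where V = UNIV])
      (auto intro: holomorphic_on_exp smooth_on_mult[OF smooth_on_const smooth_on_of_real[OF assms]])
  then show ?thesis by (simp add: cis_conv_exp)
qed

lemma smooth_on_cos:
  fixes f :: "'a::real_normed_vector \<Rightarrow> real"
  assumes "smooth_on f U"
  shows "smooth_on (\<lambda>x. cos (f x)) U"
proof -
  have "smooth_on (\<lambda>x. Re (cis (f x))) U"
    by (rule smooth_on_bounded_linear_compose[OF bounded_linear_Re smooth_on_cis[OF assms]])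
  then show ?thesis by simp
qed

lemma smooth_on_sin:
  fixes f :: "'a::real_normed_vector \<Rightarrow> real"
  assumes "smooth_on f U"
  shows "smooth_on (\<lambda>x. sin (f x)) U"
proof -
  have "smooth_on (\<lambda>x. Im (cis (f x))) U"
    by (rule smooth_on_bounded_linear_compose[OF bounded_linear_Im smooth_on_cis[OF assms]])
  then show ?thesis by simp
qed

lemma smooth_on_derivative:
  assumes "smooth_on f U"
  obtains D where "\<And>x. x \<in> U \<Longrightarrow> (f has_derivative D x) (at x)" "\<And>v. continuous_on U (\<lambda>x. D x v)"
  using smooth_on_Ck[OF assms, of "Suc 0"] by auto

section \<open>Tangent spaces\<close>

lemma has_vector_derivative_along_curve:
  assumes f: "(f has_derivative D) (at (\<gamma> 0) within X)" and "0 < e" "\<gamma> ` {-e<..<e::real} \<subseteq> X"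
    and g: "(\<gamma> has_vector_derivative v) (at 0)"
  shows "((\<lambda>t. f (\<gamma> t)) has_vector_derivative D v) (at 0)"
proof -
  have "(\<gamma> has_derivative (\<lambda>t. t *\<^sub>R v)) (at 0 within {-e<..<e})"
    using g by (simp add: has_vector_derivative_def has_derivative_at_withinI)
  then have "((\<lambda>t. f (\<gamma> t)) has_derivative (\<lambda>t. D (t *\<^sub>R v))) (at 0 within {-e<..<e})"
    by (rule has_derivative_in_compose) (rule has_derivative_subset[OF f assms(3)])
  then show ?thesis
    using assms(2) has_derivative_linear[OF f]
    by (simp add: has_vector_derivative_def linear_cmul at_within_open[of 0 "{-e<..<e}"])
qed

lemma tangent_spaceE:
  assumes "v \<in> tangent_space X x"
  obtains \<gamma> e where "0 < e" "smooth_on \<gamma> {-e<..<e::real}" "\<gamma> ` {-e<..<e} \<subseteq> X" "\<gamma> 0 = x"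
    "(\<gamma> has_vector_derivative v) (at 0)"
  using assms by (auto simp: tangent_space_def)

lemma tangent_spaceI:
  assumes "0 < e" "smooth_on \<gamma> {-e<..<e::real}" "\<gamma> ` {-e<..<e} \<subseteq> X" "\<gamma> 0 = x"
    "(\<gamma> has_vector_derivative v) (at 0)"
  shows "v \<in> tangent_space X x"
  using assms by (auto simp: tangent_space_def)

text \<open>A derivative within \<open>X\<close> is arbitrary in directions transverse to
  \<open>X\<close>, but tangent vectors are velocities of curves in \<open>X\<close>, along which
  the chain rule leaves only one value. Later arguments differentiate one map in two ways and
  compare the results with this.\<close>

lemma tangent_space_derivative_unique:
  assumes "(f has_derivative D) (at x within X)" "(f has_derivative D') (at x within X)"
    "v \<in> tangent_space X x"
  shows "D v = D' v"
proof -
  obtain \<gamma> e where g: "0 < e" "\<gamma> ` {-e<..<e::real} \<subseteq> X" "\<gamma> 0 = x" "(\<gamma> has_vector_derivative v) (at 0)"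
    using tangent_spaceE[OF assms(3)] by blast
  have "((\<lambda>t. f (\<gamma> t)) has_vector_derivative D v) (at 0)"
    using has_vector_derivative_along_curve[of f D \<gamma>, OF _ g(1,2,4)] assms(1) g(3) by simp
  moreover have "((\<lambda>t. f (\<gamma> t)) has_vector_derivative D' v) (at 0)"
    using has_vector_derivative_along_curve[of f D' \<gamma>, OF _ g(1,2,4)] assms(2) g(3) by simp
  ultimately show ?thesis by (rule vector_derivative_unique_at)
qed

lemma tangent_space_Times:
  fixes A :: "'a::real_normed_vector set" and B :: "'b::real_normed_vector set"
  shows "tangent_space (A \<times> B) (x, y) = tangent_space A x \<times> tangent_space B y"
proof (intro set_eqI iffI)
  fix w assume "w \<in> tangent_space (A \<times> B) (x, y)"
  then obtain \<gamma> e where g: "0 < e" "smooth_on \<gamma> {-e<..<e::real}" "\<gamma> ` {-e<..<e} \<subseteq> A \<times> B"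
    "\<gamma> 0 = (x, y)" "(\<gamma> has_vector_derivative w) (at 0)"
    by (rule tangent_spaceE)
  have *: "\<gamma> t \<in> A \<times> B" if "t \<in> {-e<..<e}" for t
    using g(3) that by blast
  have "fst w \<in> tangent_space A x"
    using g(1) smooth_on_bounded_linear_compose[OF bounded_linear_fst g(2)]
  proof (rule tangent_spaceI)
    show "(\<lambda>t. fst (\<gamma> t)) ` {-e<..<e} \<subseteq> A"
      using * by (auto simp: mem_Times_iff)
  qed (use g(4) bounded_linear.has_vector_derivative[OF bounded_linear_fst g(5)] in auto)
  moreover have "snd w \<in> tangent_space B y"
    using g(1) smooth_on_bounded_linear_compose[OF bounded_linear_snd g(2)]
  proof (rule tangent_spaceI)
    show "(\<lambda>t. snd (\<gamma> t)) ` {-e<..<e} \<subseteq> B"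
      using * by (auto simp: mem_Times_iff)
  qed (use g(4) bounded_linear.has_vector_derivative[OF bounded_linear_snd g(5)] in auto)
  ultimately show "w \<in> tangent_space A x \<times> tangent_space B y"
    by (simp add: mem_Times_iff)
next
  fix w assume "w \<in> tangent_space A x \<times> tangent_space B y"
  then obtain u v where w: "w = (u, v)" and u: "u \<in> tangent_space A x" and v: "v \<in> tangent_space B y"
    by auto
  obtain \<gamma> e where g: "0 < e" "smooth_on \<gamma> {-e<..<e::real}" "\<gamma> ` {-e<..<e} \<subseteq> A"
    "\<gamma> 0 = x" "(\<gamma> has_vector_derivative u) (at 0)"
    using u by (rule tangent_spaceE)
  obtain \<delta> d where d: "0 < d" "smooth_on \<delta> {-d<..<d::real}" "\<delta> ` {-d<..<d} \<subseteq> B"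
    "\<delta> 0 = y" "(\<delta> has_vector_derivative v) (at 0)"
    using v by (rule tangent_spaceE)
  define c where "c = min e d"
  have c: "0 < c" "{-c<..<c} \<subseteq> {-e<..<e}" "{-c<..<c} \<subseteq> {-d<..<d}"
    using g(1) d(1) by (auto simp: c_def)
  show "w \<in> tangent_space (A \<times> B) (x, y)"
    using c(1) smooth_on_Pair[OF smooth_on_subset[OF g(2) c(2)] smooth_on_subset[OF d(2) c(3)]]
  proof (rule tangent_spaceI)
    show "(\<lambda>t. (\<gamma> t, \<delta> t)) ` {-c<..<c} \<subseteq> A \<times> B"
      using g(3) d(3) c(2,3) by blast
    show "(\<gamma> 0, \<delta> 0) = (x, y)"
      using g(4) d(4) by simp
    show "((\<lambda>t. (\<gamma> t, \<delta> t)) has_vector_derivative w) (at 0)"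
      unfolding w using g(5) d(5) by (rule has_vector_derivative_Pair)
  qed
qed

lemma tangent_space_open:
  assumes "open W" "x \<in> W"
  shows "tangent_space W x = UNIV"
proof -
  have "v \<in> tangent_space W x" for v
  proof -
    have "isCont (\<lambda>t. x + t *\<^sub>R v) (0::real)"
      by (intro continuous_intros)
    then have "\<forall>\<^sub>F t in at 0. x + t *\<^sub>R v \<in> W"
      using assms topological_tendstoD[of "\<lambda>t. x + t *\<^sub>R v" x "at 0" W] by (simp add: isCont_def)
    then obtain e where e: "e > 0" "\<And>t. t \<noteq> 0 \<Longrightarrow> dist t 0 < e \<Longrightarrow> x + t *\<^sub>R v \<in> W"
      by (auto simp: eventually_at)
    have "x + t *\<^sub>R v \<in> W" if "t \<in> {-e<..<e}" for t
      using e(2)[of t] that assms(2) by (cases "t = 0") auto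
    moreover have "((\<lambda>t. x + t *\<^sub>R v) has_vector_derivative v) (at 0)"
      by (auto intro!: derivative_eq_intros)
    moreover have "smooth_on (\<lambda>t. x + t *\<^sub>R v) {-e<..<e}"
      by (intro smooth_on_add smooth_on_const smooth_on_bounded_linear bounded_linear_scaleR_left)
    ultimately show ?thesis
      using e(1) by (intro tangent_spaceI[of e "\<lambda>t. x + t *\<^sub>R v"]) auto
  qed
  then show ?thesis by auto
qed

lemma tangent_space_sphere:
  fixes x :: "'a::euclidean_space"
  assumes "x \<in> sphere 0 1"
  shows "tangent_space (sphere 0 1) x = {v. x \<bullet> v = 0}"
proof (intro set_eqI iffI)
  fix v assume "v \<in> tangent_space (sphere 0 1) x"
  then obtain \<gamma> e where g: "0 < e" "\<gamma> ` {-e<..<e::real} \<subseteq> sphere 0 1"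
    "\<gamma> 0 = x" "(\<gamma> has_vector_derivative v) (at 0)"
    by (rule tangent_spaceE)
  have 1: "((\<lambda>t. \<gamma> t \<bullet> \<gamma> t) has_vector_derivative (\<gamma> 0 \<bullet> v + v \<bullet> \<gamma> 0)) (at 0)"
    by (rule bounded_bilinear.has_vector_derivative[OF bounded_bilinear_inner g(4,4)])
  have 2: "\<gamma> t \<bullet> \<gamma> t = 1" if "t \<in> {-e<..<e}" for t
  proof -
    have "norm (\<gamma> t) = 1"
      using g(2) that by (metis image_subset_iff mem_sphere_0)
    then show ?thesis by (simp add: dot_square_norm)
  qed
  have "((\<lambda>t. \<gamma> t \<bullet> \<gamma> t) has_vector_derivative 0) (at 0)"
    by (rule has_vector_derivative_transform_within_open[OF has_vector_derivative_const[of 1]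
          open_greaterThanLessThan, of 0 "-e" e]) (use g(1) 2 in auto)
  then have "\<gamma> 0 \<bullet> v + v \<bullet> \<gamma> 0 = 0"
    using 1 vector_derivative_unique_at by blast
  then show "v \<in> {v. x \<bullet> v = 0}" using g by (simp add: inner_commute)
next
  fix v assume "v \<in> {v. x \<bullet> v = 0}"
  then have xv: "x \<bullet> v = 0" by simp
  have xx: "x \<bullet> x = 1" using assms by (simp add: dot_square_norm)
  \<comment> \<open>The great circle with initial velocity \<open>v\<close>. For
    \<open>v = 0\<close> the quotient is 0 and the curve is constant.\<close>
  define \<gamma> where "\<gamma> = (\<lambda>t::real. cos (norm v * t) *\<^sub>R x + sin (norm v * t) *\<^sub>R (v /\<^sub>R norm v))"
  have "\<gamma> t \<bullet> \<gamma> t = 1" for t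
  proof (cases "v = 0")
    case True
    then show ?thesis using xx by (simp add: \<gamma>_def)
  next
    case False
    have "\<gamma> t \<bullet> \<gamma> t = cos (norm v * t) ^ 2 + sin (norm v * t) ^ 2 * ((v \<bullet> v) / (norm v)\<^sup>2)"
      using xv xx unfolding \<gamma>_def
      by (simp add: inner_add_left inner_add_right inner_commute power2_eq_square divide_simps)
    then show ?thesis using False by (simp add: dot_square_norm)
  qed
  then have "\<gamma> ` {-1<..<1} \<subseteq> sphere 0 1"
    by (auto simp: norm_eq_1)
  moreover have "(\<gamma> has_vector_derivative v) (at 0)"
    unfolding \<gamma>_def by (cases "v = 0") (auto intro!: derivative_eq_intros)
  moreover have "smooth_on \<gamma> {-1<..<1}"
    unfolding \<gamma>_def
    by (intro smooth_on_add smooth_on_scaleR smooth_on_const smooth_on_sin smooth_on_cos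
        smooth_on_mult smooth_on_id)
  ultimately show "v \<in> tangent_space (sphere 0 1) x"
    by (intro tangent_spaceI[of 1 \<gamma>]) (auto simp: \<gamma>_def)
qed

section \<open>Special Lagrangian immersions of submanifolds\<close>

text \<open>A continuous field of projections stands in for charts: it carries a frame at one point
  to the neighbouring tangent spaces, and it passes to products.\<close>

definition tangent_projection ::
  "'a::euclidean_space set \<Rightarrow> ('a \<Rightarrow> 'a \<Rightarrow> 'a) \<Rightarrow> nat \<Rightarrow> bool" where
  "tangent_projection X P d \<longleftrightarrow>
     (\<forall>v. continuous_on X (\<lambda>x. P x v)) \<and>
     (\<forall>x\<in>X. (\<forall>v. P x v \<in> tangent_space X x) \<and> (\<forall>v\<in>tangent_space X x. P x v = v) \<and>
        subspace (tangent_space X x) \<and> dim (tangent_space X x) = d)"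

lemma tangent_projection_open:
  "open W \<Longrightarrow> tangent_projection (W::'a::euclidean_space set) (\<lambda>x v. v) DIM('a)"
  by (simp add: tangent_projection_def tangent_space_open dim_UNIV)

lemma tangent_projection_sphere:
  "tangent_projection (sphere (0::'a::euclidean_space) 1) (\<lambda>x v. v - (x \<bullet> v) *\<^sub>R x) (DIM('a) - 1)"
  unfolding tangent_projection_def
proof (intro conjI allI ballI)
  show "continuous_on (sphere 0 1) (\<lambda>x::'a. v - (x \<bullet> v) *\<^sub>R x)" for v
    by (intro continuous_intros)
next
  fix x :: 'a assume x: "x \<in> sphere 0 1"
  have xx: "x \<bullet> x = 1" using x by (simp add: dot_square_norm)
  show "v - (x \<bullet> v) *\<^sub>R x \<in> tangent_space (sphere 0 1) x" for v
    by (simp add: tangent_space_sphere[OF x] inner_diff_right xx)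
  show "v - (x \<bullet> v) *\<^sub>R x = v" if "v \<in> tangent_space (sphere 0 1) x" for v
    using that by (simp add: tangent_space_sphere[OF x])
  show "subspace (tangent_space (sphere 0 1) x)"
    by (simp add: tangent_space_sphere[OF x] subspace_hyperplane)
  show "dim (tangent_space (sphere 0 1) x) = DIM('a) - 1"
  proof -
    have "x \<noteq> 0" using xx by auto
    then show ?thesis by (simp add: tangent_space_sphere[OF x] dim_hyperplane)
  qed
qed

lemma tangent_projection_Times:
  assumes A: "tangent_projection A P d" and B: "tangent_projection B Q e"
  shows "tangent_projection (A \<times> B) (\<lambda>x v. (P (fst x) (fst v), Q (snd x) (snd v))) (d + e)"
  unfolding tangent_projection_def
proof (intro conjI allI ballI)
  fix v
  have "continuous_on A (\<lambda>x. P x (fst v))" "continuous_on B (\<lambda>x. Q x (snd v))"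
    using A B by (auto simp: tangent_projection_def)
  then show "continuous_on (A \<times> B) (\<lambda>x. (P (fst x) (fst v), Q (snd x) (snd v)))"
    by (intro continuous_on_Pair continuous_on_compose2[OF _ continuous_on_fst[OF continuous_on_id]]
        continuous_on_compose2[OF _ continuous_on_snd[OF continuous_on_id]]) auto
next
  fix x assume "x \<in> A \<times> B"
  then obtain a b where x: "x = (a, b)" "a \<in> A" "b \<in> B" by auto
  show "(P (fst x) (fst v), Q (snd x) (snd v)) \<in> tangent_space (A \<times> B) x" for v
    using A B x unfolding tangent_projection_def by (simp add: tangent_space_Times)
  show "(P (fst x) (fst v), Q (snd x) (snd v)) = v" if "v \<in> tangent_space (A \<times> B) x" for v
    using A B x that unfolding tangent_projection_def by (auto simp: tangent_space_Times)
  show "subspace (tangent_space (A \<times> B) x)"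
    using A B x unfolding tangent_projection_def by (simp add: tangent_space_Times subspace_Times)
  show "dim (tangent_space (A \<times> B) x) = d + e"
    using A B x unfolding tangent_projection_def by (simp add: tangent_space_Times dim_Times)
qed

section \<open>Determinants and Gram matrices of complex frames\<close>

lemma det_of_real: "det (\<chi> i j. complex_of_real (M $ i $ j)) = complex_of_real (det M)"
  by (simp add: det_def)

lemma det_cnj: "det (\<chi> i j. cnj (M $ i $ j)) = cnj (det M)"
  by (simp add: det_def)

lemma Hol_vol_sum:
  "Hol_vol (\<lambda>i. \<Sum>j\<in>UNIV. M $ i $ j *\<^sub>R v j) = complex_of_real (det M) * Hol_vol v"
proof -
  have "(\<chi> i j. (\<Sum>k\<in>UNIV. M $ i $ k *\<^sub>R v k) $ j)
      = (\<chi> i j. complex_of_real (M $ i $ j)) ** (\<chi> i j. v i $ j)"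
    by (simp add: vec_eq_iff matrix_matrix_mult_def scaleR_conv_of_real[where 'a = complex])
  then show ?thesis
    by (simp add: Hol_vol_def det_mul det_of_real)
qed

text \<open>Cramer's rule: putting the real combination into row \<open>k\<close> multiplies the
  determinant by \<open>c k\<close>, while that row is zero.\<close>

lemma Hol_vol_nonzero_independent:
  assumes "Hol_vol v \<noteq> 0" "(\<Sum>i\<in>UNIV. c i *\<^sub>R v i) = 0"
  shows "c k = 0"
proof -
  let ?A = "\<chi> i j. v i $ j"
  have "(\<Sum>i\<in>UNIV. (\<chi> i. complex_of_real (c i)) $ i *s row i ?A) = (\<Sum>i\<in>UNIV. c i *\<^sub>R v i)"
    by (simp add: vec_eq_iff row_def scaleR_conv_of_real[where 'a = complex])
  then have "det (\<chi> i. if i = k then 0 else row i ?A) = complex_of_real (c k) * det ?A"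
    using cramer_lemma_transpose[of k "\<chi> i. complex_of_real (c i)" ?A] assms(2)
    by (simp only: vec_lambda_beta)
  then show ?thesis
    using assms(1) det_row_0[of k "\<lambda>i. row i ?A"] by (simp add: Hol_vol_def)
qed

text \<open>Where \<omega> vanishes the Hermitian products of the vectors are real, so the Gram
  matrix is the matrix of the vectors times its conjugate transpose. Hence |\<Omega>| is the volume
  on isotropic frames.\<close>

lemma gram_det:
  assumes "\<And>i j. Im (\<Sum>k\<in>UNIV. v i $ k * cnj (v j $ k)) = 0"
  shows "complex_of_real (det ((\<chi> i j. v i \<bullet> v j) :: real ^ 'n ^ 'n::finite)) = Hol_vol v * cnj (Hol_vol v)"
proof -
  let ?A = "\<chi> i j. v i $ j"
  have "complex_of_real (v i \<bullet> v j) = (\<Sum>k\<in>UNIV. v i $ k * cnj (v j $ k))" for i j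
    using assms[of i j] by (intro complex_eqI) (simp_all add: inner_vec_def inner_complex_def)
  then have "(\<chi> i j. complex_of_real ((\<chi> i j. v i \<bullet> v j) $ i $ j)) = ?A ** transpose (\<chi> i j. cnj (?A $ i $ j))"
    by (simp add: vec_eq_iff matrix_matrix_mult_def transpose_def)
  then have "complex_of_real (det (\<chi> i j. v i \<bullet> v j)) = det (?A ** transpose (\<chi> i j. cnj (?A $ i $ j)))"
    by (metis det_of_real)
  then show ?thesis
    by (simp only: det_mul det_transpose det_cnj Hol_vol_def)
qed

lemma gram_vol_eq_norm:
  assumes "\<And>i j. Im (\<Sum>k\<in>UNIV. v i $ k * cnj (v j $ k)) = 0"
  shows "gram_vol v = cmod (Hol_vol v)"
proof -
  have "complex_of_real (det (\<chi> i j. v i \<bullet> v j)) = complex_of_real ((cmod (Hol_vol v))\<^sup>2)"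
    using gram_det[of v, OF assms] by (metis complex_norm_square)
  then show ?thesis
    by (simp only: gram_vol_def of_real_eq_iff) simp
qed

text \<open>Isotropy upgrades real to complex independence: |\<Omega>|^2 is the determinant of the
  Gram matrix G, and a kernel vector c of G would be a real combination of the vectors with squared
  length c \<bullet> G c = 0.\<close>

lemma Hol_vol_nonzero:
  fixes v :: "'n::finite \<Rightarrow> complex ^ 'n"
  assumes "\<And>i j. Im (\<Sum>k\<in>UNIV. v i $ k * cnj (v j $ k)) = 0"
    and ind: "\<And>c. (\<Sum>i\<in>UNIV. c i *\<^sub>R v i) = 0 \<Longrightarrow> (\<forall>i. c i = 0)"
  shows "Hol_vol v \<noteq> 0"
proof
  assume "Hol_vol v = 0"
  let ?G = "(\<chi> i j. v i \<bullet> v j) :: real ^ 'n ^ 'n"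
  have "det ?G = 0"
    using gram_det[of v, OF assms(1)] \<open>Hol_vol v = 0\<close> by simp
  then have "\<not> inj ((*v) ?G)"
    using det_nz_iff_inj[of "(*v) ?G"] by simp
  then obtain x y where "?G *v x = ?G *v y" "x \<noteq> y"
    by (auto simp: inj_def)
  then have z: "?G *v (x - y) = 0" "x - y \<noteq> 0"
    by (auto simp: matrix_vector_mult_diff_distrib)
  define c where "c = x - y"
  have "(\<Sum>i\<in>UNIV. c $ i *\<^sub>R v i) \<bullet> (\<Sum>i\<in>UNIV. c $ i *\<^sub>R v i)
      = (\<Sum>i\<in>UNIV. \<Sum>j\<in>UNIV. c $ i * (c $ j * (v i \<bullet> v j)))"
    by (simp add: inner_sum_left inner_sum_right sum_distrib_left)
      (intro sum.cong refl, simp add: inner_commute)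
  also have "\<dots> = c \<bullet> (?G *v c)"
    unfolding inner_vec_def[of c] matrix_vector_mult_def
    by (simp add: sum_distrib_left mult_ac)
  finally have "(\<Sum>i\<in>UNIV. c $ i *\<^sub>R v i) \<bullet> (\<Sum>i\<in>UNIV. c $ i *\<^sub>R v i) = c \<bullet> (?G *v c)" .
  then have "(\<Sum>i\<in>UNIV. c $ i *\<^sub>R v i) = 0"
    using z by (simp add: c_def)
  then have "c = 0"
    using ind by (simp add: vec_eq_iff)
  then show False using z(2) by (simp add: c_def)
qed

lemma continuous_on_Hol_vol:
  "(\<And>i. continuous_on U (\<lambda>x. v x i)) \<Longrightarrow> continuous_on U (\<lambda>x. Hol_vol (v x))"
  unfolding Hol_vol_def det_def vec_lambda_beta
  by (intro continuous_on_sum continuous_on_mult continuous_on_const continuous_on_prod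
      continuous_on_component)

section \<open>Frames of tangent spaces\<close>

lemma tangent_frameI:
  fixes e :: "'n::finite \<Rightarrow> 'a::euclidean_space"
  assumes T: "subspace (tangent_space X x)" "dim (tangent_space X x) = CARD('n)"
    and e: "\<And>i. e i \<in> tangent_space X x"
    and ind: "\<And>c. (\<Sum>i\<in>UNIV. c i *\<^sub>R e i) = 0 \<Longrightarrow> (\<forall>i. c i = 0)"
  shows "tangent_frame X x e"
proof -
  have inj: "inj e"
  proof (rule injI, rule ccontr)
    fix i j assume ij: "e i = e j" "i \<noteq> j"
    have "(\<Sum>k\<in>UNIV. ((if k = i then 1 else 0) - (if k = j then 1 else 0)) *\<^sub>R e k) = e i - e j"
      by (simp add: scaleR_left_diff_distrib sum_subtractf if_distrib[of "\<lambda>c. c *\<^sub>R _"] cong: if_cong)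
    then have "\<forall>k. (if k = i then 1 else 0) - (if k = j then 1 else 0) = (0::real)"
      by (intro ind) (use ij(1) in simp)
    from spec[OF this, of i] show False using ij(2) by simp
  qed
  have ind': "independent (range e)"
  proof
    assume "dependent (range e)"
    then obtain u where u: "\<exists>v\<in>range e. u v \<noteq> 0" "(\<Sum>v\<in>range e. u v *\<^sub>R v) = 0"
      by (auto simp: dependent_finite)
    have "(\<Sum>i\<in>UNIV. u (e i) *\<^sub>R e i) = 0"
      using u(2) inj by (simp add: sum.reindex)
    from spec[OF ind[OF this]] show False using u(1) by auto
  qed
  have "span (range e) = tangent_space X x"
  proof (rule subspace_dim_equal[OF subspace_span T(1)])
    show "span (range e) \<subseteq> tangent_space X x"
      using e T(1) by (intro span_minimal) auto
    show "dim (tangent_space X x) \<le> dim (span (range e))"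
      using T(2) ind' inj by (simp add: dim_eq_card_independent card_image)
  qed
  with inj ind' show ?thesis by (simp add: tangent_frame_def)
qed

lemma tangent_frame_exists:
  assumes "subspace (tangent_space X x)" "dim (tangent_space X x) = CARD('n)"
  obtains e :: "'n::finite \<Rightarrow> 'a::euclidean_space" where "tangent_frame X x e"
proof -
  obtain B where B: "finite B" "independent B" "span B = tangent_space X x" "card B = dim (tangent_space X x)"
    using basis_subspace_exists[OF assms(1)] by metis
  then obtain e where "bij_betw e (UNIV::'n set) B"
    using assms(2) by (metis finite_class.finite_UNIV finite_same_card_bij)
  then have "tangent_frame X x e"
    using B by (auto simp: tangent_frame_def bij_betw_def)
  then show ?thesis using that by blast
qed

lemma tangent_frame_independent:
  fixes e :: "'n::finite \<Rightarrow> 'a::euclidean_space"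
  assumes "tangent_frame X x e" "(\<Sum>i\<in>UNIV. c i *\<^sub>R e i) = 0"
  shows "c k = 0"
proof (rule ccontr)
  assume k: "c k \<noteq> 0"
  have e: "inj e" "independent (range e)"
    using assms(1) by (auto simp: tangent_frame_def)
  have "(\<Sum>v\<in>range e. c (inv e v) *\<^sub>R v) = 0"
    using assms(2) e(1) by (simp add: sum.reindex)
  moreover have "c (inv e (e k)) \<noteq> 0"
    using k e(1) by simp
  ultimately have "dependent (range e)"
    unfolding dependent_finite[OF finite_imageI[OF finite_class.finite_UNIV]]
    by (intro exI[of _ "\<lambda>v. c (inv e v)"] conjI bexI[of _ "e k"]) auto
  then show False using e(2) by simp
qed

lemma tangent_frame_coefficients:
  fixes e :: "'n::finite \<Rightarrow> 'a::euclidean_space"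
  assumes "tangent_frame X x e" "v \<in> tangent_space X x"
  obtains c where "v = (\<Sum>i\<in>UNIV. c i *\<^sub>R e i)"
proof -
  have "v \<in> span (range e)"
    using assms by (simp add: tangent_frame_def)
  then obtain c where "v = (\<Sum>w\<in>range e. c w *\<^sub>R w)"
    using span_finite[of "range e"] by auto
  then have "v = (\<Sum>i\<in>UNIV. c (e i) *\<^sub>R e i)"
    using assms(1) by (simp add: tangent_frame_def sum.reindex)
  then show ?thesis by (rule that)
qed


lemma Re_Hol_vol_pos_frame:
  fixes e :: "'n::finite \<Rightarrow> 'a::euclidean_space"
  assumes T: "subspace (tangent_space X x)" "dim (tangent_space X x) = CARD('n)"
    and D: "linear D" and e: "\<And>i. e i \<in> tangent_space X x"
    and H: "Hol_vol (\<lambda>i. D (e i)) \<noteq> 0"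
  shows "tangent_frame X x e"
proof (rule tangent_frameI[OF T e], intro allI)
  fix c k assume "(\<Sum>i\<in>UNIV. c i *\<^sub>R e i) = 0"
  then have "(\<Sum>i\<in>UNIV. c i *\<^sub>R D (e i)) = 0"
    using linear_sum[OF D, of "\<lambda>i. c i *\<^sub>R e i" UNIV] linear_0[OF D] by (simp add: linear_cmul[OF D])
  with H show "c k = 0" by (rule Hol_vol_nonzero_independent)
qed

lemma Hol_vol_linear_sum:
  assumes D: "linear D"
  shows "Hol_vol (\<lambda>i. D (\<Sum>j\<in>UNIV. M $ i $ j *\<^sub>R e j)) = complex_of_real (det M) * Hol_vol (\<lambda>i. D (e i))"
proof -
  have "D (\<Sum>j\<in>UNIV. M $ i $ j *\<^sub>R e j) = (\<Sum>j\<in>UNIV. M $ i $ j *\<^sub>R D (e j))" for i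
    using linear_sum[OF D, of "\<lambda>j. M $ i $ j *\<^sub>R e j" UNIV] by (simp add: linear_cmul[OF D])
  then show ?thesis by (simp add: Hol_vol_sum)
qed

text \<open>The orientation-free form of the calibration condition at one point. The imaginary part
  of the Hermitian product is \<omega> up to sign.\<close>

definition SL_at :: "'a::real_normed_vector set \<Rightarrow> ('a \<Rightarrow> complex ^ 'n::finite) \<Rightarrow> 'a \<Rightarrow> bool" where
  "SL_at X D x \<longleftrightarrow> (\<forall>v\<in>tangent_space X x. D v = 0 \<longrightarrow> v = 0) \<and>
     (\<forall>v\<in>tangent_space X x. \<forall>w\<in>tangent_space X x. Im (\<Sum>k\<in>UNIV. D v $ k * cnj (D w $ k)) = 0) \<and>
     (\<forall>e. (\<forall>i. e i \<in> tangent_space X x) \<longrightarrow> Im (Hol_vol (\<lambda>i. D (e i))) = 0)"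

lemma SL_atD:
  assumes "SL_at X D x"
  shows "v \<in> tangent_space X x \<Longrightarrow> D v = 0 \<Longrightarrow> v = 0"
    and "v \<in> tangent_space X x \<Longrightarrow> w \<in> tangent_space X x \<Longrightarrow> Im (\<Sum>k\<in>UNIV. D v $ k * cnj (D w $ k)) = 0"
    and "(\<And>i. e i \<in> tangent_space X x) \<Longrightarrow> Im (Hol_vol (\<lambda>i. D (e i))) = 0"
  using assms unfolding SL_at_def by blast+

lemma smooth_map_on_local_derivative:
  assumes "smooth_map_on X f" "x \<in> X"
  obtains U D where "open U" "x \<in> U" "\<And>y. y \<in> X \<inter> U \<Longrightarrow> (f has_derivative D y) (at y within X)"
    "\<And>v. continuous_on U (\<lambda>y. D y v)"
proof -
  from assms have "\<exists>U g. open U \<and> x \<in> U \<and> smooth_on g U \<and> (\<forall>y\<in>X \<inter> U. f y = g y)"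
    unfolding smooth_map_on_def by (rule bspec)
  then obtain U g where U: "open U" "x \<in> U" "smooth_on g U" "\<forall>y\<in>X \<inter> U. f y = g y"
    by (elim exE conjE)
  obtain D where D: "\<And>y. y \<in> U \<Longrightarrow> (g has_derivative D y) (at y)" "\<And>v. continuous_on U (\<lambda>y. D y v)"
    using smooth_on_derivative[OF U(3)] that by metis
  have "(f has_derivative D y) (at y within X)" if y: "y \<in> X \<inter> U" for y
  proof -
    have "(g has_derivative D y) (at y within X)"
      using y by (intro has_derivative_at_withinI[OF D(1)]) simp
    moreover obtain d where "d > 0" "ball y d \<subseteq> U"
      using U(1) y by (meson IntD2 openE)
    ultimately show ?thesis
      using U(4) y
      by (intro has_derivative_transform_within[of g "D y" y X d f]) (auto simp: dist_commute subset_iff)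
  qed
  from that[OF U(1,2) this D(2)] show ?thesis .
qed

lemma continuous_on_linear_apply:
  fixes D :: "'b::topological_space \<Rightarrow> 'a::euclidean_space \<Rightarrow> 'c::real_normed_vector"
  assumes "\<And>y. y \<in> S \<Longrightarrow> linear (D y)" "\<And>v. continuous_on S (\<lambda>y. D y v)" "continuous_on S p"
  shows "continuous_on S (\<lambda>y. D y (p y))"
proof -
  have "D y (p y) = (\<Sum>b\<in>Basis. (p y \<bullet> b) *\<^sub>R D y b)" if "y \<in> S" for y
  proof -
    have "D y (\<Sum>b\<in>Basis. (p y \<bullet> b) *\<^sub>R b) = (\<Sum>b\<in>Basis. (p y \<bullet> b) *\<^sub>R D y b)"
      using assms(1)[OF that] by (simp add: linear_sum linear_cmul)
    then show ?thesis by (simp add: euclidean_representation)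
  qed
  moreover have "continuous_on S (\<lambda>y. \<Sum>b\<in>Basis. (p y \<bullet> b) *\<^sub>R D y b)"
    using assms(2,3) by (intro continuous_on_sum continuous_on_scaleR continuous_on_inner
        continuous_on_const) auto
  ultimately show ?thesis by (simp cong: continuous_on_cong)
qed

text \<open>
  The orientation consists of the frames on which \<open>Re \<Omega>\<close> is positive. Since \<open>\<Omega>\<close> is real and
  non-zero on every tangent frame, these are one of the two classes of frames; projecting a
  positive frame at one point to the neighbouring tangent spaces gives a continuous positive frame.
\<close>

lemma SL_immersionI:
  fixes X :: "'a::euclidean_space set" and f :: "'a \<Rightarrow> complex ^ 'n::finite"
  assumes smooth: "smooth_map_on X f" and P: "tangent_projection X P CARD('n)"
    and SL: "\<And>x D. x \<in> X \<Longrightarrow> (f has_derivative D) (at x within X) \<Longrightarrow> SL_at X D x"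
  shows "SL_immersion X f"
proof -
  define DD where "DD x = (SOME D. (f has_derivative D) (at x within X))" for x
  have DD: "(f has_derivative DD x) (at x within X)" if "x \<in> X" for x
    using smooth_map_on_local_derivative[OF smooth that] that unfolding DD_def
    by (metis (no_types, lifting) IntI someI_ex)
  have lin: "linear (DD x)" if "x \<in> X" for x
    using DD[OF that] has_derivative_linear by blast
  have T: "subspace (tangent_space X x)" "dim (tangent_space X x) = CARD('n)"
    "P x v \<in> tangent_space X x" "v \<in> tangent_space X x \<Longrightarrow> P x v = v" if "x \<in> X" for x v
    using P that by (auto simp: tangent_projection_def)
  have inj: "inj_on (DD x) (tangent_space X x)" if "x \<in> X" for x
  proof (rule inj_onI)
    fix v w assume vw: "v \<in> tangent_space X x" "w \<in> tangent_space X x" "DD x v = DD x w"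
    have "DD x (v - w) = 0"
      using vw(3) lin[OF that] by (simp add: linear_diff)
    moreover have "v - w \<in> tangent_space X x"
      using vw T(1)[OF that] by (simp add: subspace_diff)
    ultimately show "v = w"
      using SL_atD(1)[OF SL[OF that DD[OF that]]] by fastforce
  qed
  have frame: "e i \<in> tangent_space X x" if "tangent_frame X x e" for x and e :: "'n \<Rightarrow> 'a" and i
    using that span_base[of "e i" "range e"] by (auto simp: tangent_frame_def)
  have nz: "Hol_vol (\<lambda>i. DD x (e i)) \<noteq> 0" if "x \<in> X" "tangent_frame X x e" for x e
  proof (rule Hol_vol_nonzero)
    show "Im (\<Sum>k\<in>UNIV. DD x (e i) $ k * cnj (DD x (e j) $ k)) = 0" for i j
      by (rule SL_atD(2)[OF SL[OF that(1) DD[OF that(1)]] frame[OF that(2)] frame[OF that(2)]])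
    fix c assume "(\<Sum>i\<in>UNIV. c i *\<^sub>R DD x (e i)) = 0"
    then have "DD x (\<Sum>i\<in>UNIV. c i *\<^sub>R e i) = 0"
      using lin[OF that(1)] by (simp add: linear_sum linear_cmul)
    moreover have "(\<Sum>i\<in>UNIV. c i *\<^sub>R e i) \<in> tangent_space X x"
      using T(1)[OF that(1)] frame[OF that(2)] by (intro subspace_sum subspace_scale)
    ultimately have "(\<Sum>i\<in>UNIV. c i *\<^sub>R e i) = 0"
      using SL_atD(1)[OF SL[OF that(1) DD[OF that(1)]]] by blast
    then show "\<forall>i. c i = 0"
      using tangent_frame_independent[OF that(2)] by blast
  qed
  have real: "Im (Hol_vol (\<lambda>i. DD x (e i))) = 0" if "x \<in> X" "\<And>i. e i \<in> tangent_space X x" for x e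
    by (rule SL_atD(3)[OF SL[OF that(1) DD[OF that(1)]] that(2)])
  define Or where "Or x = {e :: 'n \<Rightarrow> 'a. tangent_frame X x e \<and> Re (Hol_vol (\<lambda>i. DD x (e i))) > 0}" for x
  have Or_ne: "Or x \<noteq> {}" if x: "x \<in> X" for x
  proof -
    obtain e :: "'n \<Rightarrow> 'a" where e: "tangent_frame X x e"
      using tangent_frame_exists[OF T(1,2)[OF x]] by blast
    have "Re (Hol_vol (\<lambda>i. DD x (e i))) \<noteq> 0"
      using nz[OF x e] real[OF x frame[OF e]] by (simp add: complex_eq_iff)
    then consider "Re (Hol_vol (\<lambda>i. DD x (e i))) > 0" | "Re (Hol_vol (\<lambda>i. DD x (e i))) < 0"
      by linarith
    then show ?thesis
    proof cases
      case 1
      then show ?thesis using e by (auto simp: Or_def)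
    next
      case 2
      \<comment> \<open>Reversing one frame vector, at an arbitrary index of the nonempty type,
        changes the sign of \<Omega>.\<close>
      define k :: 'n where "k = undefined"
      define M :: "real ^ 'n ^ 'n" where "M = (\<chi> i j. if i = j then if i = k then -1 else 1 else 0)"
      have "det M = (\<Prod>i\<in>UNIV. M $ i $ i)"
        by (intro det_diagonal) (simp add: M_def)
      then have "det M = -1"
        by (simp add: M_def prod.If_cases)
      define e' where "e' i = (\<Sum>j\<in>UNIV. M $ i $ j *\<^sub>R e j)" for i
      have H: "Hol_vol (\<lambda>i. DD x (e' i)) = - Hol_vol (\<lambda>i. DD x (e i))"
        unfolding e'_def Hol_vol_linear_sum[OF lin[OF x]] \<open>det M = -1\<close> by simp
      have e': "e' i \<in> tangent_space X x" for i
        unfolding e'_def using T(1)[OF x] frame[OF e] by (intro subspace_sum subspace_scale)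
      have "tangent_frame X x e'"
        using H nz[OF x e] by (intro Re_Hol_vol_pos_frame[OF T(1,2)[OF x] lin[OF x] e']) auto
      then have "e' \<in> Or x" using H 2 by (simp add: Or_def)
      then show ?thesis by blast
    qed
  qed
  have "orientation_on X Or"
    unfolding orientation_on_def
  proof (intro conjI ballI)
    fix x assume "x \<in> X"
    then show "Or x \<noteq> {}" by (rule Or_ne)
  next
    fix x e assume x: "x \<in> X" and "e \<in> Or x"
    then show "tangent_frame X x e" by (simp add: Or_def)
  next
    fix x e assume x: "x \<in> X" and e: "e \<in> Or x"
    then have e': "tangent_frame X x e" "Re (Hol_vol (\<lambda>i. DD x (e i))) > 0"
      by (simp_all add: Or_def)
    show "Or x = {(\<lambda>i. \<Sum>j\<in>UNIV. M $ i $ j *\<^sub>R e j) | M :: real^'n^'n. det M > 0}"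
    proof (intro set_eqI iffI)
      fix e2 assume "e2 \<in> Or x"
      then have e2: "tangent_frame X x e2" "Re (Hol_vol (\<lambda>i. DD x (e2 i))) > 0"
        by (simp_all add: Or_def)
      have "\<exists>c. e2 i = (\<Sum>j\<in>UNIV. c j *\<^sub>R e j)" for i
        using tangent_frame_coefficients[OF e'(1) frame[OF e2(1)]] by metis
      then obtain c where c: "\<And>i. e2 i = (\<Sum>j\<in>UNIV. c i j *\<^sub>R e j)" by metis
      define M :: "real ^ 'n ^ 'n" where "M = (\<chi> i j. c i j)"
      have e2M: "e2 = (\<lambda>i. \<Sum>j\<in>UNIV. M $ i $ j *\<^sub>R e j)"
        using c by (simp add: M_def fun_eq_iff)
      have "Re (Hol_vol (\<lambda>i. DD x (e2 i))) = det M * Re (Hol_vol (\<lambda>i. DD x (e i)))"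
        unfolding e2M Hol_vol_linear_sum[OF lin[OF x]] by simp
      then have "det M > 0"
        using e2(2) e'(2) by (simp add: zero_less_mult_iff)
      then show "e2 \<in> {(\<lambda>i. \<Sum>j\<in>UNIV. M $ i $ j *\<^sub>R e j) | M :: real^'n^'n. det M > 0}"
        using e2M by blast
    next
      fix e2 assume "e2 \<in> {(\<lambda>i. \<Sum>j\<in>UNIV. M $ i $ j *\<^sub>R e j) | M :: real^'n^'n. det M > 0}"
      then obtain M :: "real^'n^'n" where M: "e2 = (\<lambda>i. \<Sum>j\<in>UNIV. M $ i $ j *\<^sub>R e j)" "det M > 0"
        by blast
      have H: "Hol_vol (\<lambda>i. DD x (e2 i)) = complex_of_real (det M) * Hol_vol (\<lambda>i. DD x (e i))"
        unfolding M(1) Hol_vol_linear_sum[OF lin[OF x]] ..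
      have "e2 i \<in> tangent_space X x" for i
        unfolding M(1) using T(1)[OF x] frame[OF e'(1)] by (intro subspace_sum subspace_scale)
      then have "tangent_frame X x e2"
        using H M(2) nz[OF x e'(1)] by (intro Re_Hol_vol_pos_frame[OF T(1,2)[OF x] lin[OF x]]) auto
      then show "e2 \<in> Or x"
        using H M(2) e'(2) by (simp add: Or_def)
    qed
  next
    fix x assume x: "x \<in> X"
    obtain e :: "'n \<Rightarrow> 'a" where e: "tangent_frame X x e" "Re (Hol_vol (\<lambda>i. DD x (e i))) > 0"
      using Or_ne[OF x] by (auto simp: Or_def)
    show "\<exists>U E. open U \<and> x \<in> U \<and> (\<forall>i. continuous_on (X \<inter> U) (\<lambda>y. E y i)) \<and> (\<forall>y\<in>X \<inter> U. E y \<in> Or y)"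
    proof -
      obtain U D where U: "open U" "x \<in> U" and D: "\<And>y. y \<in> X \<inter> U \<Longrightarrow> (f has_derivative D y) (at y within X)"
        and contD: "\<And>v. continuous_on U (\<lambda>y. D y v)"
        using smooth_map_on_local_derivative[OF smooth x] by metis
      \<comment> \<open>\<open>DD\<close> is chosen point by point and need not be continuous, while
        \<open>D\<close> comes from a smooth local extension. They agree on projected vectors, which
        are tangent, so continuity is argued with \<open>D\<close> and positivity with
        \<open>DD\<close>.\<close>
      have DP: "D y (P y v) = DD y (P y v)" if "y \<in> X \<inter> U" for y v
        using that by (intro tangent_space_derivative_unique[OF D DD] T(3)) auto
      define h where "h y = Re (Hol_vol (\<lambda>i. D y (P y (e i))))" for y
      have "continuous_on (X \<inter> U) (\<lambda>y. D y (P y (e i)))" for i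
      proof (rule continuous_on_linear_apply[where D = D and p = "\<lambda>y. P y (e i)"])
        show "linear (D y)" if "y \<in> X \<inter> U" for y
          using D[OF that] has_derivative_linear by blast
        show "continuous_on (X \<inter> U) (\<lambda>y. D y v)" for v
          using contD by (rule continuous_on_subset) auto
        have "continuous_on X (\<lambda>y. P y (e i))"
          using P by (simp add: tangent_projection_def)
        then show "continuous_on (X \<inter> U) (\<lambda>y. P y (e i))"
          by (rule continuous_on_subset) auto
      qed
      then have "continuous_on (X \<inter> U) h"
        unfolding h_def by (intro continuous_on_Re continuous_on_Hol_vol)
      then obtain A where A: "open A" "A \<inter> (X \<inter> U) = h -` {0<..} \<inter> (X \<inter> U)"
        unfolding continuous_on_open_invariant by (meson open_greaterThan)
      have Pe: "P x (e i) = e i" for i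
        using T(4)[OF x frame[OF e(1)]] .
      have "h x > 0"
        using e(2) DP[of x "e _"] x U(2) unfolding h_def Pe by simp
      then have "x \<in> A" using A(2) x U(2) by auto
      have "(\<lambda>i. P y (e i)) \<in> Or y" if y: "y \<in> X \<inter> (A \<inter> U)" for y
      proof -
        have "y \<in> A \<inter> (X \<inter> U)" using y by blast
        then have "h y > 0" using A(2) by auto
        then have pos: "Re (Hol_vol (\<lambda>i. DD y (P y (e i)))) > 0"
          using DP[of y] y by (simp add: h_def)
        have yX: "y \<in> X" using y by blast
        have "tangent_frame X y (\<lambda>i. P y (e i))"
        proof (rule Re_Hol_vol_pos_frame[OF T(1,2)[OF yX] lin[OF yX] T(3)[OF yX]])
          show "Hol_vol (\<lambda>i. DD y (P y (e i))) \<noteq> 0" using pos by auto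
        qed
        then show ?thesis using pos by (simp add: Or_def)
      qed
      moreover have "continuous_on (X \<inter> (A \<inter> U)) (\<lambda>y. P y (e i))" for i
        using P by (auto simp: tangent_projection_def intro: continuous_on_subset)
      ultimately show ?thesis
        using A(1) U \<open>x \<in> A\<close>
        by (intro exI[of _ "A \<inter> U"] exI[of _ "\<lambda>y i. P y (e i)"]) auto
    qed
  qed
  moreover have "Re (Hol_vol (\<lambda>i. D (e i))) = gram_vol (\<lambda>i. D (e i))"
    if x: "x \<in> X" and D: "(f has_derivative D) (at x within X)" and e: "e \<in> Or x" for x D e
  proof -
    have fr: "tangent_frame X x e" and pos: "Re (Hol_vol (\<lambda>i. DD x (e i))) > 0"
      using e by (simp_all add: Or_def)
    have eq: "D (e i) = DD x (e i)" for i
      using tangent_space_derivative_unique[OF D DD[OF x] frame[OF fr]] .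
    have "gram_vol (\<lambda>i. DD x (e i)) = cmod (Hol_vol (\<lambda>i. DD x (e i)))"
      by (intro gram_vol_eq_norm SL_atD(2)[OF SL[OF x DD[OF x]]] frame[OF fr])
    also have "\<dots> = Re (Hol_vol (\<lambda>i. DD x (e i)))"
      using real[OF x frame[OF fr]] pos by (simp add: cmod_eq_Re)
    finally show ?thesis by (simp add: eq)
  qed
  moreover have "immersion_on X f"
    using smooth DD inj by (auto simp: immersion_on_def)
  ultimately show ?thesis
    unfolding SL_immersion_def by blast
qed

section \<open>The evolution equation\<close>

lemma Hol_vol_columns:
  "Hol_vol (\<lambda>i. \<chi> j. c j * B i $ j) = (\<Prod>j\<in>UNIV. c j) * Hol_vol B"
proof -
  have "det (transpose (\<chi> i j. c j * B i $ j)) = (\<Prod>j\<in>UNIV. c j) * det (\<chi> j. \<chi> i. B i $ j)"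
    by (simp add: det_rows_mul[symmetric] transpose_def vector_scalar_mult_def)
  also have "(\<chi> j. \<chi> i. B i $ j) = transpose (\<chi> i j. B i $ j)"
    by (simp add: transpose_def)
  finally show ?thesis
    by (simp only: det_transpose Hol_vol_def vec_lambda_beta)
qed

lemma det_zero_if_kernel:
  fixes M :: "real ^ 'n ^ 'n::finite"
  assumes "M *v x = 0" "x \<noteq> 0"
  shows "det M = 0"
proof -
  have "\<not> inj ((*v) M)"
    using assms by (metis injD matrix_vector_mult_0_right)
  then show ?thesis
    using det_nz_iff_inj[of "(*v) M"] by auto
qed

text \<open>
  Rotating \<open>s\<close> onto a coordinate axis moves the whole non-real part of the determinant into one row,
  and the determinant without that part vanishes because \<open>n\<close> is orthogonal to all rows.
\<close>

lemma Hol_vol_rank_one_update: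
  fixes a :: "'n::finite \<Rightarrow> real ^ 'n" and s :: "real ^ 'n" and y n :: "real ^ 'n"
  assumes n: "n \<noteq> 0" "\<And>i. a i \<bullet> n = 0"
  shows "\<exists>r. Hol_vol (\<lambda>i. \<chi> j. complex_of_real (a i $ j) + c * complex_of_real (s $ i * y $ j)) = c * complex_of_real r"
proof -
  define k :: 'n where "k = undefined"
  obtain f where f: "orthogonal_transformation f" "f s = norm s *\<^sub>R axis k (1::real)"
    using orthogonal_transformation_exists[of s "norm s *\<^sub>R axis k (1::real)"] by auto
  define M where "M = matrix f"
  have Ms: "M *v s = norm s *\<^sub>R axis k 1"
    using f(2) orthogonal_transformation_linear[OF f(1)] by (simp add: M_def)
  have dM: "\<bar>det M\<bar> = 1"
    unfolding M_def using f(1) by simp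
  define a' where "a' i = (\<Sum>l\<in>UNIV. M $ i $ l *\<^sub>R a l)" for i
  let ?B = "\<lambda>i. (\<chi> j. complex_of_real (a i $ j) + c * complex_of_real (s $ i * y $ j))"
  let ?C = "\<lambda>v::real^'n. (\<chi> j. complex_of_real (v $ j))"
  have "complex_of_real (det M) * Hol_vol ?B = Hol_vol (\<lambda>i. \<Sum>l\<in>UNIV. M $ i $ l *\<^sub>R ?B l)"
    by (simp add: Hol_vol_sum)
  also have "(\<lambda>i. \<Sum>l\<in>UNIV. M $ i $ l *\<^sub>R ?B l)
      = (\<lambda>i. if i = k then ?C (a' k) + (c * complex_of_real (norm s)) *s ?C y else ?C (a' i))"
  proof
    fix i
    have "(\<Sum>l\<in>UNIV. M $ i $ l * s $ l) = (if i = k then norm s else 0)"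
      using arg_cong[OF Ms, of "\<lambda>v. v $ i"] by (simp add: matrix_vector_mult_def axis_def)
    then have *: "(\<Sum>l\<in>UNIV. complex_of_real (M $ i $ l) * complex_of_real (s $ l)) = (if i = k then complex_of_real (norm s) else 0)"
      by (metis (mono_tags, lifting) of_real_0 of_real_mult of_real_sum sum.cong)
    have "(\<Sum>l\<in>UNIV. M $ i $ l *\<^sub>R ?B l) $ j
       = complex_of_real (a' i $ j) + c * complex_of_real (y $ j)
          * (\<Sum>l\<in>UNIV. complex_of_real (M $ i $ l) * complex_of_real (s $ l))" for j
      by (simp add: a'_def scaleR_conv_of_real[where 'a = complex] algebra_simps sum.distrib sum_distrib_left)
    then show "(\<Sum>l\<in>UNIV. M $ i $ l *\<^sub>R ?B l)
      = (if i = k then ?C (a' k) + (c * complex_of_real (norm s)) *s ?C y else ?C (a' i))"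
      unfolding * by (simp add: vec_eq_iff)
  qed
  also have "Hol_vol \<dots> = det (\<chi> i. if i = k then ?C (a' k) else ?C (a' i))
      + (c * complex_of_real (norm s)) * det (\<chi> i. if i = k then ?C y else ?C (a' i))"
    unfolding Hol_vol_def vec_lambda_eta det_row_add det_row_mul ..
  also have "det (\<chi> i. if i = k then ?C (a' k) else ?C (a' i)) = complex_of_real (det (\<chi> i. a' i))"
    unfolding det_of_real[symmetric] by (intro arg_cong[of _ _ det]) (simp add: vec_eq_iff)
  also have "det (\<chi> i. a' i) = 0"
  proof (rule det_zero_if_kernel[OF _ n(1)])
    have "a' i \<bullet> n = 0" for i
      using n(2) by (simp add: a'_def inner_sum_left)
    then show "(\<chi> i. a' i) *v n = 0"
      by (simp add: vec_eq_iff matrix_vector_mult_def inner_vec_def)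
  qed
  also have "det (\<chi> i. if i = k then ?C y else ?C (a' i)) = complex_of_real (det (\<chi> i. if i = k then y else a' i))"
    unfolding det_of_real[symmetric] by (intro arg_cong[of _ _ det]) (simp add: vec_eq_iff)
  finally have 1: "complex_of_real (det M) * Hol_vol ?B
      = c * complex_of_real (norm s * det (\<chi> i. if i = k then y else a' i))" by simp
  have "complex_of_real (det M) * complex_of_real (det M) = 1"
    using dM by (metis abs_mult_self_eq mult.right_neutral of_real_1 of_real_mult)
  then have "Hol_vol ?B = complex_of_real (det M) * (complex_of_real (det M) * Hol_vol ?B)"
    by (simp add: mult.assoc[symmetric])
  also have "\<dots> = c * complex_of_real (det M * (norm s * det (\<chi> i. if i = k then y else a' i)))"
    unfolding 1 by simp
  finally show ?thesis by blast
qed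

lemma has_derivative_vec_lambda:
  assumes "\<And>j. (f j has_derivative f' j) F"
  shows "((\<lambda>x. (\<chi> j. f j x) :: 'b::euclidean_space ^ 'n::finite) has_derivative (\<lambda>v. \<chi> j. f' j v)) F"
proof -
  have "((\<lambda>x. \<Sum>j\<in>UNIV. axis j (f j x)) has_derivative (\<lambda>v. \<Sum>j\<in>UNIV. axis j (f' j v))) F"
    by (intro has_derivative_sum bounded_linear.has_derivative[OF bounded_linear_axis] assms)
  moreover have "(\<Sum>j\<in>UNIV. axis j (g j)) = (\<chi> j. g j)" for g :: "'n \<Rightarrow> 'b"
    by (simp add: vec_eq_iff axis_def)
  ultimately show ?thesis by simp
qed

text \<open>The evolution equation in complex form. Periodicity is added only later, since the
  special Lagrangian condition at a point involves the equation at a single time.\<close>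

locale quadric_evolution =
  fixes eps :: "'n::finite \<Rightarrow> real" and w :: "'n \<Rightarrow> real \<Rightarrow> complex"
  assumes eps_nz: "eps j \<noteq> 0"
    and w_nz: "w j t \<noteq> 0"
    and w_deriv: "(w j has_vector_derivative eps j *\<^sub>R cnj (\<Prod>k\<in>UNIV - {j}. w k t)) (at t)"
begin

text \<open>Bootstrapping: the derivative of each \<open>w j\<close> is a product of conjugates of
  the others, so it inherits every order of regularity that they have, and \<open>w j\<close> gains
  one more.\<close>

lemma smooth_w: "smooth_on (w j) U"
proof -
  have "Ck_on k (w j) UNIV" for k j
  proof (induction k arbitrary: j)
    case 0
    have "isCont (w j) t" for t
      using w_deriv has_vector_derivative_continuous by blast
    then show ?case by (simp add: continuous_at_imp_continuous_on)
  next
    case (Suc k)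
    have "Ck_on k (\<lambda>t. v *\<^sub>R (eps j *\<^sub>R cnj (\<Prod>k\<in>UNIV - {j}. w k t))) UNIV" for v
      by (intro Ck_on_bounded_linear_compose[OF bounded_linear_scaleR_right]
          Ck_on_bounded_linear_compose[OF bounded_linear_cnj] Ck_on_prod Suc.IH)
    with w_deriv[unfolded has_vector_derivative_def] show ?case
      by (intro Ck_on_SucI)
  qed
  then show ?thesis
    using Ck_on_subset unfolding smooth_on_def by blast
qed

text \<open>The image of the tangent vector \<open>(a, s)\<close> at \<open>(x, t)\<close> under the
  differential of the map sending (x, t) to the point with coordinates \<open>x $ j\<close> times
  \<open>w j t\<close>.\<close>

definition velocity :: "real \<Rightarrow> real ^ 'n \<Rightarrow> real ^ 'n \<Rightarrow> real \<Rightarrow> complex ^ 'n" where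
  "velocity t x a s = (\<chi> j. complex_of_real (a $ j) * w j t
      + complex_of_real (x $ j) * (s *\<^sub>R (eps j *\<^sub>R cnj (\<Prod>k\<in>UNIV - {j}. w k t))))"

text \<open>With P the product of all \<open>w k t\<close>, the conjugate of the product without
  factor j is cnj P times \<open>w j t\<close> over its squared modulus. Once the diagonal factor
  \<open>w j t\<close> is pulled out, a real vector remains plus the single complex scalar cnj P
  times a real vector scaled by \<open>s\<close>. Injectivity, isotropy and the phase of \<Omega>
  are all read off from this form.\<close>

lemma velocity_eq:
  "velocity t x a s = (\<chi> j. w j t * (complex_of_real (a $ j)
      + cnj (\<Prod>k\<in>UNIV. w k t) * complex_of_real (s * (eps j * x $ j / (cmod (w j t))\<^sup>2))))"
proof -
  have "cnj (\<Prod>k\<in>UNIV. w k t) = cnj (w j t) * cnj (\<Prod>k\<in>UNIV - {j}. w k t)" for j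
    by (subst prod.remove[of UNIV j]) auto
  then have "cnj (\<Prod>k\<in>UNIV - {j}. w k t) = cnj (\<Prod>k\<in>UNIV. w k t) / cnj (w j t)" for j
    using w_nz[of j t] by (metis complex_cnj_zero_iff nonzero_mult_div_cancel_left)
  moreover have "1 / cnj (w j t) = w j t / complex_of_real ((cmod (w j t))\<^sup>2)" for j
    unfolding complex_norm_square using w_nz[of j t] by (simp add: field_simps)
  ultimately have *: "cnj (\<Prod>k\<in>UNIV - {j}. w k t)
      = cnj (\<Prod>k\<in>UNIV. w k t) * (w j t / complex_of_real ((cmod (w j t))\<^sup>2))" for j
    by (metis times_divide_eq_right mult.right_neutral)
  show ?thesis
    unfolding velocity_def vec_eq_iff * by (simp add: scaleR_conv_of_real algebra_simps del: cnj_prod)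
qed

context
  fixes t :: real and x :: "real ^ 'n"
  assumes x: "x \<noteq> 0"
begin

text \<open>Pairs the normal \<open>eps j * x $ j\<close> of the quadric with the real direction
  that accompanies \<open>s\<close> in \<open>velocity_eq\<close>. Positivity makes that direction
  transverse to the quadric.\<close>

lemma normal_pos: "0 < (\<Sum>j\<in>UNIV. (eps j * x $ j) * (eps j * x $ j / (cmod (w j t))\<^sup>2))"
proof -
  obtain k where "x $ k \<noteq> 0" using x by (auto simp: vec_eq_iff)
  then show ?thesis
    using eps_nz[of k] w_nz[of k t]
    by (intro sum_pos2[of UNIV k]) (auto simp: zero_less_mult_iff zero_less_divide_iff simp flip: power2_eq_square)
qed

lemma velocity_zero:
  assumes "(\<Sum>j\<in>UNIV. eps j * x $ j * a $ j) = 0" "velocity t x a s = 0"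
  shows "a = 0" "s = 0"
proof -
  let ?P = "cnj (\<Prod>k\<in>UNIV. w k t)"
  have P: "?P \<noteq> 0" using w_nz by (simp add: prod_zero_iff)
  have a: "complex_of_real (a $ j) + ?P * complex_of_real (s * (eps j * x $ j / (cmod (w j t))\<^sup>2)) = 0" for j
    using assms(2) w_nz[of j t] unfolding velocity_eq vec_eq_iff vec_lambda_beta zero_index mult_eq_0_iff
    by blast
  \<comment> \<open>Pairing with the normal removes the tangential part \<open>a\<close> and
    isolates \<open>s\<close>.\<close>
  have "0 = (\<Sum>j\<in>UNIV. complex_of_real (eps j * x $ j) * (complex_of_real (a $ j) + ?P * complex_of_real (s * (eps j * x $ j / (cmod (w j t))\<^sup>2))))"
    unfolding a by simp
  also have "\<dots> = complex_of_real (\<Sum>j\<in>UNIV. eps j * x $ j * a $ j)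
     + ?P * complex_of_real (s * (\<Sum>j\<in>UNIV. (eps j * x $ j) * (eps j * x $ j / (cmod (w j t))\<^sup>2)))"
    by (simp add: algebra_simps sum.distrib sum_distrib_left del: cnj_prod)
  finally have "?P * complex_of_real (s * (\<Sum>j\<in>UNIV. (eps j * x $ j) * (eps j * x $ j / (cmod (w j t))\<^sup>2))) = 0"
    unfolding assms(1) of_real_0 add_0 by (rule sym)
  then have "s * (\<Sum>j\<in>UNIV. (eps j * x $ j) * (eps j * x $ j / (cmod (w j t))\<^sup>2)) = 0"
    unfolding mult_eq_0_iff[of ?P] of_real_eq_0_iff using P by blast
  then show "s = 0" using normal_pos by simp
  then show "a = 0" using a by (simp add: vec_eq_iff del: cnj_prod)
qed

text \<open>The weight |w_j|^2 from the diagonal factors cancels the denominators in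
  \<open>velocity_eq\<close>, and the imaginary part reduces to multiples of the pairings of
  \<open>a\<close> and \<open>b\<close> with the normal.\<close>

lemma velocity_isotropic:
  assumes "(\<Sum>j\<in>UNIV. eps j * x $ j * a $ j) = 0" "(\<Sum>j\<in>UNIV. eps j * x $ j * b $ j) = 0"
  shows "Im (\<Sum>j\<in>UNIV. velocity t x a s $ j * cnj (velocity t x b r $ j)) = 0"
proof -
  let ?P = "cnj (\<Prod>k\<in>UNIV. w k t)"
  define P where "P = ?P"
  have "Im (velocity t x a s $ j * cnj (velocity t x b r $ j))
      = s * Im P * (eps j * x $ j * b $ j) - r * Im P * (eps j * x $ j * a $ j)" for j
  proof -
    define y where "y = eps j * x $ j / (cmod (w j t))\<^sup>2"
    have y: "(cmod (w j t))\<^sup>2 * y = eps j * x $ j"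
      using w_nz[of j t] by (simp add: y_def)
    have "velocity t x a s $ j * cnj (velocity t x b r $ j)
      = (w j t * cnj (w j t)) * ((complex_of_real (a $ j) + P * complex_of_real (s * y))
          * cnj (complex_of_real (b $ j) + P * complex_of_real (r * y)))"
      unfolding velocity_eq y_def P_def by (simp add: mult_ac del: cnj_prod)
    also have "Im \<dots> = (cmod (w j t))\<^sup>2 * Im ((complex_of_real (a $ j) + P * complex_of_real (s * y))
          * cnj (complex_of_real (b $ j) + P * complex_of_real (r * y)))"
      unfolding complex_norm_square[symmetric] by simp
    also have "\<dots> = ((cmod (w j t))\<^sup>2 * y) * (s * Im P * b $ j - r * Im P * a $ j)"
      by (simp add: algebra_simps)
    finally show ?thesis unfolding y by (simp add: algebra_simps)
  qed
  then have "Im (\<Sum>j\<in>UNIV. velocity t x a s $ j * cnj (velocity t x b r $ j))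
     = s * Im P * (\<Sum>j\<in>UNIV. eps j * x $ j * b $ j) - r * Im P * (\<Sum>j\<in>UNIV. eps j * x $ j * a $ j)"
    by (simp add: sum_subtractf sum_distrib_left)
  then show ?thesis using assms by simp
qed

text \<open>The diagonal factors contribute P and the remaining determinant is a real multiple of
  cnj P, so the phases cancel to |P|^2.\<close>

lemma velocity_Hol_vol:
  assumes "\<And>i. (\<Sum>j\<in>UNIV. eps j * x $ j * a i $ j) = 0"
  shows "Im (Hol_vol (\<lambda>i. velocity t x (a i) (s i))) = 0"
proof -
  let ?P = "\<Prod>k\<in>UNIV. w k t"
  define y :: "real ^ 'n" where "y = (\<chi> j. eps j * x $ j / (cmod (w j t))\<^sup>2)"
  define n :: "real ^ 'n" where "n = (\<chi> j. eps j * x $ j)"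
  have n: "n \<noteq> 0"
    using x eps_nz by (auto simp: n_def vec_eq_iff)
  have an: "a i \<bullet> n = 0" for i
    using assms[of i] by (simp add: n_def inner_vec_def mult_ac)
  obtain r where r: "Hol_vol (\<lambda>i. \<chi> j. complex_of_real (a i $ j) + cnj ?P * complex_of_real ((\<chi> i. s i) $ i * y $ j)) = cnj ?P * complex_of_real r"
    using Hol_vol_rank_one_update[of n a "cnj ?P" "\<chi> i. s i" y, OF n an] by (elim exE)
  have "Hol_vol (\<lambda>i. velocity t x (a i) (s i)) = ?P * (cnj ?P * complex_of_real r)"
    unfolding r[symmetric] Hol_vol_columns[symmetric] velocity_eq by (simp add: y_def del: cnj_prod)
  also have "\<dots> = complex_of_real ((cmod ?P)\<^sup>2 * r)"
    unfolding of_real_mult complex_norm_square by (simp add: mult.assoc del: cnj_prod)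
  finally show ?thesis by simp
qed

end

text \<open>\<xi> and \<tau> may be any local functions giving the point of the quadric and the
  time, so the same statement serves products of spheres and graph charts. The left inverse
  \<Lambda> makes the differential of (\<xi>, \<tau>) injective on tangent vectors, and
  differentiating the quadric equation makes \<open>D\<xi> v\<close> orthogonal to the
  normal.\<close>

lemma family_SL_at:
  fixes X :: "'a::euclidean_space set"
  assumes x: "x \<in> X" and D: "(f has_derivative D) (at x within X)"
    and U: "open U" "x \<in> U"
    and \<xi>: "(\<xi> has_derivative D\<xi>) (at x)" and \<tau>: "(\<tau> has_derivative D\<tau>) (at x)"
    and f: "\<And>y. y \<in> X \<inter> U \<Longrightarrow> f y = (\<chi> j. complex_of_real (\<xi> y $ j) * w j (\<tau> y))"
    and quadric: "\<And>y. y \<in> X \<inter> U \<Longrightarrow> (\<Sum>j\<in>UNIV. eps j * (\<xi> y $ j)\<^sup>2) = c"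
    and nz: "\<xi> x \<noteq> 0"
    and \<Lambda>: "(\<Lambda> has_derivative D\<Lambda>) (at (\<xi> x, \<tau> x))" "\<And>y. y \<in> X \<inter> U \<Longrightarrow> \<Lambda> (\<xi> y, \<tau> y) = y"
  shows "SL_at X D x"
proof -
  obtain d where d: "d > 0" "ball x d \<subseteq> U"
    using U openE by blast
  have near: "y \<in> U" if "dist y x < d" for y
    using d that by (auto simp: dist_commute)
  have Deq: "D v = velocity (\<tau> x) (\<xi> x) (D\<xi> v) (D\<tau> v)" if "v \<in> tangent_space X x" for v
  proof (rule tangent_space_derivative_unique[OF D _ that])
    have "((\<lambda>y. \<xi> y $ j) has_derivative (\<lambda>v. D\<xi> v $ j)) (at x)" for j
      by (rule bounded_linear.has_derivative[OF bounded_linear_vec_nth \<xi>])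
    then have 1: "((\<lambda>y. complex_of_real (\<xi> y $ j)) has_derivative (\<lambda>v. complex_of_real (D\<xi> v $ j))) (at x)" for j
      by (rule bounded_linear.has_derivative[OF bounded_linear_of_real])
    have 2: "((\<lambda>y. w j (\<tau> y)) has_derivative (\<lambda>v. D\<tau> v *\<^sub>R (eps j *\<^sub>R cnj (\<Prod>k\<in>UNIV - {j}. w k (\<tau> x))))) (at x)" for j
      using has_derivative_compose[OF \<tau> w_deriv[unfolded has_vector_derivative_def]] .
    have "((\<lambda>y. \<chi> j. complex_of_real (\<xi> y $ j) * w j (\<tau> y)) has_derivative
        (\<lambda>v. velocity (\<tau> x) (\<xi> x) (D\<xi> v) (D\<tau> v))) (at x)"
      unfolding velocity_def using has_derivative_mult[OF 1 2]
      by (intro has_derivative_vec_lambda) (simp add: add.commute)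
    then have "((\<lambda>y. \<chi> j. complex_of_real (\<xi> y $ j) * w j (\<tau> y)) has_derivative
        (\<lambda>v. velocity (\<tau> x) (\<xi> x) (D\<xi> v) (D\<tau> v))) (at x within X)"
      by (rule has_derivative_at_withinI)
    then show "(f has_derivative (\<lambda>v. velocity (\<tau> x) (\<xi> x) (D\<xi> v) (D\<tau> v))) (at x within X)"
      by (rule has_derivative_transform_within[OF _ d(1) x]) (use f near in auto)
  qed
  have orth: "(\<Sum>j\<in>UNIV. eps j * \<xi> x $ j * D\<xi> v $ j) = 0" if "v \<in> tangent_space X x" for v
  proof -
    have \<xi>j: "((\<lambda>y. \<xi> y $ j) has_derivative (\<lambda>v. D\<xi> v $ j)) (at x within X)" for j
      by (rule bounded_linear.has_derivative[OF bounded_linear_vec_nth has_derivative_at_withinI[OF \<xi>]])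
    have 1: "((\<lambda>y. \<Sum>j\<in>UNIV. eps j * (\<xi> y $ j)\<^sup>2) has_derivative
        (\<lambda>v. \<Sum>j\<in>UNIV. eps j * (2 * \<xi> x $ j * D\<xi> v $ j))) (at x within X)"
      by (rule has_derivative_eq_rhs)
        (auto intro!: derivative_eq_intros \<xi>j simp: fun_eq_iff power2_eq_square mult_ac)
    have 2: "((\<lambda>y. \<Sum>j\<in>UNIV. eps j * (\<xi> y $ j)\<^sup>2) has_derivative (\<lambda>v. 0)) (at x within X)"
      by (rule has_derivative_transform_within[OF has_derivative_const[of c] d(1) x])
        (use quadric near in auto)
    have "(\<Sum>j\<in>UNIV. eps j * (2 * \<xi> x $ j * D\<xi> v $ j)) = 0"
      using tangent_space_derivative_unique[OF 1 2 that] .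
    then have "2 * (\<Sum>j\<in>UNIV. eps j * \<xi> x $ j * D\<xi> v $ j) = 0"
      by (simp add: sum_distrib_left mult_ac)
    then show ?thesis by simp
  qed
  have inj: "v = D\<Lambda> (D\<xi> v, D\<tau> v)" if "v \<in> tangent_space X x" for v
  proof (rule tangent_space_derivative_unique[OF has_derivative_ident _ that])
    have "((\<lambda>y. \<Lambda> (\<xi> y, \<tau> y)) has_derivative (\<lambda>v. D\<Lambda> (D\<xi> v, D\<tau> v))) (at x within X)"
      using has_derivative_compose[OF has_derivative_at_withinI[OF has_derivative_Pair[OF \<xi> \<tau>]] \<Lambda>(1)] .
    then show "((\<lambda>y. y) has_derivative (\<lambda>v. D\<Lambda> (D\<xi> v, D\<tau> v))) (at x within X)"
      by (rule has_derivative_transform_within[OF _ d(1) x]) (use \<Lambda>(2) near in auto)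
  qed
  show ?thesis
    unfolding SL_at_def
  proof (intro conjI ballI allI impI)
    fix v assume v: "v \<in> tangent_space X x" "D v = 0"
    have "D\<xi> v = 0" "D\<tau> v = 0"
      using velocity_zero[OF nz orth[OF v(1)]] v(2) Deq[OF v(1)] by simp_all
    then show "v = 0"
      using inj[OF v(1)] linear_0[OF has_derivative_linear[OF \<Lambda>(1)]] by (simp add: zero_prod_def)
  next
    fix v u assume "v \<in> tangent_space X x" "u \<in> tangent_space X x"
    then show "Im (\<Sum>k\<in>UNIV. D v $ k * cnj (D u $ k)) = 0"
      by (simp only: Deq velocity_isotropic[OF nz orth orth])
  next
    fix e :: "'n \<Rightarrow> 'a" assume "\<forall>i. e i \<in> tangent_space X x"
    then show "Im (Hol_vol (\<lambda>i. D (e i))) = 0"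
      by (simp only: Deq velocity_Hol_vol[OF nz orth])
  qed
qed

end

section \<open>Immersions of products of spheres\<close>

lemma sum_UNIV_sum:
  "(\<Sum>j\<in>UNIV. f (j :: 'p::finite + 'q::finite)) = (\<Sum>i\<in>UNIV. f (Inl i)) + (\<Sum>k\<in>UNIV. f (Inr k))"
  unfolding UNIV_Plus_UNIV[symmetric] by (subst sum.Plus) (auto simp: o_def)

lemma norm_sq_sum: "(norm (v::real^'n::finite))\<^sup>2 = (\<Sum>i\<in>UNIV. (v $ i)\<^sup>2)"
  by (simp add: norm_vec_def L2_set_def sum_nonneg)

lemma inner_self_sum: "v \<bullet> v = (\<Sum>i\<in>UNIV. (v $ i)\<^sup>2)" for v :: "real^'n::finite"
  by (simp add: inner_vec_def power2_eq_square)

lemma norm_vec_divide: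
  fixes v :: "'n::finite \<Rightarrow> real"
  assumes "R > 0" "R\<^sup>2 = (\<Sum>i\<in>UNIV. (v i)\<^sup>2)"
  shows "norm ((\<chi> i. v i / R) :: real ^ 'n) = 1"
proof -
  have "(norm ((\<chi> i. v i / R) :: real ^ 'n))\<^sup>2 = (\<Sum>i\<in>UNIV. (v i)\<^sup>2) / R\<^sup>2"
    by (simp add: norm_sq_sum power_divide sum_divide_distrib)
  also have "\<dots> = 1"
    unfolding assms(2)[symmetric] using assms(1) by simp
  finally show ?thesis
    using abs_square_eq_1[of "norm ((\<chi> i. v i / R) :: real ^ 'n)"] by simp
qed

lemma differentiable_vec_lambda:
  fixes f :: "'n::finite \<Rightarrow> 'a::real_normed_vector \<Rightarrow> 'b::euclidean_space"
  assumes "\<And>j. f j differentiable F"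
  shows "(\<lambda>x. \<chi> j. f j x) differentiable F"
proof -
  obtain f' where "\<And>j. (f j has_derivative f' j) F"
    using assms unfolding differentiable_def by metis
  then show ?thesis
    unfolding differentiable_def using has_derivative_vec_lambda by blast
qed

lemma differentiable_real_sqrt:
  fixes f :: "'a::real_normed_vector \<Rightarrow> real"
  assumes "f differentiable (at x)" "0 < f x"
  shows "(\<lambda>x. sqrt (f x)) differentiable (at x)"
proof -
  obtain f' where "(f has_derivative f') (at x)"
    using assms(1) unfolding differentiable_def by blast
  from has_derivative_real_sqrt[OF assms(2) this] show ?thesis
    unfolding differentiable_def by blast
qed

lemma differentiable_vec_nth: "f differentiable F \<Longrightarrow> (\<lambda>x. f x $ j) differentiable F"
  unfolding differentiable_def using bounded_linear.has_derivative[OF bounded_linear_vec_nth] by blast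

lemma differentiable_fst: "fst differentiable F" and differentiable_snd: "snd differentiable F"
  unfolding differentiable_def
  using bounded_linear_imp_has_derivative[OF bounded_linear_fst] bounded_linear_imp_has_derivative[OF bounded_linear_snd]
  by blast+

lemma smooth_on_UNIV_has_derivative:
  assumes "smooth_on f UNIV"
  shows "\<exists>D. \<forall>x. (f has_derivative D x) (at x)"
  using smooth_on_derivative[OF assms] by (metis UNIV_I)

section \<open>Indefinite quadrics over a periodic evolution\<close>

definition quadric_sign :: "'p + 'q \<Rightarrow> real" where
  "quadric_sign = case_sum (\<lambda>_. 1) (\<lambda>_. -1)"

definition quadric_form :: "real ^ ('p::finite + 'q::finite) \<Rightarrow> real" where
  "quadric_form x = (\<Sum>j\<in>UNIV. quadric_sign j * (x $ j)\<^sup>2)"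

lemma quadric_form_eq: "quadric_form x = (\<Sum>i\<in>UNIV. (x $ Inl i)\<^sup>2) - (\<Sum>k\<in>UNIV. (x $ Inr k)\<^sup>2)"
  by (simp add: quadric_form_def quadric_sign_def sum_UNIV_sum sum_negf)

locale periodic_evolution = quadric_evolution quadric_sign w
  for w :: "'p::finite + 'q::finite \<Rightarrow> real \<Rightarrow> complex" +
  fixes T :: real
  assumes T_pos: "T > 0" and w_periodic: "w j (t + T) = w j t"
begin

definition family :: "real \<Rightarrow> (complex ^ ('p + 'q)) set" where
  "family c = {z. \<exists>x t. quadric_form x = c \<and> z = (\<chi> j. complex_of_real (x $ j) * w j t)}"

lemma w_periodic_int: "w j (t + T * of_int n) = w j t"
proof (induction n rule: int_induct[where k = 0])
  case (step1 i)
  then show ?case using w_periodic[of j "t + T * of_int i"] by (simp add: algebra_simps)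
next
  case (step2 i)
  then show ?case using w_periodic[of j "t + T * of_int (i - 1)"] by (simp add: algebra_simps)
qed simp

lemma w_eq_cis:
  assumes "cis (2 * pi * s / T) = cis (2 * pi * t / T)"
  shows "w j s = w j t"
proof -
  have "sin (2 * pi * s / T) = sin (2 * pi * t / T) \<and> cos (2 * pi * s / T) = cos (2 * pi * t / T)"
    using assms by (metis cis.sel)
  then obtain n :: int where n: "2 * pi * s / T = 2 * pi * t / T + 2 * pi * n"
    using sin_cos_eq_iff by blast
  then have "2 * pi * s = 2 * pi * (t + T * n)"
    using T_pos by (simp add: field_simps)
  then have "s = t + T * n" by simp
  then show ?thesis by (simp add: w_periodic_int)
qed

text \<open>The time on the circle: \<open>Arg\<close> jumps, but \<open>w\<close> does not see the jump.\<close>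

definition circle_time :: "complex \<Rightarrow> real" where
  "circle_time s = T / (2 * pi) * Arg s"

lemma cis_circle_time: "norm s = 1 \<Longrightarrow> cis (2 * pi * circle_time s / T) = s"
  using T_pos cis_Arg[of s] by (cases "s = 0") (auto simp: circle_time_def sgn_div_norm)

lemma family_immersion:
  fixes X :: "'a::euclidean_space set" and \<xi> :: "'a \<Rightarrow> real ^ ('p + 'q)" and \<sigma> :: "'a \<Rightarrow> complex"
  assumes P: "tangent_projection X P CARD('p + 'q)"
    and smooth: "smooth_on \<xi> UNIV" "smooth_on \<sigma> UNIV"
    and X: "\<And>y. y \<in> X \<Longrightarrow> norm (\<sigma> y) = 1 \<and> \<xi> y \<noteq> 0 \<and> quadric_form (\<xi> y) = c"
    and \<Lambda>: "\<And>y. y \<in> X \<Longrightarrow> \<Lambda> differentiable (at (\<xi> y, \<sigma> y)) \<and> \<Lambda> (\<xi> y, \<sigma> y) = y"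
  shows "SL_immersion X (\<lambda>y. \<chi> j. complex_of_real (\<xi> y $ j) * w j (circle_time (\<sigma> y)))"
    (is "SL_immersion X ?f")
proof -
  \<comment> \<open>A branch of the time centred at \<open>\<sigma> x\<close>, hence smooth as long
    as \<open>\<sigma> y / \<sigma> x\<close> avoids the cut of the logarithm. On \<open>X\<close>
    it agrees with \<open>circle_time (\<sigma> y)\<close> up to multiples of
    \<open>T\<close>.\<close>
  define \<tau> where "\<tau> x y = circle_time (\<sigma> x) + T / (2 * pi) * Im (Ln (\<sigma> y / \<sigma> x))" for x y
  define U where "U x = (\<lambda>y. \<sigma> y / \<sigma> x) -` (- \<real>\<^sub>\<le>\<^sub>0)" for x
  have cont: "continuous_on UNIV \<sigma>"
    using smooth_on_Ck[OF smooth(2), of 0] by simp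
  have U_open: "open (U x)" for x
    unfolding U_def divide_inverse by (intro open_vimage continuous_on_mult continuous_on_const cont) auto
  have xU: "x \<in> U x" if "x \<in> X" for x
    using X[OF that] by (auto simp: U_def)
  have \<tau>_smooth: "smooth_on (\<tau> x) (U x)" for x
  proof -
    have "smooth_on (\<lambda>y. \<sigma> y * (1 / \<sigma> x)) (U x)"
      by (rule smooth_on_mult[OF smooth_on_subset[OF smooth(2)] smooth_on_const]) simp
    then have quotient: "smooth_on (\<lambda>y. \<sigma> y / \<sigma> x) (U x)" by simp
    have "open (- \<real>\<^sub>\<le>\<^sub>0 :: complex set)" "Ln holomorphic_on - \<real>\<^sub>\<le>\<^sub>0"
      by (auto intro: holomorphic_on_Ln)
    then have "smooth_on (\<lambda>y. Ln (\<sigma> y / \<sigma> x)) (U x)"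
      by (rule smooth_on_holomorphic_compose[OF _ _ quotient]) (auto simp: U_def)
    then have "smooth_on (\<lambda>y. Im (Ln (\<sigma> y / \<sigma> x))) (U x)"
      by (rule smooth_on_bounded_linear_compose[OF bounded_linear_Im])
    then show ?thesis
      unfolding \<tau>_def by (rule smooth_on_add[OF smooth_on_const smooth_on_mult[OF smooth_on_const]])
  qed
  have cis_\<tau>: "cis (2 * pi * \<tau> x y / T) = \<sigma> y" if "x \<in> X" "y \<in> X" "y \<in> U x" for x y
  proof -
    have n: "norm (\<sigma> y / \<sigma> x) = 1" and nz: "\<sigma> x \<noteq> 0"
      using X[OF that(1)] X[OF that(2)] by (auto simp: norm_divide)
    have "2 * pi * \<tau> x y / T = 2 * pi * circle_time (\<sigma> x) / T + Im (Ln (\<sigma> y / \<sigma> x))"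
      using T_pos by (simp add: \<tau>_def field_simps)
    then have "cis (2 * pi * \<tau> x y / T) = \<sigma> x * cis (Im (Ln (\<sigma> y / \<sigma> x)))"
      using cis_circle_time[of "\<sigma> x"] X[OF that(1)] by (simp add: cis_mult[symmetric])
    also have "cis (Im (Ln (\<sigma> y / \<sigma> x))) = exp (Ln (\<sigma> y / \<sigma> x))"
    proof -
      have "\<sigma> y / \<sigma> x \<noteq> 0" using n by (metis norm_zero zero_neq_one)
      then have "Re (Ln (\<sigma> y / \<sigma> x)) = 0" unfolding Re_Ln[OF \<open>\<sigma> y / \<sigma> x \<noteq> 0\<close>] n by simp
      then show ?thesis by (simp add: exp_eq_polar)
    qed
    finally show ?thesis using n nz exp_Ln[of "\<sigma> y / \<sigma> x"] by (cases "\<sigma> y = 0") simp_all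
  qed
  have f: "?f y = (\<chi> j. complex_of_real (\<xi> y $ j) * w j (\<tau> x y))" if "x \<in> X" "y \<in> X \<inter> U x" for x y
  proof -
    have "w j (circle_time (\<sigma> y)) = w j (\<tau> x y)" for j
      by (rule w_eq_cis) (use cis_\<tau> cis_circle_time X that in auto)
    then show ?thesis by simp
  qed
  show ?thesis
  proof (rule SL_immersionI[OF _ P])
    show "smooth_map_on X ?f"
      unfolding smooth_map_on_def
    proof
      fix x assume x: "x \<in> X"
      have "smooth_on (\<lambda>y. complex_of_real (\<xi> y $ j) * w j (\<tau> x y)) (U x)" for j
        by (rule smooth_on_mult[OF smooth_on_of_real[OF smooth_on_vec_nth[OF smooth_on_subset[OF smooth(1)]]]
              smooth_on_compose[OF \<tau>_smooth smooth_w[of _ UNIV]]]) simp_all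
      then have "smooth_on (\<lambda>y. \<chi> j. complex_of_real (\<xi> y $ j) * w j (\<tau> x y)) (U x)"
        by (rule smooth_on_vec_lambda)
      then show "\<exists>V g. open V \<and> x \<in> V \<and> smooth_on g V \<and> (\<forall>y\<in>X \<inter> V. ?f y = g y)"
        using U_open xU[OF x] f[OF x] by (intro exI conjI ballI) assumption+
    qed
  next
    fix x D assume x: "x \<in> X" and D: "(?f has_derivative D) (at x within X)"
    from smooth_on_UNIV_has_derivative[OF smooth(1)]
    obtain D\<xi> where "\<forall>y. (\<xi> has_derivative D\<xi> y) (at y)" by (elim exE)
    note D\<xi> = this[rule_format]
    obtain D\<tau> where D\<tau>: "\<And>y. y \<in> U x \<Longrightarrow> (\<tau> x has_derivative D\<tau> y) (at y)"
      using smooth_on_derivative[OF \<tau>_smooth[of x]] by metis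
    have \<tau>x: "cis (2 * pi * \<tau> x x / T) = \<sigma> x"
      using cis_\<tau>[OF x x xU[OF x]] .
    obtain D\<Lambda> where D\<Lambda>: "(\<Lambda> has_derivative D\<Lambda>) (at (\<xi> x, \<sigma> x))"
      using \<Lambda>[OF x] unfolding differentiable_def by blast
    \<comment> \<open>\<Lambda> inverts (\<xi>, \<sigma>), but \<open>family_SL_at\<close> asks for
      an inverse of (\<xi>, \<tau>). Composing with the covering of the circle by time converts one
      into the other.\<close>
    have "smooth_on (\<lambda>p::(real ^ ('p + 'q)) \<times> real. (fst p, cis (2 * pi / T * snd p))) UNIV"
      by (rule smooth_on_Pair[OF smooth_on_bounded_linear[OF bounded_linear_fst]
            smooth_on_cis[OF smooth_on_mult[OF smooth_on_const smooth_on_bounded_linear[OF bounded_linear_snd]]]])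
    from smooth_on_UNIV_has_derivative[OF this]
    obtain Dp where "\<forall>p. ((\<lambda>p::(real ^ ('p + 'q)) \<times> real. (fst p, cis (2 * pi / T * snd p))) has_derivative Dp p) (at p)"
      by (elim exE)
    note Dp = this[rule_format]
    have "(\<Lambda> has_derivative D\<Lambda>) (at ((\<lambda>p. (fst p, cis (2 * pi / T * snd p))) (\<xi> x, \<tau> x x)))"
      using D\<Lambda> \<tau>x by simp
    from has_derivative_compose[OF Dp this]
    have *: "((\<lambda>p. \<Lambda> (fst p, cis (2 * pi / T * snd p))) has_derivative (\<lambda>v. D\<Lambda> (Dp (\<xi> x, \<tau> x x) v)))
        (at (\<xi> x, \<tau> x x))" .
    show "SL_at X D x"
    proof (rule family_SL_at[OF x D U_open xU[OF x] D\<xi> D\<tau>[OF xU[OF x]] f[OF x] _ _ *])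
      show "(\<Sum>j\<in>UNIV. quadric_sign j * (\<xi> y $ j)\<^sup>2) = c" if "y \<in> X \<inter> U x" for y
        using X that by (simp add: quadric_form_def)
      show "\<xi> x \<noteq> 0" using X[OF x] by blast
      show "\<Lambda> (fst (\<xi> y, \<tau> x y), cis (2 * pi / T * snd (\<xi> y, \<tau> x y))) = y" if "y \<in> X \<inter> U x" for y
        using cis_\<tau>[OF x, of y] \<Lambda>[of y] that by simp
    qed
  qed
qed

text \<open>Removing 0 lets one statement serve all \<open>c\<close>: nothing is lost for
  \<open>c \<noteq> 0\<close>, and for \<open>c = 0\<close> it takes out the vertex.\<close>

lemma family_image:
  assumes X: "\<And>y. y \<in> X \<Longrightarrow> norm (\<sigma> y) = 1 \<and> \<xi> y \<noteq> 0 \<and> quadric_form (\<xi> y) = c"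
    and \<Lambda>: "\<And>x s. x \<noteq> 0 \<Longrightarrow> quadric_form x = c \<Longrightarrow> norm s = 1 \<Longrightarrow>
      \<Lambda> (x, s) \<in> X \<and> \<xi> (\<Lambda> (x, s)) = x \<and> \<sigma> (\<Lambda> (x, s)) = s"
  shows "(\<lambda>y. \<chi> j. complex_of_real (\<xi> y $ j) * w j (circle_time (\<sigma> y))) ` X = family c - {0}"
    (is "?f ` X = _")
proof (intro equalityI subsetI)
  fix z assume "z \<in> ?f ` X"
  then obtain y where y: "y \<in> X" "z = ?f y" by blast
  obtain j where "\<xi> y $ j \<noteq> 0" using X[OF y(1)] by (auto simp: vec_eq_iff)
  then have "z $ j \<noteq> 0" using w_nz by (simp add: y(2))
  then have "z \<noteq> 0" by auto
  then show "z \<in> family c - {0}" using X[OF y(1)] y(2) by (auto simp: family_def)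
next
  fix z assume "z \<in> family c - {0}"
  then obtain x t where x: "quadric_form x = c" "z = (\<chi> j. complex_of_real (x $ j) * w j t)" "z \<noteq> 0"
    by (auto simp: family_def)
  then have "x \<noteq> 0" by (auto simp: vec_eq_iff)
  define s where "s = cis (2 * pi * t / T)"
  have s: "norm s = 1" by (simp add: s_def)
  have "w j (circle_time s) = w j t" for j
    by (rule w_eq_cis) (use cis_circle_time[OF s] s_def in simp)
  then have "z = ?f (\<Lambda> (x, s))"
    using \<Lambda>[OF \<open>x \<noteq> 0\<close> x(1) s] x(2) by simp
  then show "z \<in> ?f ` X"
    using \<Lambda>[OF \<open>x \<noteq> 0\<close> x(1) s] by blast
qed

lemma zero_notin_family: "c \<noteq> 0 \<Longrightarrow> 0 \<notin> family c"
proof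
  assume "c \<noteq> 0" "0 \<in> family c"
  then obtain x t where x: "quadric_form x = c" "0 = (\<chi> j. complex_of_real (x $ j) * w j t)"
    by (auto simp: family_def)
  have "complex_of_real (x $ j) * w j t = 0" for j
    using arg_cong[OF x(2), of "\<lambda>v. v $ j"] by simp
  then have "x $ j = 0" for j
    using w_nz[of j t] by (metis mult_eq_0_iff of_real_eq_0_iff)
  then show False using x(1) \<open>c \<noteq> 0\<close> by (simp add: quadric_form_def)
qed

text \<open>For \<open>c > 0\<close> the first block of a point of the quadric has squared length c
  plus that of the second block, hence never vanishes. Its direction gives the sphere and the second
  block is free.\<close>

lemma SL_immersed_image_pos:
  assumes "c > 0"
  shows "SL_immersed_image (sphere (0 :: real ^ 'p) 1 \<times> (UNIV :: (real ^ 'q) set) \<times> sphere (0 :: complex) 1) (family c)"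
    (is "SL_immersed_image ?X _")
proof -
  define \<xi> :: "(real^'p) \<times> (real^'q) \<times> complex \<Rightarrow> real ^ ('p + 'q)" where
    "\<xi> y = (\<chi> j. case j of Inl i \<Rightarrow> sqrt (c + fst (snd y) \<bullet> fst (snd y)) * fst y $ i | Inr k \<Rightarrow> fst (snd y) $ k)" for y
  define \<sigma> :: "(real^'p) \<times> (real^'q) \<times> complex \<Rightarrow> complex" where "\<sigma> y = snd (snd y)" for y
  define R :: "real ^ ('p + 'q) \<Rightarrow> real" where "R x = sqrt (c + (\<Sum>k\<in>UNIV. (x $ Inr k)\<^sup>2))" for x
  define \<Lambda> :: "(real ^ ('p + 'q)) \<times> complex \<Rightarrow> (real^'p) \<times> (real^'q) \<times> complex" where
    "\<Lambda> p = ((\<chi> i. fst p $ Inl i / R (fst p)), (\<chi> k. fst p $ Inr k), snd p)" for p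
  have pos: "c + v \<bullet> v > 0" for v :: "real^'q" using assms by (simp add: add_pos_nonneg)
  have pos': "c + (\<Sum>k\<in>UNIV. (x $ Inr k)\<^sup>2) > 0" for x :: "real ^ ('p + 'q)"
    using assms by (simp add: add_pos_nonneg sum_nonneg)
  have lin: "bounded_linear (\<lambda>y::(real^'p) \<times> (real^'q) \<times> complex. fst (snd y))" "bounded_linear \<sigma>"
    unfolding \<sigma>_def
    by (rule bounded_linear_compose[OF bounded_linear_fst bounded_linear_snd]
        bounded_linear_compose[OF bounded_linear_snd bounded_linear_snd])+
  note sm = smooth_on_bounded_linear[OF bounded_linear_fst] smooth_on_bounded_linear[OF lin(1)]
  have s\<xi>: "smooth_on \<xi> UNIV"
    unfolding \<xi>_def
  proof (rule smooth_on_vec_lambda)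
    fix j :: "'p + 'q"
    show "smooth_on (\<lambda>y. case j of Inl i \<Rightarrow> sqrt (c + fst (snd y) \<bullet> fst (snd y)) * fst y $ i | Inr k \<Rightarrow> fst (snd y) $ k)
       (UNIV :: ((real^'p) \<times> (real^'q) \<times> complex) set)"
    proof (cases j)
      case (Inl i)
      then show ?thesis
        using pos by (simp, intro smooth_on_mult[OF smooth_on_sqrt_compose[OF smooth_on_add[OF smooth_on_const
              smooth_on_inner[OF sm(2) sm(2)]]] smooth_on_vec_nth[OF sm(1)]]) simp
    next
      case (Inr k)
      then show ?thesis using smooth_on_vec_nth[OF sm(2)] by simp
    qed
  qed
  have Xq: "norm (\<sigma> y) = 1 \<and> \<xi> y \<noteq> 0 \<and> quadric_form (\<xi> y) = c" if "y \<in> ?X" for y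
  proof -
    obtain a b s where "y = (a, b, s)" by (rule prod_cases3)
    with that have y: "y = (a, b, s)" "norm a = 1" "norm s = 1" by simp_all
    have "(\<Sum>i\<in>UNIV. (a $ i)\<^sup>2) = 1" using y(2) norm_sq_sum[of a] by simp
    then have q: "quadric_form (\<xi> y) = c"
      using pos[of b] by (simp add: y quadric_form_eq \<xi>_def power_mult_distrib sum_distrib_left[symmetric] inner_self_sum)
    then have "\<xi> y \<noteq> 0" using assms by (auto simp: quadric_form_eq)
    with q y show ?thesis by (simp add: \<sigma>_def)
  qed
  have \<Lambda>\<xi>: "\<Lambda> (\<xi> y, \<sigma> y) = y" for y
  proof -
    obtain a b s where y: "y = (a, b, s)" by (rule prod_cases3)
    have "R (\<xi> y) = sqrt (c + b \<bullet> b)"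
      by (simp add: R_def \<xi>_def y inner_self_sum)
    moreover have "sqrt (c + b \<bullet> b) \<noteq> 0" using pos[of b] by simp
    ultimately show ?thesis
      by (simp add: \<Lambda>_def \<xi>_def \<sigma>_def y vec_eq_iff)
  qed
  have d\<Lambda>: "\<Lambda> differentiable (at p)" for p
    unfolding \<Lambda>_def R_def using pos'[of "fst p"]
    by (intro differentiable_Pair differentiable_vec_lambda differentiable_divide differentiable_vec_nth
        differentiable_fst differentiable_snd differentiable_real_sqrt differentiable_add differentiable_const
        differentiable_sum differentiable_power ballI) auto
  have \<Lambda>X: "\<Lambda> (x, s) \<in> ?X \<and> \<xi> (\<Lambda> (x, s)) = x \<and> \<sigma> (\<Lambda> (x, s)) = s"
    if "quadric_form x = c" "norm s = 1" for x s
  proof -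
    have R: "R x > 0" "(R x)\<^sup>2 = (\<Sum>i\<in>UNIV. (x $ Inl i)\<^sup>2)"
      using pos'[of x] that(1) by (simp_all add: R_def quadric_form_eq)
    have "norm (\<chi> i. x $ Inl i / R x) = 1"
      by (rule norm_vec_divide[OF R])
    moreover have "sqrt (c + (\<chi> k. x $ Inr k) \<bullet> (\<chi> k. x $ Inr k)) = R x"
      by (simp add: R_def inner_self_sum)
    ultimately show ?thesis
      using that R(1) by (auto simp: \<Lambda>_def \<xi>_def \<sigma>_def vec_eq_iff split: sum.split)
  qed
  have "\<exists>P. tangent_projection ?X P ((DIM(real^'p) - 1) + (DIM(real^'q) + (DIM(complex) - 1)))"
    by (rule exI) (rule tangent_projection_Times[OF tangent_projection_sphere tangent_projection_Times[OF tangent_projection_open[OF open_UNIV] tangent_projection_sphere]])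
  moreover have "(DIM(real^'p) - 1) + (DIM(real^'q) + (DIM(complex) - 1)) = CARD('p + 'q)"
    using zero_less_card_finite[where 'a = 'p] zero_less_card_finite[where 'a = 'q] by simp
  ultimately obtain P where P: "tangent_projection ?X P CARD('p + 'q)" by metis
  have "SL_immersion ?X (\<lambda>y. \<chi> j. complex_of_real (\<xi> y $ j) * w j (circle_time (\<sigma> y)))"
    by (rule family_immersion[OF P s\<xi> smooth_on_bounded_linear[OF lin(2)] Xq])
      (use d\<Lambda> \<Lambda>\<xi> in auto)
  moreover have "(\<lambda>y. \<chi> j. complex_of_real (\<xi> y $ j) * w j (circle_time (\<sigma> y))) ` ?X = family c - {0}"
    by (rule family_image[where \<Lambda> = \<Lambda>]) (use Xq \<Lambda>X in blast)+
  moreover have "family c - {0} = family c"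
    using zero_notin_family[of c] assms by simp
  ultimately show ?thesis
    unfolding SL_immersed_image_def by (metis (no_types, lifting))
qed

lemma SL_immersed_image_neg:
  assumes "c < 0"
  shows "SL_immersed_image ((UNIV :: (real ^ 'p) set) \<times> sphere (0 :: real ^ 'q) 1 \<times> sphere (0 :: complex) 1) (family c)"
    (is "SL_immersed_image ?X _")
proof -
  define \<xi> :: "(real^'p) \<times> (real^'q) \<times> complex \<Rightarrow> real ^ ('p + 'q)" where
    "\<xi> y = (\<chi> j. case j of Inl i \<Rightarrow> fst y $ i | Inr k \<Rightarrow> sqrt (fst y \<bullet> fst y - c) * fst (snd y) $ k)" for y
  define \<sigma> :: "(real^'p) \<times> (real^'q) \<times> complex \<Rightarrow> complex" where "\<sigma> y = snd (snd y)" for y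
  define R :: "real ^ ('p + 'q) \<Rightarrow> real" where "R x = sqrt ((\<Sum>i\<in>UNIV. (x $ Inl i)\<^sup>2) - c)" for x
  define \<Lambda> :: "(real ^ ('p + 'q)) \<times> complex \<Rightarrow> (real^'p) \<times> (real^'q) \<times> complex" where
    "\<Lambda> p = ((\<chi> i. fst p $ Inl i), (\<chi> k. fst p $ Inr k / R (fst p)), snd p)" for p
  have pos: "v \<bullet> v - c > 0" for v :: "real^'p"
    using assms inner_ge_zero[of v] by linarith
  have pos': "(\<Sum>i\<in>UNIV. (x $ Inl i)\<^sup>2) - c > 0" for x :: "real ^ ('p + 'q)"
    using assms sum_nonneg[of UNIV "\<lambda>i. (x $ Inl i)\<^sup>2"] by simp
  have lin: "bounded_linear (\<lambda>y::(real^'p) \<times> (real^'q) \<times> complex. fst (snd y))" "bounded_linear \<sigma>"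
    unfolding \<sigma>_def
    by (rule bounded_linear_compose[OF bounded_linear_fst bounded_linear_snd]
        bounded_linear_compose[OF bounded_linear_snd bounded_linear_snd])+
  note sm = smooth_on_bounded_linear[OF bounded_linear_fst] smooth_on_bounded_linear[OF lin(1)]
  have s\<xi>: "smooth_on \<xi> UNIV"
    unfolding \<xi>_def
  proof (rule smooth_on_vec_lambda)
    fix j :: "'p + 'q"
    show "smooth_on (\<lambda>y. case j of Inl i \<Rightarrow> fst y $ i | Inr k \<Rightarrow> sqrt (fst y \<bullet> fst y - c) * fst (snd y) $ k)
       (UNIV :: ((real^'p) \<times> (real^'q) \<times> complex) set)"
    proof (cases j)
      case (Inl i)
      then show ?thesis using smooth_on_vec_nth[OF sm(1)] by simp
    next
      case (Inr k)
      then show ?thesis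
        using pos by (simp, intro smooth_on_mult[OF smooth_on_sqrt_compose[OF smooth_on_diff[OF
              smooth_on_inner[OF sm(1) sm(1)] smooth_on_const]] smooth_on_vec_nth[OF sm(2)]]) simp
    qed
  qed
  have Xq: "norm (\<sigma> y) = 1 \<and> \<xi> y \<noteq> 0 \<and> quadric_form (\<xi> y) = c" if "y \<in> ?X" for y
  proof -
    obtain a b s where "y = (a, b, s)" by (rule prod_cases3)
    with that have y: "y = (a, b, s)" "norm b = 1" "norm s = 1" by simp_all
    have "(\<Sum>i\<in>UNIV. (b $ i)\<^sup>2) = 1" using y(2) norm_sq_sum[of b] by simp
    then have q: "quadric_form (\<xi> y) = c"
      using pos[of a] by (simp add: y quadric_form_eq \<xi>_def power_mult_distrib sum_distrib_left[symmetric] inner_self_sum)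
    then have "\<xi> y \<noteq> 0" using assms by (auto simp: quadric_form_eq)
    with q y show ?thesis by (simp add: \<sigma>_def)
  qed
  have \<Lambda>\<xi>: "\<Lambda> (\<xi> y, \<sigma> y) = y" for y
  proof -
    obtain a b s where y: "y = (a, b, s)" by (rule prod_cases3)
    have "R (\<xi> y) = sqrt (a \<bullet> a - c)"
      by (simp add: R_def \<xi>_def y inner_self_sum)
    moreover have "sqrt (a \<bullet> a - c) \<noteq> 0" using pos[of a] by simp
    ultimately show ?thesis
      by (simp add: \<Lambda>_def \<xi>_def \<sigma>_def y vec_eq_iff)
  qed
  have d\<Lambda>: "\<Lambda> differentiable (at p)" for p
    unfolding \<Lambda>_def R_def using pos'[of "fst p"]
    by (intro differentiable_Pair differentiable_vec_lambda differentiable_divide differentiable_vec_nth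
        differentiable_fst differentiable_snd differentiable_real_sqrt differentiable_diff differentiable_const
        differentiable_sum differentiable_power ballI) auto
  have \<Lambda>X: "\<Lambda> (x, s) \<in> ?X \<and> \<xi> (\<Lambda> (x, s)) = x \<and> \<sigma> (\<Lambda> (x, s)) = s"
    if "quadric_form x = c" "norm s = 1" for x s
  proof -
    have R: "R x > 0" "(R x)\<^sup>2 = (\<Sum>k\<in>UNIV. (x $ Inr k)\<^sup>2)"
      using pos'[of x] that(1) by (simp_all add: R_def quadric_form_eq)
    have "norm (\<chi> k. x $ Inr k / R x) = 1"
      by (rule norm_vec_divide[OF R])
    moreover have "sqrt ((\<chi> i. x $ Inl i) \<bullet> (\<chi> i. x $ Inl i) - c) = R x"
      by (simp add: R_def inner_self_sum)
    ultimately show ?thesis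
      using that R(1) by (auto simp: \<Lambda>_def \<xi>_def \<sigma>_def vec_eq_iff split: sum.split)
  qed
  have "\<exists>P. tangent_projection ?X P (DIM(real^'p) + ((DIM(real^'q) - 1) + (DIM(complex) - 1)))"
    by (rule exI) (rule tangent_projection_Times[OF tangent_projection_open[OF open_UNIV] tangent_projection_Times[OF tangent_projection_sphere tangent_projection_sphere]])
  moreover have "DIM(real^'p) + ((DIM(real^'q) - 1) + (DIM(complex) - 1)) = CARD('p + 'q)"
    using zero_less_card_finite[where 'a = 'p] zero_less_card_finite[where 'a = 'q] by simp
  ultimately obtain P where P: "tangent_projection ?X P CARD('p + 'q)" by metis
  have "SL_immersion ?X (\<lambda>y. \<chi> j. complex_of_real (\<xi> y $ j) * w j (circle_time (\<sigma> y)))"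
    by (rule family_immersion[OF P s\<xi> smooth_on_bounded_linear[OF lin(2)] Xq])
      (use d\<Lambda> \<Lambda>\<xi> in auto)
  moreover have "(\<lambda>y. \<chi> j. complex_of_real (\<xi> y $ j) * w j (circle_time (\<sigma> y))) ` ?X = family c - {0}"
    by (rule family_image[where \<Lambda> = \<Lambda>]) (use Xq \<Lambda>X in blast)+
  moreover have "family c - {0} = family c"
    using zero_notin_family[of c] assms by simp
  ultimately show ?thesis
    unfolding SL_immersed_image_def by (metis (no_types, lifting))
qed

text \<open>On the null quadric the two blocks have the same length, which serves as the radial
  coordinate; their directions give the two spheres. The parametrisation is linear in the radius and
  so respects dilations.\<close>

lemma SL_immersed_cone_zero:
  "SL_immersed_cone (sphere (0 :: real ^ 'p) 1 \<times> sphere (0 :: real ^ 'q) 1 \<times> sphere (0 :: complex) 1) (family 0)"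
    (is "SL_immersed_cone ?S _")
proof -
  define \<xi> :: "((real^'p) \<times> (real^'q) \<times> complex) \<times> real \<Rightarrow> real ^ ('p + 'q)" where
    "\<xi> y = (\<chi> j. case j of Inl i \<Rightarrow> snd y * fst (fst y) $ i | Inr k \<Rightarrow> snd y * fst (snd (fst y)) $ k)" for y
  define \<sigma> :: "((real^'p) \<times> (real^'q) \<times> complex) \<times> real \<Rightarrow> complex" where "\<sigma> y = snd (snd (fst y))" for y
  define R :: "real ^ ('p + 'q) \<Rightarrow> real" where "R x = sqrt (\<Sum>i\<in>UNIV. (x $ Inl i)\<^sup>2)" for x
  define \<Lambda> :: "(real ^ ('p + 'q)) \<times> complex \<Rightarrow> ((real^'p) \<times> (real^'q) \<times> complex) \<times> real" where
    "\<Lambda> p = (((\<chi> i. fst p $ Inl i / R (fst p)), (\<chi> k. fst p $ Inr k / R (fst p)), snd p), R (fst p))" for p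
  let ?X = "?S \<times> {0::real<..}"
  have lin: "bounded_linear (\<lambda>y::((real^'p) \<times> (real^'q) \<times> complex) \<times> real. fst (fst y))"
    "bounded_linear (\<lambda>y::((real^'p) \<times> (real^'q) \<times> complex) \<times> real. fst (snd (fst y)))"
    "bounded_linear \<sigma>"
    unfolding \<sigma>_def
    by (rule bounded_linear_compose[OF bounded_linear_fst bounded_linear_fst]
        bounded_linear_compose[OF bounded_linear_fst bounded_linear_compose[OF bounded_linear_snd bounded_linear_fst]]
        bounded_linear_compose[OF bounded_linear_snd bounded_linear_compose[OF bounded_linear_snd bounded_linear_fst]])+
  note sm = smooth_on_bounded_linear[OF lin(1)] smooth_on_bounded_linear[OF lin(2)]
    smooth_on_bounded_linear[OF bounded_linear_snd]
  have s\<xi>: "smooth_on \<xi> UNIV"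
    unfolding \<xi>_def
  proof (rule smooth_on_vec_lambda)
    fix j :: "'p + 'q"
    show "smooth_on (\<lambda>y. case j of Inl i \<Rightarrow> snd y * fst (fst y) $ i | Inr k \<Rightarrow> snd y * fst (snd (fst y)) $ k)
       (UNIV :: (((real^'p) \<times> (real^'q) \<times> complex) \<times> real) set)"
    proof (cases j)
      case (Inl i)
      then show ?thesis using smooth_on_mult[OF sm(3) smooth_on_vec_nth[OF sm(1)]] by simp
    next
      case (Inr k)
      then show ?thesis using smooth_on_mult[OF sm(3) smooth_on_vec_nth[OF sm(2)]] by simp
    qed
  qed
  have Xq: "norm (\<sigma> y) = 1 \<and> \<xi> y \<noteq> 0 \<and> quadric_form (\<xi> y) = 0 \<and> R (\<xi> y) = snd y" if "y \<in> ?X" for y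
  proof -
    obtain a b s r where "y = ((a, b, s), r)" by (metis prod.exhaust)
    with that have y: "y = ((a, b, s), r)" "norm a = 1" "norm b = 1" "norm s = 1" "r > 0" by simp_all
    have ab: "(\<Sum>i\<in>UNIV. (a $ i)\<^sup>2) = 1" "(\<Sum>i\<in>UNIV. (b $ i)\<^sup>2) = 1"
      using y(2,3) norm_sq_sum[of a] norm_sq_sum[of b] by simp_all
    have q: "quadric_form (\<xi> y) = 0"
      using ab by (simp add: y quadric_form_eq \<xi>_def power_mult_distrib sum_distrib_left[symmetric])
    have R: "R (\<xi> y) = r"
      using ab by (simp add: y(1) abs_of_pos[OF y(5)] R_def \<xi>_def power_mult_distrib sum_distrib_left[symmetric])
    then have "\<xi> y \<noteq> 0" using y(5) by (auto simp: R_def)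
    with q R y show ?thesis by (simp add: \<sigma>_def)
  qed
  have \<Lambda>\<xi>: "\<Lambda> (\<xi> y, \<sigma> y) = y" if "y \<in> ?X" for y
  proof -
    obtain a b s r where y: "y = ((a, b, s), r)" by (metis prod.exhaust)
    have "r > 0" "R (\<xi> y) = r" using Xq[OF that] that by (simp_all add: y)
    then show ?thesis
      by (simp add: \<Lambda>_def) (simp add: \<xi>_def \<sigma>_def y vec_eq_iff)
  qed
  have d\<Lambda>: "\<Lambda> differentiable (at p)" if "(\<Sum>i\<in>UNIV. (fst p $ Inl i)\<^sup>2) > 0" for p
    unfolding \<Lambda>_def R_def using that
    by (intro differentiable_Pair differentiable_vec_lambda differentiable_divide differentiable_vec_nth
        differentiable_fst differentiable_snd differentiable_real_sqrt differentiable_add differentiable_const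
        differentiable_sum differentiable_power ballI) auto
  have \<Lambda>X: "\<Lambda> (x, s) \<in> ?X \<and> \<xi> (\<Lambda> (x, s)) = x \<and> \<sigma> (\<Lambda> (x, s)) = s"
    if "x \<noteq> 0" "quadric_form x = 0" "norm s = 1" for x s
  proof -
    have "(\<Sum>i\<in>UNIV. (x $ Inl i)\<^sup>2) \<noteq> 0"
    proof
      assume 0: "(\<Sum>i\<in>UNIV. (x $ Inl i)\<^sup>2) = 0"
      then have "(\<Sum>i\<in>UNIV. (x $ Inr i)\<^sup>2) = 0" using that(2) by (simp add: quadric_form_eq)
      with 0 have "x $ Inl i = 0" "x $ Inr k = 0" for i k
        by (simp_all add: sum_nonneg_eq_0_iff)
      then have "x $ j = 0" for j by (cases j) simp_all
      then show False using that(1) by (simp add: vec_eq_iff)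
    qed
    then have "(\<Sum>i\<in>UNIV. (x $ Inl i)\<^sup>2) > 0"
      by (simp add: order_less_le sum_nonneg)
    then have R: "R x > 0" "(R x)\<^sup>2 = (\<Sum>i\<in>UNIV. (x $ Inl i)\<^sup>2)" "(R x)\<^sup>2 = (\<Sum>i\<in>UNIV. (x $ Inr i)\<^sup>2)"
      using that(2) by (simp_all add: R_def quadric_form_eq)
    then show ?thesis
      using that(3) norm_vec_divide[OF R(1,2)] norm_vec_divide[OF R(1,3)]
      by (auto simp: \<Lambda>_def \<xi>_def \<sigma>_def vec_eq_iff split: sum.split)
  qed
  have "\<exists>P. tangent_projection ?X P
     (((DIM(real^'p) - 1) + ((DIM(real^'q) - 1) + (DIM(complex) - 1))) + DIM(real))"
    by (rule exI) (rule tangent_projection_Times[OF tangent_projection_Times[OF tangent_projection_sphere tangent_projection_Times[OF tangent_projection_sphere tangent_projection_sphere]] tangent_projection_open[OF open_greaterThan]])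
  moreover have "((DIM(real^'p) - 1) + ((DIM(real^'q) - 1) + (DIM(complex) - 1))) + DIM(real) = CARD('p + 'q)"
    using zero_less_card_finite[where 'a = 'p] zero_less_card_finite[where 'a = 'q] by simp
  ultimately obtain P where P: "tangent_projection ?X P CARD('p + 'q)" by metis
  let ?f = "\<lambda>y. \<chi> j. complex_of_real (\<xi> y $ j) * w j (circle_time (\<sigma> y))"
  have "SL_immersion ?X ?f"
  proof (rule family_immersion[OF P s\<xi> smooth_on_bounded_linear[OF lin(3)]])
    show "norm (\<sigma> y) = 1 \<and> \<xi> y \<noteq> 0 \<and> quadric_form (\<xi> y) = 0" if "y \<in> ?X" for y
      using Xq[OF that] by blast
    show "\<Lambda> differentiable (at (\<xi> y, \<sigma> y)) \<and> \<Lambda> (\<xi> y, \<sigma> y) = y" if y: "y \<in> ?X" for y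
    proof -
      have "R (\<xi> y) > 0" using Xq[OF y] y by auto
      then show ?thesis using d\<Lambda>[of "(\<xi> y, \<sigma> y)"] \<Lambda>\<xi>[OF y] by (simp add: R_def)
    qed
  qed
  moreover have "family 0 - {0} = ?f ` ?X"
    by (rule family_image[symmetric, where \<Lambda> = \<Lambda>]) (use Xq \<Lambda>X in blast)+
  moreover have "?f (s, r) = r *\<^sub>R ?f (s, 1)" for s r
    by (auto simp: \<xi>_def \<sigma>_def vec_eq_iff scaleR_conv_of_real[where 'a = complex] split: sum.split)
  moreover have "0 \<in> family 0"
    unfolding family_def mem_Collect_eq
    by (intro exI[of _ 0]) (simp add: quadric_form_def vec_eq_iff)
  ultimately show ?thesis
    unfolding SL_immersed_cone_def by (intro disjI1 exI[of _ ?f]) blast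
qed

end

section \<open>The singular cone\<close>

lemma smooth_map_on_has_derivative:
  assumes "smooth_map_on X f" "x \<in> X"
  shows "\<exists>D. (f has_derivative D) (at x within X)"
  using smooth_map_on_local_derivative[OF assms] assms(2) by (metis IntI)

lemma smooth_on_has_derivative:
  assumes "smooth_on f U" "x \<in> U"
  shows "\<exists>D. (f has_derivative D) (at x)"
  using smooth_on_derivative[OF assms(1)] assms(2) by metis

text \<open>Difference quotients of \<open>g\<close> along a curve through \<open>x\<close> are
  dilates of points of \<open>N\<close>, and \<open>N\<close> is closed. The limit is taken from the
  right because only nonnegative dilations are assumed.\<close>

lemma immersion_derivative_in_closed_cone:
  fixes g :: "real ^ 'm::finite \<Rightarrow> 'b::real_normed_vector"
  assumes N: "closed N" "\<And>z r. z \<in> N \<Longrightarrow> r \<ge> 0 \<Longrightarrow> r *\<^sub>R z \<in> N"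
    and W: "open W" "x \<in> W" "g ` W \<subseteq> N" "g x = 0" and D: "(g has_derivative D) (at x within W)"
  shows "D v \<in> N"
proof -
  have "v \<in> tangent_space W x"
    using tangent_space_open[OF W(1,2)] by simp
  then obtain \<gamma> e where g: "0 < e" "\<gamma> ` {-e<..<e::real} \<subseteq> W" "\<gamma> 0 = x" "(\<gamma> has_vector_derivative v) (at 0)"
    by (rule tangent_spaceE)
  have "((\<lambda>t. g (\<gamma> t)) has_vector_derivative D v) (at 0)"
    using has_vector_derivative_along_curve[of g D \<gamma>, OF _ g(1,2,4)] D g(3) by simp
  then have "((\<lambda>t. (1 / norm t) *\<^sub>R (g (\<gamma> t) - t *\<^sub>R D v)) \<longlongrightarrow> 0) (at 0)"
    unfolding has_vector_derivative_def has_derivative_at2 by (simp add: g(3) W(4))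
  then have "((\<lambda>t. norm ((1 / norm t) *\<^sub>R (g (\<gamma> t) - t *\<^sub>R D v))) \<longlongrightarrow> 0) (at 0)"
    by (rule tendsto_norm_zero)
  moreover have "norm ((1 / norm t) *\<^sub>R (g (\<gamma> t) - t *\<^sub>R D v)) = norm ((1 / t) *\<^sub>R g (\<gamma> t) - D v)" if "t \<noteq> 0" for t
  proof -
    have "(1 / t) *\<^sub>R g (\<gamma> t) - D v = (1 / t) *\<^sub>R (g (\<gamma> t) - t *\<^sub>R D v)"
      using that by (simp add: algebra_simps)
    then show ?thesis by simp
  qed
  then have "\<forall>\<^sub>F t in at 0. norm ((1 / norm t) *\<^sub>R (g (\<gamma> t) - t *\<^sub>R D v)) = norm ((1 / t) *\<^sub>R g (\<gamma> t) - D v)"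
    by (auto simp: eventually_at intro: exI[of _ 1])
  ultimately have "((\<lambda>t. norm ((1 / t) *\<^sub>R g (\<gamma> t) - D v)) \<longlongrightarrow> 0) (at 0)"
    by (rule Lim_transform_eventually)
  then have "((\<lambda>t. (1 / t) *\<^sub>R g (\<gamma> t)) \<longlongrightarrow> D v) (at 0)"
    by (rule LIM_zero_cancel[OF tendsto_norm_zero_cancel])
  then have lim: "((\<lambda>t. (1 / t) *\<^sub>R g (\<gamma> t)) \<longlongrightarrow> D v) (at_right 0)"
    by (rule tendsto_within_subset) simp
  have "\<forall>\<^sub>F t in at_right 0. (1 / t) *\<^sub>R g (\<gamma> t) \<in> N"
  proof (rule eventually_at_rightI[of 0 e])
    fix t assume t: "t \<in> {0<..<e}"
    then have "\<gamma> t \<in> W" using g(2) by auto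
    then have "g (\<gamma> t) \<in> N" using W(3) by blast
    then show "(1 / t) *\<^sub>R g (\<gamma> t) \<in> N" using t by (intro N(2)) auto
  qed (rule g(1))
  from Lim_in_closed_set[OF N(1) this trivial_limit_at_right_real lim] show ?thesis .
qed

context periodic_evolution
begin

text \<open>No \<open>w j\<close> vanishes, so membership at a given time is the closed condition
  that all \<open>z $ j / w j t\<close> are real and lie on the quadric. Time can be confined to the
  compact interval \<open>{0..T}\<close>, and projection along a compact factor preserves
  closedness.\<close>

lemma closed_family: "closed (family c)"
proof -
  define K where "K = {p :: (complex ^ ('p + 'q)) \<times> real. (\<forall>j. Im (fst p $ j / w j (snd p)) = 0) \<and>
     (\<Sum>j\<in>UNIV. quadric_sign j * (Re (fst p $ j / w j (snd p)))\<^sup>2) = c}"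
  have "continuous_on UNIV (w j)" for j
    using smooth_on_Ck[OF smooth_w, of 0 j UNIV] by simp
  then have cont: "continuous_on UNIV (\<lambda>p :: (complex ^ ('p + 'q)) \<times> real. fst p $ j / w j (snd p))" for j
    by (intro continuous_on_divide continuous_on_component continuous_on_fst continuous_on_id
        continuous_on_compose2[of UNIV "w j" UNIV snd] continuous_on_snd) (auto simp: w_nz)
  have "closed K"
    unfolding K_def
    by (intro closed_Collect_conj closed_Collect_all closed_Collect_eq continuous_on_const
        continuous_on_Im continuous_on_Re continuous_on_sum continuous_on_mult continuous_on_power cont)
  then have "closedin (top_of_set (UNIV \<times> {0..T})) ((UNIV \<times> {0..T}) \<inter> K)"
    by (rule closedin_closed_Int)
  then have "closedin (top_of_set UNIV) (fst ` ((UNIV \<times> {0..T}) \<inter> K))"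
    by (rule Starlike.closed_map_fst[OF compact_Icc])
  then have "closed (fst ` ((UNIV \<times> {0..T}) \<inter> K))"
    by simp
  also have "fst ` ((UNIV \<times> {0..T}) \<inter> K) = family c"
  proof (intro equalityI subsetI)
    fix z assume "z \<in> fst ` ((UNIV \<times> {0..T}) \<inter> K)"
    then obtain t where t: "(z, t) \<in> K" by auto
    define x :: "real ^ ('p + 'q)" where "x = (\<chi> j. Re (z $ j / w j t))"
    have "complex_of_real (x $ j) = z $ j / w j t" for j
      using t by (simp add: K_def x_def complex_eq_iff)
    then have "z = (\<chi> j. complex_of_real (x $ j) * w j t)"
      using w_nz by (simp add: vec_eq_iff)
    moreover have "quadric_form x = c"
      using t by (simp add: K_def x_def quadric_form_def)
    ultimately show "z \<in> family c" unfolding family_def by blast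
  next
    fix z assume "z \<in> family c"
    then obtain x t where x: "quadric_form x = c" "z = (\<chi> j. complex_of_real (x $ j) * w j t)"
      by (auto simp: family_def)
    define n :: int where "n = \<lfloor>t / T\<rfloor>"
    define s where "s = t + T * of_int (- n)"
    have "of_int n \<le> t / T" "t / T < of_int n + 1"
      by (auto simp: n_def)
    then have "s \<in> {0..T}"
      using T_pos by (simp add: s_def field_simps)
    moreover have "w j s = w j t" for j
      unfolding s_def by (rule w_periodic_int)
    then have "(z, s) \<in> K"
      using x w_nz by (simp add: K_def quadric_form_def)
    ultimately show "z \<in> fst ` ((UNIV \<times> {0..T}) \<inter> K)" by force
  qed
  finally show ?thesis .
qed

lemma scaleR_family_zero: "z \<in> family 0 \<Longrightarrow> r *\<^sub>R z \<in> family 0"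
proof -
  assume "z \<in> family 0"
  then obtain x t where x: "quadric_form x = 0" "z = (\<chi> j. complex_of_real (x $ j) * w j t)"
    by (auto simp: family_def)
  have "quadric_form (r *\<^sub>R x) = r\<^sup>2 * quadric_form x"
    by (simp add: quadric_form_def power_mult_distrib sum_distrib_left mult_ac)
  moreover have "r *\<^sub>R z = (\<chi> j. complex_of_real ((r *\<^sub>R x) $ j) * w j t)"
    by (simp add: x(2) vec_eq_iff scaleR_conv_of_real[where 'a = complex])
  ultimately show ?thesis
    unfolding family_def mem_Collect_eq using x(1)
    by (intro exI[of _ "r *\<^sub>R x"] exI[of _ t]) simp
qed

lemma cone_family_zero: "cone (family 0)"
  using scaleR_family_zero by (auto simp: cone_def)

lemma zero_in_family: "0 \<in> family 0"
  unfolding family_def mem_Collect_eq by (intro exI[of _ 0]) (simp add: quadric_form_def vec_eq_iff)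

text \<open>The two blocks of a null vector have the same length, so neither can vanish
  alone.\<close>

lemma family_zero_block:
  assumes "z \<in> family 0"
  shows "(\<forall>i. z $ Inl i = 0) \<Longrightarrow> z = 0" and "(\<forall>k. z $ Inr k = 0) \<Longrightarrow> z = 0"
proof -
  obtain x t where x: "quadric_form x = 0" "z = (\<chi> j. complex_of_real (x $ j) * w j t)"
    using assms by (auto simp: family_def)
  have z: "z $ j = 0 \<longleftrightarrow> x $ j = 0" for j
    using w_nz by (simp add: x(2))
  have eq: "(\<Sum>i\<in>UNIV. (x $ Inl i)\<^sup>2) = (\<Sum>k\<in>UNIV. (x $ Inr k)\<^sup>2)"
    using x(1) by (simp add: quadric_form_eq)
  have zj: "z = 0" if "\<And>i. z $ Inl i = 0" "\<And>k. z $ Inr k = 0"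
    unfolding vec_eq_iff
  proof
    fix j show "z $ j = 0 $ j" using that by (cases j) simp_all
  qed
  show "z = 0" if "\<forall>i. z $ Inl i = 0"
  proof -
    have "(\<Sum>k\<in>UNIV. (x $ Inr k)\<^sup>2) = 0" using eq that z by simp
    then have "x $ Inr k = 0" for k by (simp add: sum_nonneg_eq_0_iff)
    then show ?thesis using zj that z by blast
  qed
  show "z = 0" if "\<forall>k. z $ Inr k = 0"
  proof -
    have "(\<Sum>i\<in>UNIV. (x $ Inl i)\<^sup>2) = 0" using eq that z by simp
    then have "x $ Inl i = 0" for i by (simp add: sum_nonneg_eq_0_iff)
    then show ?thesis using zj that z by blast
  qed
qed

text \<open>
  An immersed sheet through \<open>0\<close> would put its tangent space, of dimension \<open>p + q\<close>, into the cone.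
  The cone projects injectively to both factors, so \<open>p = q\<close> and the projection to \<open>\<complex>\<^sup>p\<close> is onto;
  but all coordinates of a point of the cone in \<open>\<complex>\<^sup>p\<close> have the same phase up to sign.
\<close>

lemma not_immersed_near_zero:
  assumes phase: "\<And>i k t. w (Inl i) t = w (Inl k) t" and card: "CARD('p) + CARD('q) \<ge> 3"
  shows "\<not> immersed_near (family 0) 0"
proof
  assume "immersed_near (family 0) 0"
  then obtain U W and g :: "real ^ ('p + 'q) \<Rightarrow> complex ^ ('p + 'q)" where
    U: "open U" "0 \<in> U" "open W" "immersion_on W g" "g ` W = family 0 \<inter> U"
    unfolding immersed_near_def by blast
  obtain x where x: "x \<in> W" "g x = 0"
    using U(2,5) zero_in_family by (metis IntI imageE)
  obtain D where D: "(g has_derivative D) (at x within W)" "inj_on D (tangent_space W x)"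
    using U(4) x(1) unfolding immersion_on_def by blast
  have inj: "inj D"
    using D(2) tangent_space_open[OF U(3) x(1)] by simp
  have lin: "linear D"
    using D(1) has_derivative_linear by blast
  have DN: "D v \<in> family 0" for v
    using immersion_derivative_in_closed_cone[OF closed_family scaleR_family_zero U(3) x(1) _ x(2) D(1)] U(5)
    by auto
  define P where "P v = (\<chi> i. D v $ Inl i)" for v
  define Q where "Q v = (\<chi> k. D v $ Inr k)" for v
  have linP: "linear P" and linQ: "linear Q"
    using lin by (auto simp: P_def Q_def linear_iff vec_eq_iff)
  have "v = 0" if "P v = 0" for v
  proof -
    have "D v = 0" using family_zero_block(1)[OF DN[of v]] that by (simp add: P_def vec_eq_iff)
    then show ?thesis using inj lin by (metis injD linear_0)
  qed
  then have injP: "inj P" using linP linear_injective_0 by blast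
  have "v = 0" if "Q v = 0" for v
  proof -
    have "D v = 0" using family_zero_block(2)[OF DN[of v]] that by (simp add: Q_def vec_eq_iff)
    then show ?thesis using inj lin by (metis injD linear_0)
  qed
  then have injQ: "inj Q" using linQ linear_injective_0 by blast
  have dP: "dim (range P) = CARD('p) + CARD('q)"
    using dim_image_eq[OF linP, of UNIV] injP by (simp add: dim_UNIV)
  have dQ: "dim (range Q) = CARD('p) + CARD('q)"
    using dim_image_eq[OF linQ, of UNIV] injQ by (simp add: dim_UNIV)
  \<comment> \<open>p + q \<le> 2p and p + q \<le> 2q force p = q, and then p + q \<ge> 3 leaves
    room for two distinct indices in the first block.\<close>
  have "dim (range P) \<le> CARD('p) * 2" "dim (range Q) \<le> CARD('q) * 2"
    using dim_subset_UNIV[of "range P"] dim_subset_UNIV[of "range Q"] by simp_all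
  then have pq: "CARD('p) = CARD('q)" "dim (range P) = CARD('p) * 2" "CARD('p) \<ge> 2"
    using dP dQ card by linarith+
  have "subspace (range P)"
    using linP subspace_UNIV by (rule linear_subspace_image)
  then have "span (range P) = range P" by (rule span_eq_iff[THEN iffD2])
  moreover have "span (range P) = UNIV"
    using dim_eq_full[of "range P"] pq(2) by simp
  ultimately have surj: "range P = UNIV" by simp
  obtain i k :: 'p where ik: "i \<noteq> k"
    using pq(3) card_le_Suc0_iff_eq[of "UNIV :: 'p set"] by auto
  \<comment> \<open>The values 1 and \<i> are not real multiples of a common number.\<close>
  obtain v where v: "P v = (\<chi> l. if l = i then 1 else if l = k then \<i> else 0)"
    using surj by (metis UNIV_I imageE)
  obtain y t where y: "D v = (\<chi> j. complex_of_real (y $ j) * w j t)"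
    using DN[of v] by (auto simp: family_def)
  have 1: "complex_of_real (y $ Inl i) * w (Inl i) t = 1"
    using arg_cong[OF v, of "\<lambda>v. v $ i"] y by (simp add: P_def)
  have 2: "complex_of_real (y $ Inl k) * w (Inl i) t = \<i>"
    using arg_cong[OF v, of "\<lambda>v. v $ k"] y ik phase[of k t i] by (simp add: P_def)
  have "complex_of_real (y $ Inl k) = complex_of_real (y $ Inl k) * (complex_of_real (y $ Inl i) * w (Inl i) t)"
    using 1 by simp
  also have "\<dots> = complex_of_real (y $ Inl i) * (complex_of_real (y $ Inl k) * w (Inl i) t)"
    by (simp only: mult_ac)
  also have "\<dots> = complex_of_real (y $ Inl i) * \<i>"
    unfolding 2 ..
  finally have "y $ Inl k = 0"
    by (simp add: complex_eq_iff)
  then show False using 2 by simp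
qed

text \<open>
  Graph charts \<open>x\<^sub>i = \<plusminus> sqrt (\<dots>)\<close> of the cone, times an interval of time longer than a period. The time
  sits in the coordinate \<open>i0\<close> freed by the graph (after swapping \<open>i\<close> and \<open>i0\<close>), and different
  charts use disjoint time intervals, so that together they form one map on an open set.
\<close>

lemma immersed_near_nonzero:
  assumes "q \<noteq> 0"
  shows "immersed_near (family 0) q"
proof -
  define i0 :: 'p where "i0 = undefined"
  obtain num :: "'p \<times> bool \<Rightarrow> nat" where num: "inj num"
    using finite_imp_inj_to_nat_seg[of "UNIV :: ('p \<times> bool) set"] by auto
  define sg :: "bool \<Rightarrow> real" where "sg b = (if b then 1 else -1)" for b
  \<comment> \<open>Length 2T exceeds a full period, and spacing 3T keeps the intervals of different
    \<open>n\<close> apart.\<close>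
  define I where "I n = {3 * T * real n <..< 3 * T * real n + 2 * T}" for n
  have I_disj: "m = n" if "t \<in> I m" "t \<in> I n" for t m n
  proof -
    have "3 * T * real m < 3 * T * real n + 2 * T" "3 * T * real n < 3 * T * real m + 2 * T"
      using that by (auto simp: I_def)
    then have "T * (3 * real m) < T * (3 * real n + 2)" "T * (3 * real n) < T * (3 * real m + 2)"
      by (simp_all add: algebra_simps)
    then have "3 * real m < 3 * real n + 2" "3 * real n < 3 * real m + 2"
      using T_pos by (simp_all only: mult_less_cancel_left_pos)
    then show ?thesis by linarith
  qed
  \<comment> \<open>The square of the coordinate that the null equation determines. The slot
    \<open>Inl i0\<close> is absent because it carries the time.\<close>
  define \<rho> where "\<rho> v = (\<Sum>k\<in>UNIV. (v $ Inr k)\<^sup>2) - (\<Sum>l\<in>UNIV - {i0}. (v $ Inl l)\<^sup>2)" for v :: "real ^ ('p + 'q)"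
  define \<pi> :: "'p \<Rightarrow> 'p + 'q \<Rightarrow> 'p + 'q" where "\<pi> i = Transposition.transpose (Inl i) (Inl i0)" for i
  define \<xi> :: "'p \<times> bool \<Rightarrow> real ^ ('p + 'q) \<Rightarrow> real ^ ('p + 'q)" where
    "\<xi> c v = (\<chi> j. if \<pi> (fst c) j = Inl i0 then sg (snd c) * sqrt (\<rho> v) else v $ \<pi> (fst c) j)" for c v
  define W where "W c = {v. v $ Inl i0 \<in> I (num c) \<and> \<rho> v > 0}" for c
  define G where "G c v = (\<chi> j. complex_of_real (\<xi> c v $ j) * w j (v $ Inl i0))" for c v
  define sel where "sel t = (SOME c. t \<in> I (num c))" for t
  define g where "g v = G (sel (v $ Inl i0)) v" for v
  have sel: "sel (v $ Inl i0) = c" if "v \<in> W c" for v c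
  proof -
    have "v $ Inl i0 \<in> I (num c)" using that by (simp add: W_def)
    then have "v $ Inl i0 \<in> I (num (sel (v $ Inl i0)))" unfolding sel_def by (rule someI)
    with \<open>v $ Inl i0 \<in> I (num c)\<close> show ?thesis using I_disj num by (metis injD)
  qed
  have gG: "g v = G c v" if "v \<in> W c" for v c
    using sel[OF that] by (simp add: g_def)
  have c\<rho>: "continuous_on UNIV \<rho>"
    unfolding \<rho>_def by (intro continuous_intros)
  have W_open: "open (W c)" for c
  proof -
    have "W c = (\<lambda>v. v $ Inl i0) -` I (num c) \<inter> \<rho> -` {0<..}"
      by (auto simp: W_def)
    also have "open \<dots>"
      unfolding I_def by (intro open_Int open_vimage c\<rho> continuous_on_component continuous_on_id open_greaterThanLessThan open_greaterThan)
    finally show ?thesis .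
  qed
  have s\<rho>: "smooth_on \<rho> U" for U
    unfolding \<rho>_def power2_eq_square
    by (rule smooth_on_diff; rule smooth_on_sum; rule smooth_on_mult; rule smooth_on_vec_nth; rule smooth_on_id)
  have s\<xi>: "smooth_on (\<xi> c) (W c)" for c
    unfolding \<xi>_def
  proof (rule smooth_on_vec_lambda)
    fix j
    have sqrt: "smooth_on (\<lambda>v. sqrt (\<rho> v)) (W c)"
      by (rule smooth_on_sqrt_compose[OF s\<rho>]) (simp add: W_def)
    show "smooth_on (\<lambda>v. if \<pi> (fst c) j = Inl i0 then sg (snd c) * sqrt (\<rho> v) else v $ \<pi> (fst c) j) (W c)"
    proof (cases "\<pi> (fst c) j = Inl i0")
      case True
      then show ?thesis using smooth_on_mult[OF smooth_on_const sqrt] by simp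
    next
      case False
      then show ?thesis using smooth_on_vec_nth[OF smooth_on_id] by simp
    qed
  qed
  have sw: "smooth_on (\<lambda>v::real ^ ('p + 'q). w j (v $ Inl i0)) U" for j U
    by (rule smooth_on_compose[OF smooth_on_vec_nth[OF smooth_on_id] smooth_w[of j UNIV]]) simp
  have sG: "smooth_on (G c) (W c)" for c
    unfolding G_def
    by (rule smooth_on_vec_lambda, rule smooth_on_mult[OF smooth_on_of_real[OF smooth_on_vec_nth[OF s\<xi>]] sw])
  have \<pi>: "\<pi> i j = Inl i0 \<longleftrightarrow> j = Inl i" "\<pi> i j = Inl i \<longleftrightarrow> j = Inl i0" "\<pi> i (Inr k) = Inr k" "\<pi> i (\<pi> i j) = j" for i j k
    by (auto simp: \<pi>_def Transposition.transpose_def)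
  have sg: "(sg b)\<^sup>2 = 1" "sg b \<noteq> 0" for b by (auto simp: sg_def)
  have quad: "quadric_form (\<xi> c v) = 0 \<and> \<xi> c v \<noteq> 0" if "\<rho> v > 0" for c v
  proof -
    obtain i b where c: "c = (i, b)" by (cases c)
    have "(\<Sum>l\<in>UNIV. (\<xi> c v $ Inl l)\<^sup>2) = (\<xi> c v $ Inl i)\<^sup>2 + (\<Sum>l\<in>UNIV - {i}. (\<xi> c v $ Inl l)\<^sup>2)"
      by (subst sum.remove[of UNIV i]) auto
    also have "(\<xi> c v $ Inl i)\<^sup>2 = \<rho> v"
      using that by (simp add: \<xi>_def c \<pi>(1) power_mult_distrib sg)
    also have "(\<Sum>l\<in>UNIV - {i}. (\<xi> c v $ Inl l)\<^sup>2) = (\<Sum>l\<in>UNIV - {i0}. (v $ Inl l)\<^sup>2)"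
    proof (rule sum.reindex_bij_witness[of _ "Transposition.transpose i i0" "Transposition.transpose i i0"])
      fix l assume "l \<in> UNIV - {i}"
      then show "(v $ Inl (Transposition.transpose i i0 l))\<^sup>2 = (\<xi> c v $ Inl l)\<^sup>2"
        by (auto simp: \<xi>_def c \<pi>_def Transposition.transpose_def)
    qed (auto simp: Transposition.transpose_def split: if_splits)
    also have "\<rho> v + (\<Sum>l\<in>UNIV - {i0}. (v $ Inl l)\<^sup>2) = (\<Sum>k\<in>UNIV. (\<xi> c v $ Inr k)\<^sup>2)"
      by (simp add: \<rho>_def \<xi>_def c \<pi>)
    finally have "quadric_form (\<xi> c v) = 0" by (simp add: quadric_form_eq)
    moreover have "\<xi> c v $ Inl i \<noteq> 0"
      using that by (simp add: \<xi>_def c \<pi>(1) sg)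
    ultimately show ?thesis by auto
  qed
  define V where "V = (\<Union>c. W c)"
  have V_open: "open V" unfolding V_def using W_open by blast
  have sm: "smooth_map_on V g"
    unfolding smooth_map_on_def
  proof
    fix v assume "v \<in> V"
    then obtain c where c: "v \<in> W c" by (auto simp: V_def)
    show "\<exists>U h. open U \<and> v \<in> U \<and> smooth_on h U \<and> (\<forall>y\<in>V \<inter> U. g y = h y)"
    proof (intro exI[of _ "W c"] exI[of _ "G c"] conjI ballI)
      show "g y = G c y" if "y \<in> V \<inter> W c" for y
        using gG[of y c] that by blast
    qed (rule W_open c sG)+
  qed
  have imm: "immersion_on V g"
    unfolding immersion_on_def
  proof (intro conjI sm ballI)
    fix v assume v: "v \<in> V"
    then obtain c where c: "v \<in> W c" by (auto simp: V_def)
    from smooth_map_on_has_derivative[OF sm v] obtain D where D: "(g has_derivative D) (at v within V)"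
      by (elim exE)
    from smooth_on_has_derivative[OF s\<xi> c] obtain D\<xi> where D\<xi>: "(\<xi> c has_derivative D\<xi>) (at v)"
      by (elim exE)
    have D\<tau>: "((\<lambda>v. v $ Inl i0) has_derivative (\<lambda>v. v $ Inl i0)) (at v)"
      by (rule bounded_linear_imp_has_derivative[OF bounded_linear_vec_nth])
    \<comment> \<open>Apart from the square root entry, which is discarded, the chart only permutes
      coordinates, and the time is stored in a slot of its own. A linear map therefore recovers the
      argument.\<close>
    define \<Lambda> :: "(real ^ ('p + 'q)) \<times> real \<Rightarrow> real ^ ('p + 'q)" where
      "\<Lambda> p = (\<chi> j. if j = Inl i0 then snd p else fst p $ \<pi> (fst c) j)" for p
    have "linear \<Lambda>"
      by (rule linearI) (auto simp: \<Lambda>_def vec_eq_iff)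
    then have D\<Lambda>: "(\<Lambda> has_derivative \<Lambda>) (at (\<xi> c v, v $ Inl i0))"
      by (simp add: bounded_linear_imp_has_derivative linear_conv_bounded_linear)
    have "SL_at V D v"
    proof (rule family_SL_at[OF v D W_open c D\<xi> D\<tau> _ _ _ D\<Lambda>])
      show "g y = (\<chi> j. complex_of_real (\<xi> c y $ j) * w j (y $ Inl i0))" if "y \<in> V \<inter> W c" for y
        using gG[of y c] that by (simp add: G_def)
      show "(\<Sum>j\<in>UNIV. quadric_sign j * (\<xi> c y $ j)\<^sup>2) = 0" if "y \<in> V \<inter> W c" for y
        using quad[of y c] that by (simp add: W_def quadric_form_def)
      show "\<xi> c v \<noteq> 0" using quad[of v c] c by (simp add: W_def)
      show "\<Lambda> (\<xi> c y, y $ Inl i0) = y" if "y \<in> V \<inter> W c" for y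
        by (auto simp: \<Lambda>_def \<xi>_def vec_eq_iff \<pi>)
    qed
    then have ker: "D u = 0 \<Longrightarrow> u = 0" for u
      using SL_atD(1)[of V D v u] tangent_space_open[OF V_open v] by simp
    have "linear D" using D has_derivative_linear by blast
    then have "inj D" using ker linear_injective_0 by blast
    then show "\<exists>D. (g has_derivative D) (at v within V) \<and> inj_on D (tangent_space V v)"
      using D by (auto intro: inj_on_subset)
  qed
  have "g ` V = family 0 \<inter> (- {0})"
  proof (intro equalityI subsetI)
    fix z assume "z \<in> g ` V"
    then obtain v c where v: "v \<in> W c" "z = G c v" using gG by (auto simp: V_def)
    have q: "quadric_form (\<xi> c v) = 0" "\<xi> c v \<noteq> 0" using quad[of v c] v(1) by (auto simp: W_def)
    then obtain j where "\<xi> c v $ j \<noteq> 0" by (auto simp: vec_eq_iff)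
    then have "z $ j \<noteq> 0" using w_nz by (simp add: v(2) G_def)
    then have "z \<noteq> 0" by auto
    moreover have "z \<in> family 0" unfolding v(2) G_def family_def using q(1) by blast
    ultimately show "z \<in> family 0 \<inter> (- {0})" by simp
  next
    fix z assume "z \<in> family 0 \<inter> (- {0})"
    then have z: "z \<in> family 0" "z \<noteq> 0" by auto
    then obtain x t where x: "quadric_form x = 0" "z = (\<chi> j. complex_of_real (x $ j) * w j t)"
      by (auto simp: family_def)
    obtain i where "z $ Inl i \<noteq> 0" using family_zero_block(1)[OF z(1)] z(2) by blast
    then have xi: "x $ Inl i \<noteq> 0" by (auto simp: x(2))
    define c where "c = (i, x $ Inl i > 0)"
    \<comment> \<open>Removing \<open>n - 1\<close> rather than \<open>n\<close> periods puts
      \<open>s - 3 * T * real (num c)\<close> into [T, 2T). With \<open>n\<close> it could hit the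
      excluded end point 0.\<close>
    define n :: int where "n = \<lfloor>(t - 3 * T * real (num c)) / T\<rfloor>"
    define s where "s = t + T * of_int (1 - n)"
    have "of_int n \<le> (t - 3 * T * real (num c)) / T" "(t - 3 * T * real (num c)) / T < of_int n + 1"
      unfolding n_def by linarith+
    then have "T * of_int n \<le> t - 3 * T * real (num c)" "t - 3 * T * real (num c) < T * of_int n + T"
      using T_pos by (simp_all add: field_simps)
    then have s: "s \<in> I (num c)"
      using T_pos by (simp add: s_def I_def algebra_simps)
    have ws: "w j s = w j t" for j
      unfolding s_def by (rule w_periodic_int)
    define v :: "real ^ ('p + 'q)" where "v = (\<chi> j. if j = Inl i0 then s else x $ \<pi> i j)"
    have "(\<Sum>l\<in>UNIV - {i0}. (v $ Inl l)\<^sup>2) = (\<Sum>l\<in>UNIV - {i}. (x $ Inl l)\<^sup>2)"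
    proof (rule sum.reindex_bij_witness[of _ "Transposition.transpose i i0" "Transposition.transpose i i0"])
      fix l assume "l \<in> UNIV - {i0}"
      then show "(x $ Inl (Transposition.transpose i i0 l))\<^sup>2 = (v $ Inl l)\<^sup>2"
        by (auto simp: v_def \<pi>_def Transposition.transpose_def)
    qed (auto simp: Transposition.transpose_def split: if_splits)
    moreover have "(\<Sum>l\<in>UNIV. (x $ Inl l)\<^sup>2) = (x $ Inl i)\<^sup>2 + (\<Sum>l\<in>UNIV - {i}. (x $ Inl l)\<^sup>2)"
      by (subst sum.remove[of UNIV i]) auto
    moreover have "(\<Sum>k\<in>UNIV. (v $ Inr k)\<^sup>2) = (\<Sum>k\<in>UNIV. (x $ Inr k)\<^sup>2)"
      by (simp add: v_def \<pi>)
    ultimately have \<rho>v: "\<rho> v = (x $ Inl i)\<^sup>2"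
      using x(1) by (simp add: \<rho>_def quadric_form_eq)
    then have vW: "v \<in> W c"
      using s xi by (simp add: W_def v_def)
    have "sg (snd c) * sqrt (\<rho> v) = x $ Inl i"
      unfolding \<rho>v using xi by (auto simp: sg_def c_def)
    then have "\<xi> c v = x"
      by (auto simp: \<xi>_def vec_eq_iff \<pi> v_def c_def)
    then have "G c v = z"
      by (simp add: G_def x(2) v_def ws)
    then show "z \<in> g ` V"
      using gG[OF vW] vW by (auto simp: V_def intro!: image_eqI[of _ _ v])
  qed
  then show ?thesis
    unfolding immersed_near_def using V_open imm assms
    by (intro exI[of _ "- {0}"] exI[of _ V] exI[of _ g]) auto
qed

end

section \<open>Normal form of the energy level curves\<close>

lemma isCont_cong_eventually:
  assumes "isCont f x" "\<forall>\<^sub>F y in nhds x. f y = g y"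
  shows "isCont g x"
  using isCont_cong[OF assms(2)] assms(1) by blast

lemma has_antiderivative:
  fixes f :: "real \<Rightarrow> real"
  assumes "continuous_on UNIV f"
  shows "\<exists>F. (\<forall>x. (F has_real_derivative f x) (at x)) \<and> F 0 = 0"
proof -
  have "\<exists>F. \<forall>x::real. (-\<infinity>::ereal) < x \<longrightarrow> x < (\<infinity>::ereal) \<longrightarrow> (F has_vector_derivative f x) (at x)"
    by (rule einterval_antiderivative) (use assms in \<open>auto simp: continuous_on_eq_continuous_at\<close>)
  then obtain F where F: "\<And>x. (F has_real_derivative f x) (at x)"
    by (auto simp: has_real_derivative_iff_has_vector_derivative)
  have "((\<lambda>x. F x - F 0) has_real_derivative f x) (at x)" for x
    using DERIV_diff[OF F DERIV_const] by simp
  then show ?thesis by (intro exI[of _ "\<lambda>x. F x - F 0"]) simp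
qed

lemma antiderivative_le:
  fixes F G :: "real \<Rightarrow> real"
  assumes "x \<le> y" "\<And>z. (F has_real_derivative f z) (at z)" "\<And>z. (G has_real_derivative g z) (at z)"
    and "\<And>z. x \<le> z \<Longrightarrow> z \<le> y \<Longrightarrow> f z \<le> g z"
  shows "F y - F x \<le> G y - G x"
proof -
  have "(\<lambda>z. G z - F z) x \<le> (\<lambda>z. G z - F z) y"
  proof (rule DERIV_nonneg_imp_nondecreasing[OF assms(1)])
    fix z assume "x \<le> z" "z \<le> y"
    then show "\<exists>d. ((\<lambda>z. G z - F z) has_real_derivative d) (at z) \<and> 0 \<le> d"
      using assms(2-4) by (intro exI[of _ "g z - f z"]) (auto intro!: DERIV_diff)
  qed
  then show ?thesis by simp
qed

lemma antiderivative_periodic: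
  fixes F :: "real \<Rightarrow> real"
  assumes F: "\<And>x. (F has_real_derivative f x) (at x)" and f: "\<And>x. f (x + p) = f x"
  shows "F (x + p) = F x + (F p - F 0)"
proof -
  have "((\<lambda>x. F (x + p) - F x) has_real_derivative 0) (at x)" for x
  proof -
    have "((\<lambda>x. F (x + p)) has_real_derivative f x) (at x)"
      using F[of "x + p"] f[of x] by (simp add: DERIV_shift)
    from DERIV_diff[OF this F] show ?thesis by simp
  qed
  then have "F (x + p) - F x = F (0 + p) - F 0"
    by (intro DERIV_isconst_all[rule_format, of "\<lambda>x. F (x + p) - F x"]) auto
  then show ?thesis by simp
qed

text \<open>Separation of variables: an antiderivative \<open>F\<close> of \<open>W\<close> is time
  as a function of position, and \<Phi> is its inverse. \<open>F\<close> grows by the same amount T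
  over each period \<open>p\<close>, hence is onto, so that \<Phi> exists for all time.\<close>

lemma periodic_reparametrisation:
  fixes W :: "real \<Rightarrow> real"
  assumes cont: "continuous_on UNIV W" and pos: "\<And>x. W x > 0" and per: "\<And>x. W (x + p) = W x" and p: "p > 0"
  shows "\<exists>\<Phi> T. T > 0 \<and> (\<forall>t. (\<Phi> has_real_derivative 1 / W (\<Phi> t)) (at t)) \<and>
    (\<forall>t. \<Phi> (t + T) = \<Phi> t + p) \<and> surj \<Phi>"
proof -
  obtain F where "\<forall>x. (F has_real_derivative W x) (at x)" "F 0 = 0"
    using has_antiderivative[OF cont] by (elim exE conjE)
  then have F: "\<And>x. (F has_real_derivative W x) (at x)" "F 0 = 0" by simp_all
  have contF: "isCont F x" for x
    using F(1) DERIV_isCont by blast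
  have mono: "F x < F y" if "x < y" for x y
  proof (rule DERIV_pos_imp_increasing[OF that])
    fix z
    show "\<exists>d. (F has_real_derivative d) (at z) \<and> 0 < d"
      using F(1)[of z] pos[of z] by blast
  qed
  then have inj: "inj F"
    by (metis injI linorder_neqE_linordered_idom order_less_irrefl)
  define T where "T = F p"
  have T: "T > 0" using mono[OF p] F(2) by (simp add: T_def)
  have shift: "F (x + p) = F x + T" for x
    using antiderivative_periodic[OF F(1) per] F(2) by (simp add: T_def)
  have nat: "F (real n * p) = real n * T" for n
  proof (induction n)
    case (Suc n)
    then show ?case using shift[of "real n * p"] by (simp add: algebra_simps)
  qed (simp add: F(2))
  have nat': "F (- (real n * p)) = - (real n * T)" for n
  proof (induction n)
    case (Suc n)
    then show ?case using shift[of "- (real (Suc n) * p)"] by (simp add: algebra_simps)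
  qed (simp add: F(2))
  have surj: "\<exists>x. F x = y" for y
  proof -
    obtain n where n: "\<bar>y\<bar> < real n * T"
      using reals_Archimedean3[OF T] by blast
    have "\<exists>x\<ge>- (real n * p). x \<le> real n * p \<and> F x = y"
      by (rule IVT) (use n nat nat' p contF in auto)
    then show ?thesis by blast
  qed
  define \<Phi> where "\<Phi> = inv F"
  have F\<Phi>: "F (\<Phi> y) = y" for y
    using surj unfolding \<Phi>_def by (metis f_inv_into_f rangeI)
  have \<Phi>F: "\<Phi> (F x) = x" for x
    using inj by (simp add: \<Phi>_def)
  have cont\<Phi>: "isCont \<Phi> y" for y
    using isCont_inverse_function2[of "\<Phi> y - 1" "\<Phi> y" "\<Phi> y + 1" \<Phi> F] \<Phi>F contF F\<Phi> by simp
  have "(\<Phi> has_real_derivative 1 / W (\<Phi> t)) (at t)" for t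
    unfolding divide_inverse mult_1
    using pos[of "\<Phi> t"]
    by (intro DERIV_inverse_function[where f = F and a = "t - 1" and b = "t + 1"] F(1) F\<Phi> cont\<Phi>) auto
  moreover have "\<Phi> (t + T) = \<Phi> t + p" for t
    using shift[of "\<Phi> t"] \<Phi>F[of "\<Phi> t + p"] F\<Phi>[of t] by simp
  moreover have "surj \<Phi>" using \<Phi>F by (metis surjI)
  ultimately show ?thesis using T by blast
qed

text \<open>
  \<open>L u = ln (Q(0)/Q(u))\<close> is \<open>u\<^sup>2 gq u\<close> with \<open>gq\<close> positive and continuous also at \<open>0\<close>, so that
  \<open>h = hf u = u sqrt (gq u)\<close> is a differentiable coordinate through the equilibrium \<open>u = 0\<close>; \<open>U\<close> is
  its inverse and \<open>V\<close> the derivative of \<open>U\<close>. In the same way \<open>cos \<theta> = Cf k\<close> and \<open>k / cos \<theta> = Sf k\<close>.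
\<close>

locale two_blocks =
  fixes a b :: nat
  assumes a: "a > 0" and b: "b > 0"
begin

abbreviation (input) "ra \<equiv> real a"
abbreviation (input) "rb \<equiv> real b"
abbreviation (input) "rm \<equiv> real a + real b"

definition L :: "real \<Rightarrow> real" where
  "L u = ra * ln ra + rb * ln rb - ra * ln (ra + u) - rb * ln (rb - u)"

definition dom :: "real set" where "dom = {- ra<..<rb}"

lemma dom: "u \<in> dom \<longleftrightarrow> ra + u > 0 \<and> rb - u > 0"
  by (auto simp: dom_def)

lemma L_deriv: "u \<in> dom \<Longrightarrow> (L has_real_derivative rm * u / ((ra + u) * (rb - u))) (at u)"
proof -
  assume u: "u \<in> dom"
  have "(L has_real_derivative rb / (rb - u) - ra / (ra + u)) (at u)"
    unfolding L_def using u by (auto intro!: derivative_eq_intros simp: dom divide_inverse)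
  moreover have "rb / (rb - u) - ra / (ra + u) = (rb * (ra + u) - ra * (rb - u)) / ((rb - u) * (ra + u))"
    using u by (intro diff_frac_eq) (auto simp: dom)
  moreover have "rb * (ra + u) - ra * (rb - u) = rm * u" "(rb - u) * (ra + u) = (ra + u) * (rb - u)"
    by (simp_all add: algebra_simps)
  ultimately show ?thesis by simp
qed

text \<open>The bound ln x \<le> x - 1, strict away from 1, is applied at (a + u)/a and (b - u)/b.
  After weighting by a and b the linear terms are u and -u and cancel.\<close>

lemma L_pos: "u \<in> dom \<Longrightarrow> u \<noteq> 0 \<Longrightarrow> L u > 0"
proof -
  assume u: "u \<in> dom" "u \<noteq> 0"
  have strict: "ln x < x - 1" if "x > 0" "x \<noteq> 1" for x :: real
    using ln_le_minus_one[OF that(1)] ln_eq_minus_one[OF that(1)] that(2) by linarith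
  have "(ra + u) / ra > 0" "(rb - u) / rb > 0" "(ra + u) / ra \<noteq> 1"
    using u a b by (auto simp: dom field_simps)
  then have "ln ((ra + u) / ra) < (ra + u) / ra - 1" "ln ((rb - u) / rb) \<le> (rb - u) / rb - 1"
    using strict ln_le_minus_one by blast+
  then have "ra * ln ((ra + u) / ra) < u" "rb * ln ((rb - u) / rb) \<le> - u"
    using a b by (simp_all add: field_simps)
  moreover have ln: "ln ((ra + u) / ra) = ln (ra + u) - ln ra" "ln ((rb - u) / rb) = ln (rb - u) - ln rb"
    using u a b by (auto simp: dom ln_div)
  ultimately show ?thesis unfolding ln L_def right_diff_distrib by linarith
qed

text \<open>The value at 0 is half the second derivative of \<open>L\<close> there, which fills the
  removable singularity.\<close>

definition gq :: "real \<Rightarrow> real" where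
  "gq u = (if u = 0 then rm / (2 * ra * rb) else L u / u\<^sup>2)"

lemma gq_pos: "u \<in> dom \<Longrightarrow> gq u > 0"
  using L_pos a b by (auto simp: gq_def)

lemma L_eq: "L u = u\<^sup>2 * gq u"
  by (auto simp: gq_def L_def)

lemma zero_dom: "0 \<in> dom" using a b by (simp add: dom)

lemma open_dom: "open dom" by (simp add: dom_def)

lemma ev_dom: "u \<in> dom \<Longrightarrow> \<forall>\<^sub>F v in nhds u. v \<in> dom"
  using open_dom eventually_nhds by blast

lemma isCont_gq: "u \<in> dom \<Longrightarrow> isCont gq u"
proof (cases "u = 0")
  case True
  have "((\<lambda>u. L u / u\<^sup>2) \<longlongrightarrow> rm / (2 * ra * rb)) (at 0)"
  proof (rule lhopital)
    show "(L \<longlongrightarrow> 0) (at 0)"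
      using DERIV_isCont[OF L_deriv[OF zero_dom]] by (simp add: isCont_def L_def)
    show "((\<lambda>u::real. u\<^sup>2) \<longlongrightarrow> 0) (at 0)"
      by (auto intro!: tendsto_eq_intros)
    have ev: "\<forall>\<^sub>F u in at 0. u \<in> dom \<and> u \<noteq> 0"
      using ev_dom[OF zero_dom] by (auto simp: eventually_at_filter elim: eventually_mono)
    show "\<forall>\<^sub>F u::real in at 0. u\<^sup>2 \<noteq> 0" "\<forall>\<^sub>F u::real in at 0. 2 * u \<noteq> 0"
      by (auto simp: eventually_at_filter)
    show "\<forall>\<^sub>F u in at 0. (L has_real_derivative rm * u / ((ra + u) * (rb - u))) (at u)"
      using ev by (rule eventually_mono) (simp add: L_deriv)
    show "\<forall>\<^sub>F u::real in at 0. ((\<lambda>u. u\<^sup>2) has_real_derivative 2 * u) (at u)"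
      by (intro always_eventually allI) (auto intro!: derivative_eq_intros)
    have "((\<lambda>u. rm / (2 * ((ra + u) * (rb - u)))) \<longlongrightarrow> rm / (2 * ((ra + 0) * (rb - 0)))) (at 0)"
      using a b by (intro tendsto_intros) auto
    then have "((\<lambda>u. rm / (2 * ((ra + u) * (rb - u)))) \<longlongrightarrow> rm / (2 * ra * rb)) (at 0)"
      by (simp add: mult.assoc)
    moreover have cancel: "c / (2 * p) = c * u / p / (2 * u)" if "u \<noteq> 0" for c p u :: real
      using that by simp
    then have "\<forall>\<^sub>F u in at 0. rm / (2 * ((ra + u) * (rb - u))) = rm * u / ((ra + u) * (rb - u)) / (2 * u)"
      by (simp add: eventually_at_filter)
    ultimately show "((\<lambda>u. rm * u / ((ra + u) * (rb - u)) / (2 * u)) \<longlongrightarrow> rm / (2 * ra * rb)) (at 0)"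
      by (rule Lim_transform_eventually)
  qed
  moreover have "\<forall>\<^sub>F u in at 0. L u / u\<^sup>2 = gq u"
    by (auto simp: eventually_at_filter gq_def)
  ultimately have "(gq \<longlongrightarrow> rm / (2 * ra * rb)) (at 0)"
    by (rule Lim_transform_eventually)
  then show ?thesis using True by (simp add: isCont_def gq_def)
next
  case False
  assume u: "u \<in> dom"
  have "isCont (\<lambda>v. L v / v\<^sup>2) u"
    using DERIV_isCont[OF L_deriv[OF u]] False by (intro continuous_intros) auto
  moreover have "\<forall>\<^sub>F v in nhds u. L v / v\<^sup>2 = gq v"
    by (rule eventually_mono[OF t1_space_nhds[OF False]]) (simp add: gq_def)
  ultimately show ?thesis by (rule isCont_cong_eventually)
qed

definition hf :: "real \<Rightarrow> real" where "hf u = u * sqrt (gq u)"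

definition hf' :: "real \<Rightarrow> real" where "hf' u = rm / (2 * (ra + u) * (rb - u) * sqrt (gq u))"

lemma hf_sq: "u \<in> dom \<Longrightarrow> (hf u)\<^sup>2 = L u"
  using gq_pos[of u] by (simp add: hf_def power_mult_distrib L_eq)

text \<open>At 0 Caratheodory's criterion derives this from continuity of \<open>gq\<close> alone.
  Elsewhere \<open>hf\<close> is locally a constant sign times \<open>sqrt (L u)\<close>, to which
  the chain rule applies.\<close>

lemma hf_deriv: "u \<in> dom \<Longrightarrow> (hf has_real_derivative hf' u) (at u)"
proof (cases "u = 0")
  case True
  define r where "r = sqrt (gq 0)"
  have r: "r > 0" "r * r = rm / (2 * ra * rb)"
    using gq_pos[OF zero_dom] by (simp_all add: r_def) (simp add: gq_def)
  have "hf' 0 = rm / (2 * ra * rb) / r" by (simp add: hf'_def r_def)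
  also have "\<dots> = r" unfolding r(2)[symmetric] using r(1) by simp
  finally have "hf' 0 = sqrt (gq 0)" by (simp add: r_def)
  then show ?thesis
    unfolding CARAT_DERIV True
    using isCont_gq[OF zero_dom]
    by (intro exI[of _ "\<lambda>u. sqrt (gq u)"]) (auto simp: hf_def intro!: continuous_intros)
next
  case False
  assume u: "u \<in> dom"
  define s where "s = sgn u"
  have "((\<lambda>v. s * sqrt (L v)) has_real_derivative s * (rm * u / ((ra + u) * (rb - u)) / (2 * sqrt (L u)))) (at u)"
    using L_pos[OF u False] by (auto intro!: derivative_eq_intros L_deriv[OF u] simp: field_simps)
  moreover have "sqrt (L u) = \<bar>u\<bar> * sqrt (gq u)"
    by (simp add: L_eq real_sqrt_mult)
  have su: "s * u = \<bar>u\<bar>" by (simp add: s_def sgn_if)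
  have cancel: "s * (c * u / p / (2 * (\<bar>u\<bar> * g))) = c / (2 * p * g)" for c p g :: real
  proof -
    have "s * (c * u / p / (2 * (\<bar>u\<bar> * g))) = c * (s * u) / (p * (2 * (\<bar>u\<bar> * g)))" by simp
    also have "\<dots> = c / (2 * p * g)" unfolding su using False by simp
    finally show ?thesis .
  qed
  have "s * (rm * u / ((ra + u) * (rb - u)) / (2 * sqrt (L u))) = hf' u"
    unfolding \<open>sqrt (L u) = \<bar>u\<bar> * sqrt (gq u)\<close> cancel hf'_def by (simp only: mult.assoc)
  ultimately have d: "((\<lambda>v. s * sqrt (L v)) has_real_derivative hf' u) (at u)" by simp
  have ev: "\<forall>\<^sub>F v in nhds u. s * sqrt (L v) = hf v"
  proof -
    have "\<forall>\<^sub>F v in nhds u. v \<in> {v. 0 < v * u}"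
      by (intro eventually_nhds_in_open open_Collect_less continuous_intros)
        (use False in \<open>auto simp: zero_less_mult_iff linorder_neq_iff\<close>)
    then show ?thesis
    proof (rule eventually_mono)
      fix v assume "v \<in> {v. 0 < v * u}"
      then have "s * \<bar>v\<bar> = v" by (auto simp: s_def sgn_if zero_less_mult_iff split: if_splits)
      then show "s * sqrt (L v) = hf v"
        unfolding hf_def L_eq real_sqrt_mult by (simp add: mult.assoc[symmetric])
    qed
  qed
  from DERIV_cong_ev[THEN iffD1, OF refl ev refl d] show ?thesis .
qed

lemma hf'_pos: "u \<in> dom \<Longrightarrow> hf' u > 0"
  using gq_pos[of u] a by (simp add: hf'_def dom)

lemma isCont_hf: "u \<in> dom \<Longrightarrow> isCont hf u"
  using hf_deriv DERIV_isCont by blast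

lemma hf_mono: "u \<in> dom \<Longrightarrow> v \<in> dom \<Longrightarrow> u < v \<Longrightarrow> hf u < hf v"
proof -
  assume uv: "u \<in> dom" "v \<in> dom" "u < v"
  have "z \<in> dom" if "u \<le> z" "z \<le> v" for z
    using that uv by (auto simp: dom)
  then show "hf u < hf v"
    using hf_deriv hf'_pos by (intro DERIV_pos_imp_increasing[OF uv(3)]) blast
qed

lemma hf_surj: "\<exists>u\<in>dom. hf u = y"
proof -
  have up: "\<exists>u\<in>dom. u > 0 \<and> L u \<ge> K" for K
  proof -
    \<comment> \<open>Chosen so that the term \<open>rb * s\<close>, from the logarithm tending to
      minus infinity at the end point, outweighs \<open>K\<close> together with the largest value of
      the other logarithm. The maximum with 1 makes \<open>u\<close> positive.\<close>
    define s where "s = max 1 ((K + ra * (ln rm - ln ra)) / rb)"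
    define u where "u = rb - rb * exp (- s)"
    have "rb * exp (- s) < rb * 1" using b by (intro mult_strict_left_mono) (simp_all add: s_def)
    moreover have "0 < rb * exp (- s)" using b by simp
    moreover have "0 < ra" "0 < rb" using a b by simp_all
    ultimately have "ra + u > 0" "rb - u > 0" "u > 0"
      unfolding u_def by linarith+
    then have u: "u \<in> dom" "u > 0" by (simp_all add: dom)
    have lnu: "ln (rb - u) = ln rb - s" using b by (simp add: u_def ln_mult)
    have "ln (ra + u) \<le> ln rm" using u by (auto simp: dom)
    then have "ra * ln (ra + u) \<le> ra * ln rm" by (simp add: mult_left_mono)
    moreover have "K + ra * (ln rm - ln ra) \<le> rb * s"
    proof -
      have "(K + ra * (ln rm - ln ra)) / rb \<le> s" by (simp add: s_def)
      then show ?thesis using b by (simp add: field_simps)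
    qed
    ultimately have "L u \<ge> K" unfolding L_def lnu right_diff_distrib by linarith
    then show ?thesis using u by blast
  qed
  have down: "\<exists>u\<in>dom. u < 0 \<and> L u \<ge> K" for K
  proof -
    define s where "s = max 1 ((K + rb * (ln rm - ln rb)) / ra)"
    define u where "u = ra * exp (- s) - ra"
    have "ra * exp (- s) < ra * 1" using a by (intro mult_strict_left_mono) (simp_all add: s_def)
    moreover have "0 < ra * exp (- s)" using a by simp
    moreover have "0 < ra" "0 < rb" using a b by simp_all
    ultimately have "ra + u > 0" "rb - u > 0" "u < 0"
      unfolding u_def by linarith+
    then have u: "u \<in> dom" "u < 0" by (simp_all add: dom)
    have lnu: "ln (ra + u) = ln ra - s" using a by (simp add: u_def ln_mult)
    have "ln (rb - u) \<le> ln rm" using u by (auto simp: dom)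
    then have "rb * ln (rb - u) \<le> rb * ln rm" by (simp add: mult_left_mono)
    moreover have "K + rb * (ln rm - ln rb) \<le> ra * s"
    proof -
      have "(K + rb * (ln rm - ln rb)) / ra \<le> s" by (simp add: s_def)
      then show ?thesis using a by (simp add: field_simps)
    qed
    ultimately have "L u \<ge> K" unfolding L_def lnu right_diff_distrib by linarith
    then show ?thesis using u by blast
  qed
  obtain u where u: "u \<in> dom" "u > 0" "L u \<ge> y\<^sup>2" using up by blast
  obtain v where v: "v \<in> dom" "v < 0" "L v \<ge> y\<^sup>2" using down by blast
  have "hf u > 0" "hf v < 0"
    using u v gq_pos by (auto simp: hf_def mult_less_0_iff)
  moreover have "\<bar>y\<bar> \<le> \<bar>hf u\<bar>" "\<bar>y\<bar> \<le> \<bar>hf v\<bar>"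
    using u v hf_sq by (simp_all add: abs_le_square_iff)
  ultimately have "hf v \<le> y" "y \<le> hf u" by linarith+
  moreover have in_dom: "z \<in> dom" if "v \<le> z" "z \<le> u" for z
    using that u v by (auto simp: dom)
  ultimately have "\<exists>x\<ge>v. x \<le> u \<and> hf x = y"
    using u(2) v(2) isCont_hf by (intro IVT) auto
  then show ?thesis using in_dom by blast
qed

definition U :: "real \<Rightarrow> real" where "U = inv_into dom hf"

lemma inj_on_hf: "inj_on hf dom"
proof (rule inj_onI, rule ccontr)
  fix u v assume "u \<in> dom" "v \<in> dom" "hf u = hf v" "u \<noteq> v"
  then show False
    using hf_mono[of u v] hf_mono[of v u] by (cases "u < v") auto
qed

lemma U_dom: "U y \<in> dom" and hf_U: "hf (U y) = y"
proof -
  have "y \<in> hf ` dom" using hf_surj[of y] by blast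
  then show "U y \<in> dom" "hf (U y) = y"
    unfolding U_def by (rule inv_into_into, rule f_inv_into_f)
qed

lemma U_hf: "u \<in> dom \<Longrightarrow> U (hf u) = u"
  unfolding U_def using inj_on_hf by (rule inv_into_f_f)

lemma U_bounds: "ra + U y > 0" "rb - U y > 0"
  using U_dom[of y] by (auto simp: dom)

lemma U_strict_mono: "x < y \<Longrightarrow> U x < U y"
  using hf_mono[OF U_dom U_dom, of y x] hf_U[of x] hf_U[of y]
  by (cases "U x = U y") (auto simp: not_less[symmetric] elim: linorder_neqE)

lemma isCont_U: "isCont U y"
proof -
  obtain d where d: "d > 0" "cball (U y) d \<subseteq> dom"
    using open_contains_cball open_dom U_dom by blast
  have near: "z \<in> dom" if "U y - d \<le> z" "z \<le> U y + d" for z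
    using d(2) that by (auto simp: subset_iff dist_real_def)
  have "isCont U (hf (U y))"
  proof (rule isCont_inverse_function2[of "U y - d" "U y" "U y + d"])
    show "U (hf z) = z" "isCont hf z" if "U y - d \<le> z" "z \<le> U y + d" for z
      using near[OF that] by (rule U_hf, rule isCont_hf)
  qed (use d(1) in auto)
  then show ?thesis by (simp add: hf_U)
qed

definition V :: "real \<Rightarrow> real" where "V y = 2 * (ra + U y) * (rb - U y) * sqrt (gq (U y)) / rm"

lemma V_pos: "V y > 0"
  using U_bounds[of y] gq_pos[OF U_dom[of y]] a by (simp add: V_def)

lemma U_deriv: "(U has_real_derivative V y) (at y)"
proof -
  have "(U has_real_derivative inverse (hf' (U y))) (at y)"
    using hf'_pos[OF U_dom[of y]]
    by (intro DERIV_inverse_function[where f = hf and a = "y - 1" and b = "y + 1"] hf_deriv U_dom isCont_U)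
      (auto simp: hf_U)
  moreover have "inverse (hf' (U y)) = V y"
    by (simp add: hf'_def V_def)
  ultimately show ?thesis by simp
qed

lemma isCont_V: "isCont V y"
proof -
  have "isCont (\<lambda>y. gq (U y)) y"
    by (rule isCont_o2[OF isCont_U isCont_gq[OF U_dom]])
  then show ?thesis
    unfolding V_def using isCont_U a by (intro continuous_intros) auto
qed

text \<open>The identity \<open>L (U y) = y\<^sup>2\<close> differentiated, with denominators
  cleared.\<close>

lemma V_U: "V y * (rm * U y) = 2 * y * (ra + U y) * (rb - U y)"
proof -
  have "U y * sqrt (gq (U y)) = y"
    using hf_U[of y] by (simp add: hf_def)
  moreover have "V y * rm = 2 * (ra + U y) * (rb - U y) * sqrt (gq (U y))"
    using a by (simp add: V_def)
  then have "V y * (rm * U y) = 2 * (U y * sqrt (gq (U y))) * (ra + U y) * (rb - U y)"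
    by (simp only: mult.assoc[symmetric]) (simp only: mult_ac)
  ultimately show ?thesis by simp
qed

lemma U_0: "U 0 = 0"
  using U_hf[OF zero_dom] by (simp add: hf_def)

text \<open>The limiting rotation angle at the equilibrium is governed by this number, through
  \<open>ra * J 0 = pi * V 0\<close>; the argument needs it to exceed 1.\<close>

lemma V_0: "(V 0)\<^sup>2 = 2 * ra * rb / rm"
proof -
  have "gq 0 > 0" by (rule gq_pos[OF zero_dom])
  then have "(V 0)\<^sup>2 = (2 * ra * rb / rm)\<^sup>2 * gq 0"
    by (simp add: V_def U_0 power_mult_distrib power_divide)
  also have "gq 0 = 1 / (2 * ra * rb / rm)" by (simp add: gq_def)
  also have "x\<^sup>2 * (1 / x) = x" for x :: real by (simp add: power2_eq_square)
  finally show ?thesis .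
qed

text \<open>The value of Q^(1/2) at the equilibrium, which is the upper bound for A in a
  datum.\<close>

definition qc :: real where "qc = sqrt (ra ^ a * rb ^ b)"

lemma qc_pos: "qc > 0" using a b by (simp add: qc_def)

lemma Q_U: "(ra + U y) ^ a * (rb - U y) ^ b = qc\<^sup>2 * exp (- y\<^sup>2)"
proof -
  have "y\<^sup>2 = L (U y)" using hf_sq[OF U_dom[of y]] hf_U[of y] by simp
  then have "exp (- y\<^sup>2) = exp (ra * ln (ra + U y)) * exp (rb * ln (rb - U y)) / (exp (ra * ln ra) * exp (rb * ln rb))"
    unfolding exp_add[symmetric] exp_diff[symmetric] by (simp add: L_def)
  moreover have "exp (real n * ln x) = x ^ n" if "x > 0" for x n
    using that by (simp add: exp_of_nat_mult)
  ultimately show ?thesis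
    using U_bounds[of y] a b by (simp add: qc_def)
qed

end

text \<open>Since \<open>1 - exp (- k\<^sup>2) = k\<^sup>2 * sf (k\<^sup>2)\<close>, this plays for
  the square of cos \<theta> the role of \<open>gq\<close> for \<open>L\<close>: the signed root
  \<open>Cf\<close> stays differentiable where cos \<theta> changes sign.\<close>

definition sf :: "real \<Rightarrow> real" where "sf x = (if x = 0 then 1 else (1 - exp (- x)) / x)"

lemma sf_pos: "sf x > 0"
proof (cases "x > 0")
  case True
  then show ?thesis by (simp add: sf_def)
next
  case False
  then show ?thesis by (cases "x = 0") (auto simp: sf_def divide_neg_neg)
qed

lemma isCont_sf: "isCont sf x"
proof (cases "x = 0")
  case True
  have "((\<lambda>x::real. 1 - exp (- x)) has_real_derivative 1) (at 0)"
    by (auto intro!: derivative_eq_intros)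
  then have "((\<lambda>x::real. (1 - exp (- x)) / x) \<longlongrightarrow> 1) (at 0)"
    by (simp add: DERIV_def)
  moreover have "\<forall>\<^sub>F x in at 0. (1 - exp (- x)) / x = sf x"
    by (auto simp: eventually_at_filter sf_def)
  ultimately have "(sf \<longlongrightarrow> 1) (at 0)" by (rule Lim_transform_eventually)
  then show ?thesis using True by (simp add: isCont_def sf_def)
next
  case False
  then have "isCont (\<lambda>x. (1 - exp (- x)) / x) x" by (intro continuous_intros) auto
  moreover have "\<forall>\<^sub>F v in nhds x. (1 - exp (- v)) / v = sf v"
    by (rule eventually_mono[OF t1_space_nhds[OF False]]) (simp add: sf_def)
  ultimately show ?thesis by (rule isCont_cong_eventually)
qed

definition Cf :: "real \<Rightarrow> real" where "Cf k = k * sqrt (sf (k\<^sup>2))"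
definition Sf :: "real \<Rightarrow> real" where "Sf k = 1 / sqrt (sf (k\<^sup>2))"

lemma Sf_pos: "Sf k > 0" by (simp add: Sf_def sf_pos)

lemma Cf_Sf: "Cf k * Sf k = k"
  using sf_pos[of "k\<^sup>2"] by (simp add: Cf_def Sf_def)

lemma isCont_sf_sq: "isCont (\<lambda>k. sf (k\<^sup>2)) k"
  by (rule isCont_o2[OF _ isCont_sf]) (intro continuous_intros)

lemma isCont_Sf: "isCont Sf k"
  unfolding Sf_def using isCont_sf_sq sf_pos[of "k\<^sup>2"] by (intro continuous_intros) auto

lemma Cf_sq: "(Cf k)\<^sup>2 = 1 - exp (- k\<^sup>2)"
  using sf_pos[of "k\<^sup>2"] by (simp add: Cf_def power_mult_distrib) (simp add: sf_def)

lemma Cf_deriv: "(Cf has_real_derivative Sf k * exp (- k\<^sup>2)) (at k)"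
proof (cases "k = 0")
  case True
  then show ?thesis
    unfolding CARAT_DERIV True using isCont_sf_sq[of 0]
    by (intro exI[of _ "\<lambda>k. sqrt (sf (k\<^sup>2))"]) (auto simp: Cf_def Sf_def sf_def intro!: continuous_intros)
next
  case False
  define s where "s = sgn k"
  have pos: "1 - exp (- k\<^sup>2) > 0" using False by simp
  have abs: "\<bar>Cf v\<bar> = sqrt (1 - exp (- v\<^sup>2))" for v
    using Cf_sq[of v] real_sqrt_abs by metis
  have "((\<lambda>v. s * sqrt (1 - exp (- v\<^sup>2))) has_real_derivative s * (2 * k * exp (- k\<^sup>2) / (2 * sqrt (1 - exp (- k\<^sup>2))))) (at k)"
    using pos by (auto intro!: derivative_eq_intros simp: field_simps)
  also have "s * (2 * k * exp (- k\<^sup>2) / (2 * sqrt (1 - exp (- k\<^sup>2)))) = Sf k * exp (- k\<^sup>2)"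
    unfolding abs[symmetric] using False sf_pos[of "k\<^sup>2"]
    by (auto simp: Cf_def Sf_def s_def abs_mult sgn_if)
  finally have d: "((\<lambda>v. s * sqrt (1 - exp (- v\<^sup>2))) has_real_derivative Sf k * exp (- k\<^sup>2)) (at k)" .
  have ev: "\<forall>\<^sub>F v in nhds k. s * sqrt (1 - exp (- v\<^sup>2)) = Cf v"
  proof -
    have "\<forall>\<^sub>F v in nhds k. v \<in> {v. 0 < v * k}"
      by (intro eventually_nhds_in_open open_Collect_less continuous_intros)
        (use False in \<open>auto simp: zero_less_mult_iff linorder_neq_iff\<close>)
    then show ?thesis
    proof (rule eventually_mono)
      fix v assume "v \<in> {v. 0 < v * k}"
      then have "s * \<bar>v\<bar> = v" by (auto simp: s_def sgn_if zero_less_mult_iff split: if_splits)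
      then show "s * sqrt (1 - exp (- v\<^sup>2)) = Cf v"
        unfolding abs[symmetric] using sf_pos[of "v\<^sup>2"] by (simp add: Cf_def abs_mult mult.assoc[symmetric])
    qed
  qed
  from DERIV_cong_ev[THEN iffD1, OF refl ev refl d] show ?thesis .
qed

text \<open>The branch of arccos is the right one because sin \<theta> is positive along an orbit,
  which confines \<theta> to (0, \<pi>). That confinement is the source of the bound by \<pi> for
  large E.\<close>

definition Th :: "real \<Rightarrow> real" where "Th k = arccos (Cf k)"

lemma Cf_bounds: "-1 < Cf k" "Cf k < 1"
proof -
  have "(Cf k)\<^sup>2 < 1" by (simp add: Cf_sq)
  then show "-1 < Cf k" "Cf k < 1" by (simp_all add: power2_less_1_iff abs_less_iff)
qed

lemma cos_Th: "cos (Th k) = Cf k"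
  using Cf_bounds[of k] by (simp add: Th_def)

lemma sqrt_exp: "sqrt (exp (x::real)) = exp (x / 2)"
  by (metis exp_half_le2 exp_ge_zero exp_total real_sqrt_unique power2_eq_square mult_exp_exp field_sum_of_halves)

lemma sin_Th: "sin (Th k) = exp (- k\<^sup>2 / 2)"
  using Cf_bounds[of k] by (simp add: Th_def sin_arccos Cf_sq sqrt_exp)

lemma Th_bounds: "0 < Th k" "Th k < pi"
  using arccos_lt_bounded[OF Cf_bounds[of k]] by (simp_all add: Th_def)

lemma Th_deriv: "(Th has_real_derivative - (Sf k * exp (- k\<^sup>2 / 2))) (at k)"
proof -
  have "(Th has_real_derivative inverse (- sqrt (1 - (Cf k)\<^sup>2)) * (Sf k * exp (- k\<^sup>2))) (at k)"
    unfolding Th_def by (rule DERIV_chain2[OF DERIV_arccos[OF Cf_bounds] Cf_deriv])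
  moreover have "sqrt (1 - (Cf k)\<^sup>2) = exp (- k\<^sup>2 / 2)"
    by (simp add: Cf_sq sqrt_exp)
  moreover have "exp (- k\<^sup>2) = exp (- k\<^sup>2 / 2) * exp (- k\<^sup>2 / 2)"
    by (simp add: mult_exp_exp)
  moreover have "inverse (- e) * (c * (e * e)) = - (c * e)" if "e > 0" for c e :: real
    using that by (simp add: field_simps)
  ultimately show ?thesis by (metis exp_gt_zero)
qed

section \<open>Orbits and their rotation angles\<close>

context two_blocks
begin

definition Amp :: "real \<Rightarrow> real" where "Amp E = qc * exp (- E\<^sup>2 / 2)"

text \<open>The derivative of time with respect to the angle \<phi> on the circle h = E sin \<phi>,
  k = E cos \<phi>. As cos \<theta> is k divided by \<open>Sf k\<close>, the factor E cos \<phi>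
  from differentiating h cancels, so the expression stays positive at the turning points of u and at
  E = 0.\<close>

definition We :: "real \<Rightarrow> real \<Rightarrow> real" where
  "We E \<phi> = V (E * sin \<phi>) * Sf (E * cos \<phi>) * exp ((E * sin \<phi>)\<^sup>2 / 2) / (2 * qc)"

text \<open>A times \<open>We\<close>, with the exponential growing in E sin \<phi> cancelled
  against the one in A.\<close>

definition core :: "real \<Rightarrow> real \<Rightarrow> real" where
  "core E \<phi> = exp (- (E * cos \<phi>)\<^sup>2 / 2) * V (E * sin \<phi>) * Sf (E * cos \<phi>) / 2"

text \<open>\<open>pe\<close> and \<open>ne\<close> are the rotation speeds with respect to \<phi>,
  backwards for the first block and forwards for the second; both are positive.\<close>

definition pe :: "real \<Rightarrow> real \<Rightarrow> real" where "pe E \<phi> = core E \<phi> / (ra + U (E * sin \<phi>))"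
definition ne :: "real \<Rightarrow> real \<Rightarrow> real" where "ne E \<phi> = core E \<phi> / (rb - U (E * sin \<phi>))"

text \<open>The amount by which each angle of the first block decreases over one period of
  u.\<close>

definition J :: "real \<Rightarrow> real" where "J E = integral {0..2 * pi} (pe E)"

lemma Amp_pos: "Amp E > 0" using qc_pos by (simp add: Amp_def)
lemma We_pos: "We E \<phi> > 0" using V_pos Sf_pos qc_pos by (simp add: We_def)
lemma core_pos: "core E \<phi> > 0" using V_pos Sf_pos by (simp add: core_def)

lemma sq_split: "(E * sin \<phi>)\<^sup>2 + (E * cos \<phi>)\<^sup>2 = E\<^sup>2" for E \<phi> :: real
  by (simp add: power_mult_distrib distrib_left[symmetric])

lemma Amp_split: "Amp E = qc * exp (- (E * sin \<phi>)\<^sup>2 / 2) * exp (- (E * cos \<phi>)\<^sup>2 / 2)"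
  unfolding Amp_def sq_split[of E \<phi>, symmetric] by (simp add: mult.assoc mult_exp_exp add_divide_distrib)

lemma Amp_We: "Amp E * We E \<phi> = core E \<phi>"
proof -
  have "exp (- x / 2) * exp (x / 2) = 1" for x :: real by (simp add: mult_exp_exp)
  then have *: "q * exp (- x / 2) * e * (v * s * exp (x / 2) / (2 * q)) = e * v * s / 2" if "q > 0" for q x e v s :: real
    using that by (simp add: field_simps)
  show ?thesis
    unfolding Amp_split[of E \<phi>] We_def core_def by (rule *[OF qc_pos])
qed

lemma periodic: "We E (\<phi> + 2 * pi) = We E \<phi>" "pe E (\<phi> + 2 * pi) = pe E \<phi>" "ne E (\<phi> + 2 * pi) = ne E \<phi>"
  by (simp_all add: We_def pe_def ne_def core_def)

lemma cont_UVS: "continuous_on X U" "continuous_on X V" "continuous_on X Sf"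
  using isCont_U isCont_V isCont_Sf by (auto intro: continuous_at_imp_continuous_on)

lemma cont_core2: "continuous_on X (\<lambda>(E, \<phi>). core E \<phi>)"
  unfolding core_def split_def
  by (intro continuous_intros continuous_on_compose2[OF cont_UVS(2)[of UNIV]]
      continuous_on_compose2[OF cont_UVS(3)[of UNIV]]) auto

lemma cont_pe2: "continuous_on X (\<lambda>(E, \<phi>). pe E \<phi>)"
proof -
  have "continuous_on X (\<lambda>x. U (fst x * sin (snd x)))"
    by (rule continuous_on_compose2[OF cont_UVS(1)[of UNIV]]) (auto intro!: continuous_intros)
  moreover have "ra + U y \<noteq> 0" for y using U_bounds(1)[of y] by simp
  ultimately show ?thesis
    using cont_core2[of X] unfolding pe_def split_def
    by (intro continuous_on_divide continuous_on_add continuous_on_const) auto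
qed

lemma cont_core: "continuous_on X (core E)"
proof -
  have "continuous_on X (\<lambda>\<phi>. (\<lambda>(E, \<phi>). core E \<phi>) (E, \<phi>))"
    by (rule continuous_on_compose2[OF cont_core2[of UNIV]])
      (auto intro!: continuous_on_Pair continuous_on_const continuous_on_id)
  then show ?thesis by simp
qed

lemma cont_pe: "continuous_on X (pe E)"
proof -
  have "continuous_on X (\<lambda>\<phi>. (\<lambda>(E, \<phi>). pe E \<phi>) (E, \<phi>))"
    by (rule continuous_on_compose2[OF cont_pe2[of UNIV]])
      (auto intro!: continuous_on_Pair continuous_on_const continuous_on_id)
  then show ?thesis by simp
qed

lemma cont_ne: "continuous_on X (ne E)"
proof -
  have "continuous_on X (\<lambda>x. U (E * sin x))"
    by (rule continuous_on_compose2[OF cont_UVS(1)[of UNIV]]) (auto intro!: continuous_intros)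
  moreover have "rb - U y \<noteq> 0" for y using U_bounds(2)[of y] by simp
  ultimately show ?thesis
    using cont_core[of X E] unfolding ne_def
    by (intro continuous_on_divide continuous_on_diff continuous_on_const) auto
qed

lemma cont_We: "continuous_on X (We E)"
  unfolding We_def
  by (intro continuous_intros continuous_on_compose2[OF cont_UVS(2)[of UNIV]]
      continuous_on_compose2[OF cont_UVS(3)[of UNIV]]) (use qc_pos in auto)

lemma cont_J: "continuous_on X J"
  unfolding J_def using integral_continuous_on_param[of X 0 "2 * pi" pe] cont_pe2 by simp

lemma J_antiderivative:
  assumes "\<And>x. (F has_real_derivative pe E x) (at x)"
  shows "F (2 * pi) - F 0 = J E"
proof -
  have "(pe E has_integral (F (2 * pi) - F 0)) {0..2 * pi}"
    by (rule fundamental_theorem_of_calculus)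
      (auto intro: has_vector_derivative_at_within assms[unfolded has_real_derivative_iff_has_vector_derivative])
  then show ?thesis unfolding J_def by (simp add: integral_unique)
qed

lemma J_0: "ra * J 0 = pi * V 0"
proof -
  have Sf0: "Sf 0 = 1" by (simp add: Sf_def sf_def)
  have "pe 0 = (\<lambda>\<phi>. V 0 / (2 * ra))"
    by (simp add: pe_def core_def U_0 Sf0 fun_eq_iff)
  then have "J 0 = 2 * pi * (V 0 / (2 * ra))" by (simp add: J_def)
  then show ?thesis using a by simp
qed

text \<open>The derivative of \<theta> with respect to \<phi>, obtained from the rotation speeds on
  the left and from \<theta> = \<open>Th (E * cos \<phi>)\<close> on the right. The two agree
  through \<open>V_U\<close>.\<close>

lemma angle_difference:
  "rb * ne E \<phi> - ra * pe E \<phi> = Sf (E * cos \<phi>) * exp (- (E * cos \<phi>)\<^sup>2 / 2) * (E * sin \<phi>)"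
proof -
  let ?y = "E * sin \<phi>"
  define x where "x = ra + U ?y"
  define z where "z = rb - U ?y"
  have xz: "x > 0" "z > 0" using U_bounds[of ?y] by (simp_all add: x_def z_def)
  have "rb * ne E \<phi> - ra * pe E \<phi> = core E \<phi> * ((rb * x - ra * z) / (x * z))"
    using xz unfolding ne_def pe_def x_def[symmetric] z_def[symmetric] by (simp add: field_simps)
  also have "rb * x - ra * z = rm * U ?y"
    by (simp add: x_def z_def algebra_simps)
  also have "core E \<phi> * (rm * U ?y / (x * z))
      = exp (- (E * cos \<phi>)\<^sup>2 / 2) * Sf (E * cos \<phi>) / 2 * (V ?y * (rm * U ?y)) / (x * z)"
    by (simp add: core_def)
  also have "V ?y * (rm * U ?y) = 2 * ?y * x * z"
    unfolding V_U x_def z_def ..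
  finally show ?thesis using xz by simp
qed

lemma Th_antiderivative:
  "((\<lambda>\<phi>. Th (E * cos \<phi>)) has_real_derivative (rb * ne E \<phi> - ra * pe E \<phi>)) (at \<phi>)"
proof -
  have "((\<lambda>\<phi>. E * cos \<phi>) has_real_derivative - (E * sin \<phi>)) (at \<phi>)"
    by (auto intro!: derivative_eq_intros)
  from DERIV_chain2[OF Th_deriv this] show ?thesis
    unfolding angle_difference by simp
qed

text \<open>Integrates the conservation law. At \<open>2 * pi\<close> the left side returns to
  \<open>Th E\<close>, which forces rb N = ra P there, so that the single number \<open>J E\<close>
  determines the increments of both angles.\<close>

lemma Th_eq:
  assumes P: "\<And>x. (P has_real_derivative pe E x) (at x)" "P 0 = 0"
    and N: "\<And>x. (N has_real_derivative ne E x) (at x)" "N 0 = 0"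
  shows "Th (E * cos \<phi>) = Th E + rb * N \<phi> - ra * P \<phi>"
proof -
  have "((\<lambda>\<phi>. Th (E * cos \<phi>) - (rb * N \<phi> - ra * P \<phi>)) has_real_derivative 0) (at \<phi>)" for \<phi>
  proof -
    have "((\<lambda>\<phi>. rb * N \<phi> - ra * P \<phi>) has_real_derivative rb * ne E \<phi> - ra * pe E \<phi>) (at \<phi>)"
      by (intro DERIV_diff DERIV_cmult N(1) P(1))
    from DERIV_diff[OF Th_antiderivative[of E \<phi>] this] show ?thesis by simp
  qed
  then have "Th (E * cos \<phi>) - (rb * N \<phi> - ra * P \<phi>) = Th (E * cos 0) - (rb * N 0 - ra * P 0)"
    by (intro DERIV_isconst_all[rule_format, of "\<lambda>\<phi>. Th (E * cos \<phi>) - (rb * N \<phi> - ra * P \<phi>)"]) auto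
  then show ?thesis using P(2) N(2) by simp
qed

lemma sqrt_Q_U: "sqrt ((ra + U y) ^ a * (rb - U y) ^ b) = qc * exp (- y\<^sup>2 / 2)"
  using qc_pos by (simp add: Q_U real_sqrt_mult sqrt_exp)

text \<open>The attained bounds of \<open>u\<close> are recorded because they later distinguish the
  families.\<close>

lemma orbit_exists:
  assumes "E > 0"
  shows "\<exists>u f1 f2 T. T > 0 \<and> (\<forall>t. U (- E) \<le> u t \<and> u t \<le> U E) \<and> (\<exists>t. u t = U E) \<and> (\<exists>t. u t = U (- E)) \<and>
    (\<forall>t. sqrt ((ra + u t) ^ a * (rb - u t) ^ b) * sin (ra * f1 t + rb * f2 t) = Amp E) \<and>
    (\<forall>t. (u has_real_derivative 2 * sqrt ((ra + u t) ^ a * (rb - u t) ^ b) * cos (ra * f1 t + rb * f2 t)) (at t)) \<and>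
    (\<forall>t. (f1 has_real_derivative - Amp E / (ra + u t)) (at t)) \<and>
    (\<forall>t. (f2 has_real_derivative Amp E / (rb - u t)) (at t)) \<and>
    (\<forall>t. u (t + T) = u t) \<and> (\<forall>t. f1 (t + T) = f1 t - J E) \<and> (\<forall>t. f2 (t + T) = f2 t + ra * J E / rb)"
proof -
  have two_pi: "2 * pi > 0" by simp
  obtain \<Phi> T where T: "T > 0" and "\<forall>t. (\<Phi> has_real_derivative 1 / We E (\<Phi> t)) (at t)"
    "\<forall>t. \<Phi> (t + T) = \<Phi> t + 2 * pi" "surj \<Phi>"
    using periodic_reparametrisation[OF cont_We[of UNIV E] We_pos periodic(1) two_pi] by (elim exE conjE)
  then have \<Phi>: "\<And>t. (\<Phi> has_real_derivative 1 / We E (\<Phi> t)) (at t)"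
    "\<And>t. \<Phi> (t + T) = \<Phi> t + 2 * pi" "surj \<Phi>"
    by simp_all
  obtain P where "\<forall>x. (P has_real_derivative pe E x) (at x)" "P 0 = 0"
    using has_antiderivative[OF cont_pe[of UNIV E]] by (elim exE conjE)
  then have P: "\<And>x. (P has_real_derivative pe E x) (at x)" "P 0 = 0" by simp_all
  obtain N where "\<forall>x. (N has_real_derivative ne E x) (at x)" "N 0 = 0"
    using has_antiderivative[OF cont_ne[of UNIV E]] by (elim exE conjE)
  then have N: "\<And>x. (N has_real_derivative ne E x) (at x)" "N 0 = 0" by simp_all
  define u where "u t = U (E * sin (\<Phi> t))" for t
  \<comment> \<open>The constant \<open>Th E / rm\<close> in both angles gives their weighted sum
    the value \<open>Th E\<close> where \<open>\<Phi> t = 0\<close>.\<close>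
  define f1 where "f1 t = Th E / rm - P (\<Phi> t)" for t
  define f2 where "f2 t = Th E / rm + N (\<Phi> t)" for t
  have th: "ra * f1 t + rb * f2 t = Th (E * cos (\<Phi> t))" for t
  proof -
    have "ra * f1 t + rb * f2 t = rm * (Th E / rm) + rb * N (\<Phi> t) - ra * P (\<Phi> t)"
      by (simp add: f1_def f2_def algebra_simps add_divide_distrib)
    also have "rm * (Th E / rm) = Th E" using a by simp
    finally show ?thesis using Th_eq[OF P N] by simp
  qed
  have Q: "sqrt ((ra + u t) ^ a * (rb - u t) ^ b) = qc * exp (- (E * sin (\<Phi> t))\<^sup>2 / 2)" for t
    unfolding u_def by (rule sqrt_Q_U)
  have P2: "P (2 * pi) = J E"
    using J_antiderivative[OF P(1)] P(2) by simp
  have N2: "N (2 * pi) = ra * J E / rb"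
    using Th_eq[OF P N, of "2 * pi"] P2 b by (simp add: field_simps)
  have U_mono: "U x \<le> U y" if "x \<le> y" for x y
    using U_strict_mono[of x y] that by (cases "x = y") auto
  have "U (- E) \<le> u t \<and> u t \<le> U E \<and> (\<exists>t. u t = U E) \<and> (\<exists>t. u t = U (- E)) \<and>
    sqrt ((ra + u t) ^ a * (rb - u t) ^ b) * sin (ra * f1 t + rb * f2 t) = Amp E \<and>
    (u has_real_derivative 2 * sqrt ((ra + u t) ^ a * (rb - u t) ^ b) * cos (ra * f1 t + rb * f2 t)) (at t) \<and>
    (f1 has_real_derivative - Amp E / (ra + u t)) (at t) \<and>
    (f2 has_real_derivative Amp E / (rb - u t)) (at t) \<and>
    u (t + T) = u t \<and> f1 (t + T) = f1 t - J E \<and> f2 (t + T) = f2 t + ra * J E / rb" for t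
  proof (intro conjI)
    have "\<bar>E * sin (\<Phi> t)\<bar> \<le> E"
      using assms by (simp add: abs_mult)
    then show "U (- E) \<le> u t" "u t \<le> U E"
      unfolding u_def by (intro U_mono; linarith)+
    show "\<exists>t. u t = U E"
    proof -
      obtain t where "\<Phi> t = pi / 2" using \<Phi>(3) by (metis surjD)
      then have "sin (\<Phi> t) = 1" by (simp only: sin_pi_half)
      then show ?thesis by (intro exI[of _ t]) (simp add: u_def)
    qed
    show "\<exists>t. u t = U (- E)"
    proof -
      obtain t where "\<Phi> t = - (pi / 2)" using \<Phi>(3) by (metis surjD)
      then have "sin (\<Phi> t) = - 1" by (simp only: sin_minus sin_pi_half)
      then show ?thesis by (intro exI[of _ t]) (simp add: u_def)
    qed
    show "sqrt ((ra + u t) ^ a * (rb - u t) ^ b) * sin (ra * f1 t + rb * f2 t) = Amp E"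
      unfolding Q th sin_Th Amp_split[of E "\<Phi> t"] by simp
    have "((\<lambda>t. E * sin (\<Phi> t)) has_real_derivative E * (cos (\<Phi> t) * (1 / We E (\<Phi> t)))) (at t)"
      by (intro DERIV_cmult DERIV_chain2[OF DERIV_sin \<Phi>(1)])
    from DERIV_chain2[OF U_deriv this]
    have "(u has_real_derivative V (E * sin (\<Phi> t)) * (E * (cos (\<Phi> t) * (1 / We E (\<Phi> t))))) (at t)"
      unfolding u_def .
    moreover have "V (E * sin (\<Phi> t)) * (E * (cos (\<Phi> t) * (1 / We E (\<Phi> t))))
        = 2 * (qc * exp (- (E * sin (\<Phi> t))\<^sup>2 / 2)) * Cf (E * cos (\<Phi> t))"
    proof -
      define v where "v = V (E * sin (\<Phi> t))"
      define s where "s = Sf (E * cos (\<Phi> t))"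
      define e where "e = exp ((E * sin (\<Phi> t))\<^sup>2 / 2)"
      have pos: "v > 0" "s > 0" "e > 0" "qc > 0" by (simp_all add: v_def s_def e_def V_pos Sf_pos qc_pos)
      have e': "exp (- (E * sin (\<Phi> t))\<^sup>2 / 2) = 1 / e" by (simp add: e_def exp_minus inverse_eq_divide)
      have k: "E * cos (\<Phi> t) = Cf (E * cos (\<Phi> t)) * s" by (simp add: s_def Cf_Sf)
      have "v * (E * (cos (\<Phi> t) * (1 / We E (\<Phi> t)))) = v * ((E * cos (\<Phi> t)) / (v * s * e / (2 * qc)))"
        by (simp add: We_def v_def s_def e_def)
      also have "\<dots> = v * ((Cf (E * cos (\<Phi> t)) * s) / (v * s * e / (2 * qc)))"
        using k by simp
      also have "\<dots> = 2 * (qc * (1 / e)) * Cf (E * cos (\<Phi> t))"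
        using pos by (simp add: field_simps)
      finally show ?thesis unfolding e' v_def .
    qed
    ultimately show "(u has_real_derivative 2 * sqrt ((ra + u t) ^ a * (rb - u t) ^ b) * cos (ra * f1 t + rb * f2 t)) (at t)"
      unfolding Q th cos_Th by simp
    have core: "core E (\<Phi> t) * (1 / We E (\<Phi> t)) = Amp E"
      using We_pos[of E "\<Phi> t"] by (simp add: Amp_We[symmetric])
    have "(f1 has_real_derivative 0 - pe E (\<Phi> t) * (1 / We E (\<Phi> t))) (at t)"
      unfolding f1_def by (intro DERIV_diff DERIV_const DERIV_chain2[OF P(1) \<Phi>(1)])
    moreover have "0 - pe E (\<Phi> t) * (1 / We E (\<Phi> t)) = - Amp E / (ra + u t)"
      unfolding core[symmetric] by (simp add: pe_def u_def)
    ultimately show "(f1 has_real_derivative - Amp E / (ra + u t)) (at t)" by simp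
    have "(f2 has_real_derivative 0 + ne E (\<Phi> t) * (1 / We E (\<Phi> t))) (at t)"
      unfolding f2_def by (intro DERIV_add DERIV_const DERIV_chain2[OF N(1) \<Phi>(1)])
    moreover have "0 + ne E (\<Phi> t) * (1 / We E (\<Phi> t)) = Amp E / (rb - u t)"
      unfolding core[symmetric] by (simp add: ne_def u_def)
    ultimately show "(f2 has_real_derivative Amp E / (rb - u t)) (at t)" by simp
    show "u (t + T) = u t" by (simp add: u_def \<Phi>(2))
    show "f1 (t + T) = f1 t - J E"
      using antiderivative_periodic[OF P(1) periodic(2)] by (simp add: f1_def \<Phi>(2) P2 P(2))
    show "f2 (t + T) = f2 t + ra * J E / rb"
      using antiderivative_periodic[OF N(1) periodic(3)] by (simp add: f2_def \<Phi>(2) N2 N(2))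
  qed
  then show ?thesis
    using T by (intro exI[of _ u] exI[of _ f1] exI[of _ f2] exI[of _ T]) blast
qed

text \<open>
  Where \<open>sqrt (Q - A\<^sup>2)\<close> is small, the orbit is near an end point of its range, and there
  the rotation speeds dominate; elsewhere the time is controlled by the variation of \<open>u\<close>.
\<close>

lemma time_control:
  assumes "\<eta> > 0"
  obtains K A0 where "K > 0" "A0 > 0"
    "\<And>E \<phi>. E \<ge> 0 \<Longrightarrow> Amp E \<le> A0 \<Longrightarrow>
      core E \<phi> \<le> \<eta> * (ra * pe E \<phi> + rb * ne E \<phi>) + K * Amp E * (V (E * sin \<phi>) * (E * \<bar>cos \<phi>\<bar>))"
proof -
  \<comment> \<open>A lower bound for Q where a + u \<ge> \<eta>a and b - u \<ge> \<eta>b. The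
    threshold \<open>sqrt (q0 / 2)\<close> for A then keeps Q - A^2 at least q0/2 there.\<close>
  define q0 where "q0 = (\<eta> * ra) ^ a * (\<eta> * rb) ^ b"
  have q0: "q0 > 0" using assms a b by (simp add: q0_def)
  define K where "K = 1 / (2 * sqrt (q0 / 2))"
  have K: "K > 0" using q0 by (simp add: K_def)
  show thesis
  proof (rule that[OF K, of "sqrt (q0 / 2)"])
    show "sqrt (q0 / 2) > 0" using q0 by simp
  next
    fix E \<phi> :: real assume E: "E \<ge> 0" and small: "Amp E \<le> sqrt (q0 / 2)"
    let ?y = "E * sin \<phi>" and ?k = "E * cos \<phi>"
    define x where "x = ra + U ?y"
    define z where "z = rb - U ?y"
    define c where "c = core E \<phi>"
    define r where "r = K * Amp E * (V ?y * (E * \<bar>cos \<phi>\<bar>))"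
    have pos: "x > 0" "z > 0" using U_bounds[of ?y] by (simp_all add: x_def z_def)
    have c: "c > 0" by (simp add: c_def core_pos)
    have r: "r \<ge> 0"
      using K Amp_pos[of E] V_pos[of ?y] E by (simp add: r_def)
    have pn: "ra * pe E \<phi> = c * (ra / x)" "rb * ne E \<phi> = c * (rb / z)"
      by (simp_all add: pe_def ne_def c_def x_def z_def)
    have p: "c * (ra / x) \<ge> 0" "c * (rb / z) \<ge> 0" using c pos by simp_all
    have distrib: "\<eta> * (c * (ra / x) + c * (rb / z)) = c * (\<eta> * ra / x) + \<eta> * (c * (rb / z))"
      "\<eta> * (c * (ra / x) + c * (rb / z)) = \<eta> * (c * (ra / x)) + c * (\<eta> * rb / z)"
      by (simp_all add: algebra_simps)
    have "c \<le> \<eta> * (c * (ra / x) + c * (rb / z)) + r"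
    proof -
      consider "x \<le> \<eta> * ra" | "z \<le> \<eta> * rb" | "x \<ge> \<eta> * ra" "z \<ge> \<eta> * rb" by linarith
      then show ?thesis
      proof cases
        case 1
        then have "1 \<le> \<eta> * ra / x" using pos by simp
        then have "c * 1 \<le> c * (\<eta> * ra / x)" using c by (intro mult_left_mono) auto
        moreover have "0 \<le> \<eta> * (c * (rb / z))" by (rule mult_nonneg_nonneg[OF less_imp_le[OF assms] p(2)])
        ultimately show ?thesis unfolding distrib(1) using r by linarith
      next
        case 2
        then have "1 \<le> \<eta> * rb / z" using pos by simp
        then have "c * 1 \<le> c * (\<eta> * rb / z)" using c by (intro mult_left_mono) auto
        moreover have "0 \<le> \<eta> * (c * (ra / x))" by (rule mult_nonneg_nonneg[OF less_imp_le[OF assms] p(1)])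
        ultimately show ?thesis unfolding distrib(2) using r by linarith
      next
        case 3
        define Q where "Q = x ^ a * z ^ b"
        have Q: "Q = qc\<^sup>2 * exp (- ?y\<^sup>2)" "sqrt Q = qc * exp (- ?y\<^sup>2 / 2)"
          unfolding Q_def x_def z_def by (rule Q_U, rule sqrt_Q_U)
        have Qpos: "Q > 0" using pos by (simp add: Q_def)
        have "We E \<phi> = V ?y * Sf ?k / (2 * sqrt Q)"
          unfolding We_def Q(2) by (simp add: exp_minus field_simps)
        then have c_eq: "c = Amp E * (V ?y * Sf ?k / (2 * sqrt Q))"
          unfolding c_def Amp_We[symmetric] by simp
        have "q0 \<le> Q"
          unfolding q0_def Q_def using 3 assms pos by (intro mult_mono power_mono) auto
        have "(Amp E)\<^sup>2 \<le> (sqrt (q0 / 2))\<^sup>2"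
          using small Amp_pos[of E] by (intro power_mono) auto
        then have Amp2: "(Amp E)\<^sup>2 \<le> q0 / 2" using q0 by simp
        have "Amp E = sqrt Q * exp (- ?k\<^sup>2 / 2)"
          unfolding Q(2) by (rule Amp_split)
        then have "(Amp E)\<^sup>2 = Q * exp (- ?k\<^sup>2)"
          using Qpos by (simp add: power_mult_distrib exp_double[symmetric])
        \<comment> \<open>The left side equals Q - A^2.\<close>
        then have "Q * (Cf ?k)\<^sup>2 \<ge> q0 / 2"
          using Amp2 \<open>q0 \<le> Q\<close> by (simp add: Cf_sq algebra_simps)
        then have "sqrt (q0 / 2) \<le> sqrt (Q * (Cf ?k)\<^sup>2)" by (rule real_sqrt_le_mono)
        then have Cf: "sqrt (q0 / 2) \<le> sqrt Q * \<bar>Cf ?k\<bar>" by (simp add: real_sqrt_mult)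
        then have "1 \<le> 2 * K * (sqrt Q * \<bar>Cf ?k\<bar>)" using q0 by (simp add: K_def field_simps)
        then have "c * 1 \<le> c * (2 * K * (sqrt Q * \<bar>Cf ?k\<bar>))" using c by (intro mult_left_mono) auto
        also have "\<dots> = K * Amp E * (V ?y * (\<bar>Cf ?k\<bar> * Sf ?k))"
          unfolding c_eq using Qpos by (simp add: field_simps)
        also have "\<bar>Cf ?k\<bar> * Sf ?k = \<bar>?k\<bar>"
          using Cf_Sf[of ?k] Sf_pos[of ?k] by (metis abs_mult abs_of_pos)
        also have "\<bar>?k\<bar> = E * \<bar>cos \<phi>\<bar>" using E by (simp add: abs_mult)
        finally have "c \<le> r" by (simp add: r_def)
        moreover have "0 \<le> \<eta> * (c * (ra / x) + c * (rb / z))"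
          by (rule mult_nonneg_nonneg[OF less_imp_le[OF assms] add_nonneg_nonneg[OF p]])
        ultimately show ?thesis by linarith
      qed
    qed
    then show "core E \<phi> \<le> \<eta> * (ra * pe E \<phi> + rb * ne E \<phi>) + K * Amp E * (V (E * sin \<phi>) * (E * \<bar>cos \<phi>\<bar>))"
      unfolding pn by (simp add: c_def r_def)
  qed
qed

lemma Amp_small:
  assumes "\<delta> > 0"
  obtains E where "E > 0" "Amp E \<le> \<delta>"
proof
  define s where "s = max 1 (ln (qc / \<delta>))"
  define E where "E = sqrt (2 * s)"
  have s: "s > 0" by (simp add: s_def)
  then show "E > 0" by (simp add: E_def)
  have "E\<^sup>2 / 2 = s" using s by (simp add: E_def)
  have "qc / \<delta> = exp (ln (qc / \<delta>))" using qc_pos assms by simp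
  also have "\<dots> \<le> exp s" by (simp add: s_def)
  finally have "qc \<le> \<delta> * exp s" using assms by (simp add: field_simps)
  then have "qc * exp (- s) \<le> \<delta> * (exp s * exp (- s))"
    by (simp add: mult.assoc[symmetric] mult_right_mono)
  also have "exp s * exp (- s) = 1" by (simp add: mult_exp_exp)
  finally show "Amp E \<le> \<delta>" using \<open>E\<^sup>2 / 2 = s\<close> by (simp add: Amp_def)
qed

text \<open>Both blocks rotate by the same weighted amount I = \<open>ra * J E\<close>, in opposite
  directions, so the total rotation is 2I. Over each half circle it exceeds the change of \<theta>,
  up to sign, by at most twice the integral of \<open>core\<close>, whence I \<le> \<pi> +
  \<open>G (2 * pi)\<close>. By the time control \<open>G (2 * pi)\<close> is at most a small
  multiple of I plus a multiple of A, so I drops below \<pi> V(0) once A is small.\<close>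

lemma J_not_constant:
  assumes V0: "V 0 > 1"
  obtains E where "E > 0" "J E < J 0"
proof -
  define \<sigma> where "\<sigma> = V 0"
  \<comment> \<open>With this value \<pi>\<sigma>(1 - 2\<eta>) = \<pi> + \<pi>(\<sigma> - 1)/2,
    which leaves a margin above \<pi> for the term proportional to A.\<close>
  define \<eta> where "\<eta> = (\<sigma> - 1) / (4 * \<sigma>)"
  have \<sigma>: "\<sigma> > 1" using V0 by (simp add: \<sigma>_def)
  then have "\<eta> > 0" by (simp add: \<eta>_def)
  then obtain K A0 where K: "K > 0" "A0 > 0" and control: "\<And>E \<phi>. E \<ge> 0 \<Longrightarrow> Amp E \<le> A0 \<Longrightarrow>
      core E \<phi> \<le> \<eta> * (ra * pe E \<phi> + rb * ne E \<phi>) + K * Amp E * (V (E * sin \<phi>) * (E * \<bar>cos \<phi>\<bar>))"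
    using time_control[of \<eta>] by metis
  \<comment> \<open>Keeps that term, \<open>2 * K * Amp E * rm\<close>, within half of the
    margin.\<close>
  define \<delta> where "\<delta> = min A0 (pi * (\<sigma> - 1) / (8 * K * rm))"
  have "\<delta> > 0" using K \<sigma> a by (simp add: \<delta>_def add_pos_nonneg)
  then obtain E where E: "E > 0" "Amp E \<le> \<delta>" using Amp_small by blast
  obtain P where "\<forall>x. (P has_real_derivative pe E x) (at x)" "P 0 = 0"
    using has_antiderivative[OF cont_pe[of UNIV E]] by (elim exE conjE)
  then have P: "\<And>x. (P has_real_derivative pe E x) (at x)" "P 0 = 0" by simp_all
  obtain N where "\<forall>x. (N has_real_derivative ne E x) (at x)" "N 0 = 0"
    using has_antiderivative[OF cont_ne[of UNIV E]] by (elim exE conjE)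
  then have N: "\<And>x. (N has_real_derivative ne E x) (at x)" "N 0 = 0" by simp_all
  obtain G where "\<forall>x. (G has_real_derivative core E x) (at x)" "G 0 = 0"
    using has_antiderivative[OF cont_core[of UNIV E]] by (elim exE conjE)
  then have G: "\<And>x. (G has_real_derivative core E x) (at x)" "G 0 = 0" by simp_all
  define R where "R x = ra * P x + rb * N x" for x
  have R: "(R has_real_derivative ra * pe E x + rb * ne E x) (at x)" for x
    unfolding R_def by (intro DERIV_add DERIV_cmult P N)
  define I where "I = ra * J E"
  have P2: "ra * P (2 * pi) = I"
    using J_antiderivative[OF P(1)] P(2) by (simp add: I_def)
  have N2: "rb * N (2 * pi) = I"
    using Th_eq[OF P N, of "2 * pi"] P2 by simp
  have R2: "R 0 = 0" "R (2 * pi) = 2 * I"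
    using P N P2 N2 by (simp_all add: R_def)
  define \<theta> where "\<theta> x = Th (E * cos x)" for x
  have \<theta>: "(\<theta> has_real_derivative rb * ne E x - ra * pe E x) (at x)" for x
    unfolding \<theta>_def by (rule Th_antiderivative)
  have U_mono: "U x \<le> U y" if "x \<le> y" for x y
    using U_strict_mono[of x y] that by (cases "x = y") auto
  have pc: "ra * pe E x \<le> core E x" if "sin x \<ge> 0" for x
  proof -
    have "U (E * sin x) \<ge> 0" using U_mono[of 0 "E * sin x"] U_0 E(1) that by simp
    then have "core E x * ra \<le> core E x * (ra + U (E * sin x))" using core_pos[of E x] by simp
    then show ?thesis using U_bounds(1)[of "E * sin x"] by (simp add: pe_def field_simps)
  qed
  have nc: "rb * ne E x \<le> core E x" if "sin x \<le> 0" for x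
  proof -
    have "E * sin x \<le> 0" using E(1) that by (simp add: mult_nonneg_nonpos)
    then have "U (E * sin x) \<le> 0" using U_mono[of "E * sin x" 0] U_0 by simp
    then have "core E x * rb \<le> core E x * (rb - U (E * sin x))" using core_pos[of E x] by simp
    then show ?thesis using U_bounds(2)[of "E * sin x"] by (simp add: ne_def field_simps)
  qed
  have sin_neg: "sin x \<le> 0" if "pi \<le> x" "x \<le> 2 * pi" for x
    using sin_ge_zero[of "x - pi"] that by (simp add: sin_diff)
  \<comment> \<open>The total speed is \<theta>' + 2 \<open>ra * pe\<close>, and on this half u
    \<ge> 0 makes \<open>ra * pe\<close> at most \<open>core\<close>. On the other half the blocks
    exchange roles and \<theta> changes sign.\<close>
  have "R pi - R 0 \<le> (\<theta> pi + 2 * G pi) - (\<theta> 0 + 2 * G 0)"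
  proof (rule antiderivative_le[OF _ R])
    show "((\<lambda>x. \<theta> x + 2 * G x) has_real_derivative (rb * ne E x - ra * pe E x) + 2 * core E x) (at x)" for x
      by (intro DERIV_add DERIV_cmult \<theta> G)
    show "ra * pe E x + rb * ne E x \<le> (rb * ne E x - ra * pe E x) + 2 * core E x" if "0 \<le> x" "x \<le> pi" for x
      using pc[of x] sin_ge_zero[of x] that by simp
  qed simp
  moreover have "R (2 * pi) - R pi \<le> (- \<theta> (2 * pi) + 2 * G (2 * pi)) - (- \<theta> pi + 2 * G pi)"
  proof (rule antiderivative_le[OF _ R])
    show "((\<lambda>x. - \<theta> x + 2 * G x) has_real_derivative - (rb * ne E x - ra * pe E x) + 2 * core E x) (at x)" for x
      by (intro DERIV_add DERIV_minus DERIV_cmult \<theta> G)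
    show "ra * pe E x + rb * ne E x \<le> - (rb * ne E x - ra * pe E x) + 2 * core E x" if "pi \<le> x" "x \<le> 2 * pi" for x
      using nc[of x] sin_neg[of x] that by simp
  qed simp
  moreover have "\<theta> pi < pi" "\<theta> 0 > 0" "\<theta> (2 * pi) > 0"
    by (simp_all add: \<theta>_def Th_bounds)
  ultimately have 1: "I \<le> pi + G (2 * pi)"
    using R2 G(2) by linarith
  define c where "c = K * Amp E"
  have c: "c > 0" using K Amp_pos by (simp add: c_def)
  define u where "u x = c * U (E * sin x)" for x
  have u: "(u has_real_derivative c * (V (E * sin x) * (E * cos x))) (at x)" for x
    unfolding u_def by (intro DERIV_cmult DERIV_chain2[OF U_deriv]) (auto intro!: derivative_eq_intros)
  have ctl: "core E x \<le> \<eta> * (ra * pe E x + rb * ne E x) + c * (V (E * sin x) * (E * \<bar>cos x\<bar>))" for x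
    using control[of E x] E by (simp add: \<delta>_def c_def)
  have up: "G y - G x \<le> (\<eta> * R y + u y) - (\<eta> * R x + u x)"
    if "x \<le> y" "\<And>z. x \<le> z \<Longrightarrow> z \<le> y \<Longrightarrow> cos z \<ge> 0" for x y
  proof (rule antiderivative_le[OF that(1) G(1)])
    show "((\<lambda>x. \<eta> * R x + u x) has_real_derivative \<eta> * (ra * pe E z + rb * ne E z) + c * (V (E * sin z) * (E * cos z))) (at z)" for z
      by (intro DERIV_add DERIV_cmult R u)
    show "core E z \<le> \<eta> * (ra * pe E z + rb * ne E z) + c * (V (E * sin z) * (E * cos z))" if "x \<le> z" "z \<le> y" for z
      using ctl[of z] \<open>\<And>z. x \<le> z \<Longrightarrow> z \<le> y \<Longrightarrow> cos z \<ge> 0\<close>[OF that] by simp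
  qed
  have down: "G y - G x \<le> (\<eta> * R y - u y) - (\<eta> * R x - u x)"
    if "x \<le> y" "\<And>z. x \<le> z \<Longrightarrow> z \<le> y \<Longrightarrow> cos z \<le> 0" for x y
  proof (rule antiderivative_le[OF that(1) G(1)])
    show "((\<lambda>x. \<eta> * R x - u x) has_real_derivative \<eta> * (ra * pe E z + rb * ne E z) - c * (V (E * sin z) * (E * cos z))) (at z)" for z
      by (intro DERIV_diff DERIV_cmult R u)
    show "core E z \<le> \<eta> * (ra * pe E z + rb * ne E z) - c * (V (E * sin z) * (E * cos z))" if "x \<le> z" "z \<le> y" for z
      using ctl[of z] \<open>\<And>z. x \<le> z \<Longrightarrow> z \<le> y \<Longrightarrow> cos z \<le> 0\<close>[OF that] by simp
  qed
  \<comment> \<open>On each of the three arcs cos has a fixed sign, so the last term of the time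
    control integrates to plus or minus the change of U. Altogether this costs at most 2(a + b)
    times \<open>c\<close>.\<close>
  have "G (pi / 2) - G 0 \<le> (\<eta> * R (pi / 2) + u (pi / 2)) - (\<eta> * R 0 + u 0)"
    by (rule up) (auto intro: cos_ge_zero)
  moreover have "G (3 / 2 * pi) - G (pi / 2) \<le> (\<eta> * R (3 / 2 * pi) - u (3 / 2 * pi)) - (\<eta> * R (pi / 2) - u (pi / 2))"
  proof (rule down)
    show "cos z \<le> 0" if "pi / 2 \<le> z" "z \<le> 3 / 2 * pi" for z
      using cos_ge_zero[of "z - pi"] that by (simp add: cos_diff)
  qed simp
  moreover have "G (2 * pi) - G (3 / 2 * pi) \<le> (\<eta> * R (2 * pi) + u (2 * pi)) - (\<eta> * R (3 / 2 * pi) + u (3 / 2 * pi))"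
  proof (rule up)
    show "cos z \<ge> 0" if "3 / 2 * pi \<le> z" "z \<le> 2 * pi" for z
      using cos_ge_zero[of "z - 2 * pi"] that by (simp add: cos_diff)
  qed simp
  moreover have "u 0 = 0" "u (2 * pi) = 0" by (simp_all add: u_def U_0)
  moreover have "u (pi / 2) \<le> c * rb"
    using c U_bounds(2)[of "E * sin (pi / 2)"] unfolding u_def by (intro mult_left_mono) auto
  moreover have "- u (3 / 2 * pi) \<le> c * ra"
  proof -
    have "c * (- U (E * sin (3 / 2 * pi))) \<le> c * ra"
      using c U_bounds(1)[of "E * sin (3 / 2 * pi)"] by (intro mult_left_mono) auto
    then show ?thesis by (simp add: u_def)
  qed
  ultimately have "G (2 * pi) \<le> \<eta> * (2 * I) + 2 * (c * rb + c * ra)"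
    using R2 G(2) by simp
  with 1 have 2: "I \<le> pi + 2 * \<eta> * I + 2 * c * rm"
    by (simp add: algebra_simps)
  have \<eta>2: "1 - 2 * \<eta> = (\<sigma> + 1) / (2 * \<sigma>)" using \<sigma> by (simp add: \<eta>_def field_simps)
  have "2 * c * rm \<le> pi * (\<sigma> - 1) / 4"
  proof -
    have "Amp E \<le> pi * (\<sigma> - 1) / (8 * K * rm)" using E(2) by (simp add: \<delta>_def)
    moreover have "8 * K * rm > 0" using K a by (simp add: add_pos_nonneg)
    ultimately have "Amp E * (8 * K * rm) \<le> pi * (\<sigma> - 1)" by (simp add: pos_le_divide_eq)
    then show ?thesis by (simp add: c_def algebra_simps)
  qed
  have "I < pi * \<sigma>"
  proof (rule ccontr)
    assume "\<not> I < pi * \<sigma>"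
    then have "pi * \<sigma> * ((\<sigma> + 1) / (2 * \<sigma>)) \<le> I * ((\<sigma> + 1) / (2 * \<sigma>))"
      using \<sigma> by (intro mult_right_mono) auto
    also have "\<dots> = I - 2 * \<eta> * I" unfolding \<eta>2[symmetric] by (simp add: algebra_simps)
    also have "\<dots> \<le> pi + pi * (\<sigma> - 1) / 4" using 2 \<open>2 * c * rm \<le> pi * (\<sigma> - 1) / 4\<close> by linarith
    also have "pi * \<sigma> * ((\<sigma> + 1) / (2 * \<sigma>)) = pi + pi * (\<sigma> - 1) / 2"
      using \<sigma> by (simp add: field_simps)
    finally have "pi * (\<sigma> - 1) \<le> 0" by linarith
    then show False using \<sigma> pi_gt_zero by (simp add: mult_le_0_iff not_le)
  qed
  then have "ra * J E < ra * J 0" by (simp add: I_def J_0 \<sigma>_def)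
  then have "J E < J 0" using a by simp
  with E(1) show ?thesis by (rule that)
qed

lemma infinitely_many_rational_angles:
  assumes "a + b \<ge> 3"
  shows "infinite {E. E > 0 \<and> (\<exists>q\<in>\<rat>. J E = pi * q)}"
proof -
  \<comment> \<open>From (a - 1)(b - 1) \<ge> 0 comes ab + 1 \<ge> a + b, hence 2ab \<ge> 2(a + b) -
    2, which exceeds a + b as soon as a + b \<ge> 3.\<close>
  have "2 * ra * rb > rm"
  proof -
    have "a * b + 1 \<ge> a + b"
    proof -
      obtain a' b' where "a = Suc a'" "b = Suc b'" using a b gr0_implies_Suc by blast
      then show ?thesis by simp
    qed
    moreover have "2 * n > a + b" if "n + 1 \<ge> a + b" for n
      using that assms by linarith
    ultimately have "2 * (a * b) > a + b" by blast
    then have "real (2 * (a * b)) > real (a + b)" by (simp only: of_nat_less_iff)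
    then show ?thesis by simp
  qed
  then have "(V 0)\<^sup>2 > 1" using a by (simp add: V_0)
  then have "V 0 > 1" using V_pos[of 0] by (metis abs_of_pos abs_square_less_1 abs_square_le_1 not_less)
  then obtain E1 where E1: "E1 > 0" "J E1 < J 0" by (rule J_not_constant)
  have "J E1 / pi < J 0 / pi" using E1(2) by (simp add: divide_strict_right_mono)
  then obtain q1 where q1: "q1 \<in> \<rat>" "J E1 / pi < q1" "q1 < J 0 / pi" using Rats_dense_in_real by blast
  then obtain q2 where q2: "q2 \<in> \<rat>" "q1 < q2" "q2 < J 0 / pi" using Rats_dense_in_real by blast
  \<comment> \<open>Distinct rationals in a gap of values of J/\<pi>; distinct values are taken at
    distinct radii.\<close>
  define q where "q n = q1 + (q2 - q1) / (real n + 1)" for n :: nat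
  have qn: "q n \<in> \<rat>" "J E1 / pi < q n" "q n < J 0 / pi" for n
  proof -
    show "q n \<in> \<rat>" using q1(1) q2(1) by (simp add: q_def)
    have "0 \<le> (q2 - q1) / (real n + 1)" using q2(2) by simp
    moreover have "(q2 - q1) / (real n + 1) \<le> (q2 - q1) / 1"
      using q2(2) by (intro divide_left_mono) auto
    ultimately have "0 \<le> (q2 - q1) / (real n + 1)" "(q2 - q1) / (real n + 1) \<le> q2 - q1" by simp_all
    then show "J E1 / pi < q n" "q n < J 0 / pi" using q1 q2 unfolding q_def by linarith+
  qed
  have inj: "inj q"
    using q2(2) by (auto simp: inj_def q_def)
  have "\<exists>E. E > 0 \<and> J E = pi * q n" for n
  proof -
    have "J E1 \<le> pi * q n" "pi * q n < J 0" using qn[of n] by (simp_all add: field_simps)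
    moreover have "isCont J x" for x using cont_J[of UNIV] by (simp add: continuous_on_eq_continuous_at)
    ultimately have "\<exists>x\<ge>0. x \<le> E1 \<and> J x = pi * q n"
      using E1(1) by (intro IVT2) auto
    then obtain x where "x \<ge> 0" "J x = pi * q n" by blast
    \<comment> \<open>Strictness at \<open>J 0\<close> excludes the equilibrium.\<close>
    moreover have "x \<noteq> 0" using \<open>pi * q n < J 0\<close> \<open>J x = pi * q n\<close> by auto
    ultimately show ?thesis by (intro exI[of _ x]) auto
  qed
  then obtain e where e: "\<And>n. e n > 0 \<and> J (e n) = pi * q n" by metis
  have "inj e"
  proof (rule injI)
    fix x y assume "e x = e y"
    then have "pi * q x = pi * q y" using e by metis
    then show "x = y" using inj by (simp add: inj_eq)
  qed
  moreover have "range e \<subseteq> {E. E > 0 \<and> (\<exists>q\<in>\<rat>. J E = pi * q)}"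
    using e qn(1) by blast
  ultimately show ?thesis
    using range_inj_infinite infinite_super by blast
qed

end

section \<open>The families of a datum\<close>

lemma prod_UNIV_sum:
  "(\<Prod>j\<in>UNIV. f (j :: 'p::finite + 'q::finite)) = (\<Prod>i\<in>UNIV. f (Inl i)) * (\<Prod>k\<in>UNIV. f (Inr k))"
  unfolding UNIV_Plus_UNIV[symmetric] by (subst prod.Plus) (auto simp: o_def)

definition datum_r :: "('p + 'q \<Rightarrow> real) \<Rightarrow> (real \<Rightarrow> real) \<Rightarrow> 'p + 'q \<Rightarrow> real \<Rightarrow> real" where
  "datum_r \<alpha> u j t = sqrt (\<alpha> j + quadric_sign j * u t)"

definition datum_w ::
  "('p + 'q \<Rightarrow> real) \<Rightarrow> (real \<Rightarrow> real) \<Rightarrow> ('p + 'q \<Rightarrow> real \<Rightarrow> real) \<Rightarrow> 'p + 'q \<Rightarrow> real \<Rightarrow> complex" where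
  "datum_w \<alpha> u \<theta> j t = cis (\<theta> j t) * complex_of_real (datum_r \<alpha> u j t)"

lemma quadric_sign_Inl_Inr [simp]: "quadric_sign (Inl i) = 1" "quadric_sign (Inr k) = -1"
  by (simp_all add: quadric_sign_def)

lemma quadric_sign_nz: "quadric_sign j \<noteq> 0"
  by (cases j) simp_all

lemma prod_cis: "finite I \<Longrightarrow> (\<Prod>j\<in>I. cis (f j)) = cis (\<Sum>j\<in>I. f j)"
  by (induction I rule: finite_induct) (simp_all add: cis_mult)

lemma sqrt_prod: "sqrt (\<Prod>j\<in>I. f j) = (\<Prod>j\<in>I. sqrt (f j))"
  by (induction I rule: infinite_finite_induct) (simp_all add: real_sqrt_mult)

text \<open>In polar form, with r_j the modulus of w_j, q = Q(u)^(1/2) and \<Theta> the sum of the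
  angles, the equations for u and \<theta>_j combine to w_j' = \<plusminus>(q/r_j) cis (\<theta>_j -
  \<Theta>). The product of the other factors has modulus q/r_j and phase \<Theta> -
  \<theta>_j.\<close>

lemma evolution_datum_quadric_evolution:
  assumes "evolution_datum \<alpha> A u \<theta>"
  shows "quadric_evolution quadric_sign (datum_w \<alpha> u \<theta>)"
proof
  fix j :: "'a + 'b" and t :: real
  show "quadric_sign j \<noteq> 0" by (rule quadric_sign_nz)
  have pos: "\<alpha> j + quadric_sign j * u t > 0" for j t
    using assms by (cases j) (auto simp: evolution_datum_def)
  then have r: "datum_r \<alpha> u j t > 0" for j t
    by (simp add: datum_r_def)
  then show nz: "datum_w \<alpha> u \<theta> j t \<noteq> 0"
    by (simp add: datum_w_def less_imp_neq[symmetric] del: less_imp_neq)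
  define q where "q = sqrt (Q_poly \<alpha> (u t))"
  define \<Theta> where "\<Theta> = (\<Sum>i\<in>UNIV. \<theta> i t)"
  have "(\<Prod>j\<in>UNIV. datum_r \<alpha> u j t) = q"
    by (simp add: prod_UNIV_sum datum_r_def q_def Q_poly_def real_sqrt_mult sqrt_prod)
  then have P: "(\<Prod>k\<in>UNIV. datum_w \<alpha> u \<theta> k t) = cis \<Theta> * complex_of_real q"
    by (simp add: datum_w_def prod.distrib prod_cis \<Theta>_def flip: of_real_prod)
  have du: "(u has_real_derivative 2 * q * cos \<Theta>) (at t)"
    using assms by (simp add: evolution_datum_def q_def \<Theta>_def)
  have d\<theta>: "(\<theta> j has_real_derivative - quadric_sign j * (q * sin \<Theta>) / (datum_r \<alpha> u j t)\<^sup>2) (at t)"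
  proof (cases j)
    case (Inl i)
    then have "(datum_r \<alpha> u j t)\<^sup>2 = \<alpha> (Inl i) + u t" using pos[of j t] by (simp add: datum_r_def)
    moreover have "(\<theta> (Inl i) has_real_derivative - (q * sin \<Theta>) / (\<alpha> (Inl i) + u t)) (at t)"
      using assms unfolding evolution_datum_def q_def \<Theta>_def by blast
    ultimately show ?thesis using Inl by simp
  next
    case (Inr k)
    then have "(datum_r \<alpha> u j t)\<^sup>2 = \<alpha> (Inr k) - u t" using pos[of j t] by (simp add: datum_r_def)
    moreover have "(\<theta> (Inr k) has_real_derivative (q * sin \<Theta>) / (\<alpha> (Inr k) - u t)) (at t)"
      using assms unfolding evolution_datum_def q_def \<Theta>_def by blast
    ultimately show ?thesis using Inr by simp
  qed
  define s where "s = quadric_sign j"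
  define r where "r = datum_r \<alpha> u j t"
  have rp: "r > 0" unfolding r_def by (rule \<open>\<And>j t. datum_r \<alpha> u j t > 0\<close>)
  have dr: "(datum_r \<alpha> u j has_real_derivative s * (q * cos \<Theta>) / r) (at t)"
  proof -
    have "((\<lambda>t. \<alpha> j + s * u t) has_real_derivative s * (2 * q * cos \<Theta>)) (at t)"
      by (auto intro!: derivative_eq_intros du)
    from DERIV_real_sqrt[THEN DERIV_chain2, OF _ this] pos[of j t]
    have "((\<lambda>t. sqrt (\<alpha> j + s * u t)) has_real_derivative inverse (sqrt (\<alpha> j + s * u t)) / 2 * (s * (2 * q * cos \<Theta>))) (at t)"
      by (simp add: s_def)
    moreover have "datum_r \<alpha> u j = (\<lambda>t. sqrt (\<alpha> j + s * u t))"
      by (simp add: datum_r_def s_def fun_eq_iff)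
    moreover have "inverse (sqrt (\<alpha> j + s * u t)) / 2 * (s * (2 * q * cos \<Theta>)) = s * (q * cos \<Theta>) / r"
      by (simp add: r_def datum_r_def s_def field_simps)
    ultimately show ?thesis by simp
  qed
  have eq: "cnj (\<Prod>k\<in>UNIV - {j}. datum_w \<alpha> u \<theta> k t)
      = cis (\<theta> j t) * cis (- \<Theta>) * complex_of_real (q / r)"
  proof -
    have "(\<Prod>k\<in>UNIV. datum_w \<alpha> u \<theta> k t) = datum_w \<alpha> u \<theta> j t * (\<Prod>k\<in>UNIV - {j}. datum_w \<alpha> u \<theta> k t)"
      by (rule prod.remove) auto
    then have "(\<Prod>k\<in>UNIV - {j}. datum_w \<alpha> u \<theta> k t) = cis \<Theta> * complex_of_real q / (cis (\<theta> j t) * complex_of_real r)"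
      using nz unfolding P by (simp add: datum_w_def r_def field_simps)
    also have "\<dots> = cis \<Theta> * cis (- \<theta> j t) * complex_of_real (q / r)"
      by (simp add: divide_inverse cis_inverse mult_ac)
    finally show ?thesis by (simp add: cis_cnj)
  qed
  show "(datum_w \<alpha> u \<theta> j has_vector_derivative quadric_sign j *\<^sub>R cnj (\<Prod>k\<in>UNIV - {j}. datum_w \<alpha> u \<theta> k t)) (at t)"
    unfolding eq s_def[symmetric] has_vector_derivative_complex_iff
  proof (intro conjI)
    have cc: "cos (\<theta> j t - \<Theta>) = cos (\<theta> j t) * cos \<Theta> + sin (\<theta> j t) * sin \<Theta>"
      "sin (\<theta> j t - \<Theta>) = sin (\<theta> j t) * cos \<Theta> - cos (\<theta> j t) * sin \<Theta>"
      by (rule cos_diff, rule sin_diff)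
    note d = d\<theta>[folded s_def r_def]
    have "((\<lambda>t. cos (\<theta> j t) * datum_r \<alpha> u j t) has_real_derivative
        (- sin (\<theta> j t) * (- s * (q * sin \<Theta>) / r\<^sup>2)) * datum_r \<alpha> u j t + s * (q * cos \<Theta>) / r * cos (\<theta> j t)) (at t)"
      by (intro DERIV_mult DERIV_chain2[OF DERIV_cos d] dr)
    moreover have "(- sin (\<theta> j t) * (- s * (q * sin \<Theta>) / r\<^sup>2)) * datum_r \<alpha> u j t + s * (q * cos \<Theta>) / r * cos (\<theta> j t)
       = s * (q / r) * cos (\<theta> j t - \<Theta>)"
      unfolding r_def[symmetric] cc using rp by (simp add: field_simps power2_eq_square)
    ultimately show "((\<lambda>t. Re (datum_w \<alpha> u \<theta> j t)) has_real_derivative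
        Re (s *\<^sub>R (cis (\<theta> j t) * cis (- \<Theta>) * complex_of_real (q / r)))) (at t)"
      by (simp add: datum_w_def cis_mult mult_ac)
    have "((\<lambda>t. sin (\<theta> j t) * datum_r \<alpha> u j t) has_real_derivative
        (cos (\<theta> j t) * (- s * (q * sin \<Theta>) / r\<^sup>2)) * datum_r \<alpha> u j t + s * (q * cos \<Theta>) / r * sin (\<theta> j t)) (at t)"
      by (intro DERIV_mult DERIV_chain2[OF DERIV_sin d] dr)
    moreover have "(cos (\<theta> j t) * (- s * (q * sin \<Theta>) / r\<^sup>2)) * datum_r \<alpha> u j t + s * (q * cos \<Theta>) / r * sin (\<theta> j t)
       = s * (q / r) * sin (\<theta> j t - \<Theta>)"
      unfolding r_def[symmetric] cc using rp by (simp add: field_simps power2_eq_square)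
    ultimately show "((\<lambda>t. Im (datum_w \<alpha> u \<theta> j t)) has_real_derivative
        Im (s *\<^sub>R (cis (\<theta> j t) * cis (- \<Theta>) * complex_of_real (q / r)))) (at t)"
      by (simp add: datum_w_def cis_mult mult_ac)
  qed
qed

text \<open>The family free of the locale hypotheses, so that those of two different data can be
  compared.\<close>

definition w_family :: "('p::finite + 'q::finite \<Rightarrow> real \<Rightarrow> complex) \<Rightarrow> real \<Rightarrow> (complex ^ ('p + 'q)) set" where
  "w_family w c = {z. \<exists>x t. quadric_form x = c \<and> z = (\<chi> j. complex_of_real (x $ j) * w j t)}"

lemma (in periodic_evolution) family_eq: "family = w_family w"
  by (simp add: fun_eq_iff family_def w_family_def)

lemma quadric_family_eq: "quadric_family \<alpha> u \<theta> c = w_family (datum_w \<alpha> u \<theta>) c"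
proof (intro equalityI subsetI)
  fix z assume "z \<in> quadric_family \<alpha> u \<theta> c"
  then obtain t x where x: "(\<Sum>j\<in>UNIV. (x (Inl j))\<^sup>2) - (\<Sum>j\<in>UNIV. (x (Inr j))\<^sup>2) = c"
    and z: "\<And>j. z $ Inl j = of_real (x (Inl j)) * exp (\<i> * of_real (\<theta> (Inl j) t)) * of_real (sqrt (\<alpha> (Inl j) + u t))"
    "\<And>j. z $ Inr j = of_real (x (Inr j)) * exp (\<i> * of_real (\<theta> (Inr j) t)) * of_real (sqrt (\<alpha> (Inr j) - u t))"
    unfolding quadric_family_def by blast
  have "z $ j = complex_of_real (x j) * datum_w \<alpha> u \<theta> j t" for j
    using z by (cases j) (simp_all add: datum_w_def datum_r_def cis_conv_exp)
  then show "z \<in> w_family (datum_w \<alpha> u \<theta>) c"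
    unfolding w_family_def using x
    by (intro CollectI exI[of _ "\<chi> j. x j"] exI[of _ t]) (simp add: quadric_form_eq vec_eq_iff)
next
  fix z assume "z \<in> w_family (datum_w \<alpha> u \<theta>) c"
  then obtain x t where "quadric_form x = c" "z = (\<chi> j. complex_of_real (x $ j) * datum_w \<alpha> u \<theta> j t)"
    unfolding w_family_def by blast
  then show "z \<in> quadric_family \<alpha> u \<theta> c"
    unfolding quadric_family_def
    by (intro CollectI exI[of _ t] exI[of _ "\<lambda>j. x $ j"])
      (simp add: quadric_form_eq datum_w_def datum_r_def cis_conv_exp)
qed

lemma norm_datum_w:
  assumes "evolution_datum \<alpha> A u \<theta>"
  shows "(cmod (datum_w \<alpha> u \<theta> j t))\<^sup>2 = \<alpha> j + quadric_sign j * u t"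
proof -
  have "\<alpha> j + quadric_sign j * u t > 0"
    using assms by (cases j) (auto simp: evolution_datum_def)
  then show ?thesis by (simp add: datum_w_def norm_mult datum_r_def)
qed

lemma iterate_shift:
  fixes f :: "real \<Rightarrow> real"
  assumes "\<And>t. f (t + T) = f t + d"
  shows "f (t + real n * T) = f t + real n * d"
proof (induction n)
  case (Suc n)
  then show ?case using assms[of "t + real n * T"] by (simp add: algebra_simps)
qed simp

section \<open>Telling the families apart\<close>

text \<open>An invariant of the bare set. On one coordinate axis the quadric equation fixes the real
  coordinate up to sign, so the norms display c times the range of |w_i|^2, up to the sign of the
  block.\<close>

definition axis_norms :: "(complex ^ 'n) set \<Rightarrow> 'n \<Rightarrow> real set" where
  "axis_norms S i = {(cmod (z $ i))\<^sup>2 | z. z \<in> S \<and> (\<forall>j. j \<noteq> i \<longrightarrow> z $ j = 0)}"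

text \<open>The cone is invariant under dilations, so absolute lengths carry no information for c =
  0. In the plane of one index from each block the two real coordinates have equal squares and drop
  out of the ratio; \<open>z $ i \<noteq> 0\<close> excludes the vertex.\<close>

definition plane_ratios :: "(complex ^ 'n) set \<Rightarrow> 'n \<Rightarrow> 'n \<Rightarrow> real set" where
  "plane_ratios S i k = {(cmod (z $ i))\<^sup>2 / (cmod (z $ k))\<^sup>2 | z. z \<in> S \<and> z $ i \<noteq> 0 \<and> (\<forall>j. j \<noteq> i \<longrightarrow> j \<noteq> k \<longrightarrow> z $ j = 0)}"

lemma axis_norms_family:
  fixes w :: "'p::finite + 'q::finite \<Rightarrow> real \<Rightarrow> complex"
  assumes nz: "\<And>j t. w j t \<noteq> 0"
  shows "axis_norms (w_family w c) i = {c * quadric_sign i * (cmod (w i t))\<^sup>2 | t. c * quadric_sign i \<ge> 0}"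
proof (intro equalityI subsetI)
  fix r assume "r \<in> axis_norms (w_family w c) i"
  then obtain x t where x: "quadric_form x = c" "r = (cmod (complex_of_real (x $ i) * w i t))\<^sup>2"
    "\<And>j. j \<noteq> i \<Longrightarrow> complex_of_real (x $ j) * w j t = 0"
    by (auto simp: axis_norms_def w_family_def)
  have "x $ j = 0" if "j \<noteq> i" for j
    using x(3)[OF that] nz[of j t] by simp
  then have "quadric_form x = quadric_sign i * (x $ i)\<^sup>2"
    unfolding quadric_form_def by (subst sum.remove[of UNIV i]) auto
  then have c: "c * quadric_sign i = (x $ i)\<^sup>2"
    using x(1) by (cases i) auto
  then show "r \<in> {c * quadric_sign i * (cmod (w i t))\<^sup>2 | t. c * quadric_sign i \<ge> 0}"
    using x(2) by (auto simp: norm_mult power_mult_distrib)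
next
  fix r assume "r \<in> {c * quadric_sign i * (cmod (w i t))\<^sup>2 | t. c * quadric_sign i \<ge> 0}"
  then obtain t where t: "r = c * quadric_sign i * (cmod (w i t))\<^sup>2" "c * quadric_sign i \<ge> 0" by blast
  define x :: "real ^ ('p + 'q)" where "x = (\<chi> j. if j = i then sqrt (c * quadric_sign i) else 0)"
  have "quadric_form x = quadric_sign i * (x $ i)\<^sup>2"
    unfolding quadric_form_def by (subst sum.remove[of UNIV i]) (auto simp: x_def)
  also have "\<dots> = c" using t(2) by (cases i) (auto simp: x_def)
  finally have "(\<chi> j. complex_of_real (x $ j) * w j t) \<in> w_family w c"
    unfolding w_family_def by blast
  moreover have "r = (cmod (complex_of_real (x $ i) * w i t))\<^sup>2"
    using t by (simp add: x_def norm_mult power_mult_distrib)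
  ultimately show "r \<in> axis_norms (w_family w c) i"
    unfolding axis_norms_def
    by (intro CollectI exI[of _ "\<chi> j. complex_of_real (x $ j) * w j t"]) (simp add: x_def)
qed

lemma plane_ratios_family:
  fixes w :: "'p::finite + 'q::finite \<Rightarrow> real \<Rightarrow> complex"
  assumes nz: "\<And>j t. w j t \<noteq> 0"
  shows "plane_ratios (w_family w 0) (Inl i) (Inr k) = {(cmod (w (Inl i) t))\<^sup>2 / (cmod (w (Inr k) t))\<^sup>2 | t. True}"
proof (intro equalityI subsetI)
  fix r assume "r \<in> plane_ratios (w_family w 0) (Inl i) (Inr k)"
  then obtain x t where x: "quadric_form x = 0"
    "r = (cmod (complex_of_real (x $ Inl i) * w (Inl i) t))\<^sup>2 / (cmod (complex_of_real (x $ Inr k) * w (Inr k) t))\<^sup>2"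
    "x $ Inl i \<noteq> 0"
    "\<And>j. j \<noteq> Inl i \<Longrightarrow> j \<noteq> Inr k \<Longrightarrow> complex_of_real (x $ j) * w j t = 0"
    by (auto simp: plane_ratios_def w_family_def)
  have 0: "x $ j = 0" if "j \<noteq> Inl i" "j \<noteq> Inr k" for j
    using x(4)[OF that] nz[of j t] by simp
  have "(\<Sum>l\<in>UNIV. (x $ Inl l)\<^sup>2) = (x $ Inl i)\<^sup>2"
    by (subst sum.remove[of UNIV i]) (auto simp: 0)
  moreover have "(\<Sum>l\<in>UNIV. (x $ Inr l)\<^sup>2) = (x $ Inr k)\<^sup>2"
    by (subst sum.remove[of UNIV k]) (auto simp: 0)
  ultimately have "(x $ Inl i)\<^sup>2 = (x $ Inr k)\<^sup>2"
    using x(1) by (simp add: quadric_form_eq)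
  moreover have "r = ((x $ Inl i)\<^sup>2 * (cmod (w (Inl i) t))\<^sup>2) / ((x $ Inr k)\<^sup>2 * (cmod (w (Inr k) t))\<^sup>2)"
    unfolding x(2) by (simp add: norm_mult power_mult_distrib)
  ultimately have "r = (cmod (w (Inl i) t))\<^sup>2 / (cmod (w (Inr k) t))\<^sup>2"
    using x(3) by (metis mult_divide_mult_cancel_left power_not_zero)
  then show "r \<in> {(cmod (w (Inl i) t))\<^sup>2 / (cmod (w (Inr k) t))\<^sup>2 | t. True}" by blast
next
  fix r assume "r \<in> {(cmod (w (Inl i) t))\<^sup>2 / (cmod (w (Inr k) t))\<^sup>2 | t. True}"
  then obtain t where t: "r = (cmod (w (Inl i) t))\<^sup>2 / (cmod (w (Inr k) t))\<^sup>2" by blast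
  define x :: "real ^ ('p + 'q)" where "x = (\<chi> j. if j = Inl i \<or> j = Inr k then 1 else 0)"
  have "(\<Sum>l\<in>UNIV. (x $ Inl l)\<^sup>2) = 1" "(\<Sum>l\<in>UNIV. (x $ Inr l)\<^sup>2) = 1"
    by (simp_all add: x_def if_distrib[of "\<lambda>c. c\<^sup>2"] cong: if_cong)
  then have "quadric_form x = 0"
    by (simp add: quadric_form_eq)
  then have "(\<chi> j. complex_of_real (x $ j) * w j t) \<in> w_family w 0"
    unfolding w_family_def by blast
  then show "r \<in> plane_ratios (w_family w 0) (Inl i) (Inr k)"
    unfolding plane_ratios_def using t nz
    by (intro CollectI exI[of _ "\<chi> j. complex_of_real (x $ j) * w j t"]) (simp add: x_def)
qed

text \<open>A set determines its minimum and maximum, and both are attained here.\<close>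

lemma scaled_range_eq:
  fixes g g' :: "real \<Rightarrow> real"
  assumes eq: "{c * g t | t. True} = {c' * g' t | t. True}" and c: "c > 0" "c' > 0"
    and g: "\<And>t. l \<le> g t \<and> g t \<le> h" "\<exists>t. g t = l" "\<exists>t. g t = h"
    and g': "\<And>t. l' \<le> g' t \<and> g' t \<le> h'" "\<exists>t. g' t = l'" "\<exists>t. g' t = h'"
  shows "c * l = c' * l'" "c * h = c' * h'"
proof -
  have 1: "\<exists>s. c * g t = c' * g' s" for t using eq by blast
  have 2: "\<exists>t. c' * g' s = c * g t" for s
  proof -
    have "c' * g' s \<in> {c * g t | t. True}" unfolding eq by blast
    then show ?thesis by blast
  qed
  have "c * l \<ge> c' * l'"
    using 1 g(2) g'(1) c(2) by (metis mult_le_cancel_left_pos)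
  moreover have "c * l \<le> c' * l'"
    using 2 g'(2) g(1) c(1) by (metis mult_le_cancel_left_pos)
  ultimately show "c * l = c' * l'" by simp
  have "c * h \<le> c' * h'"
    using 1 g(3) g'(1) c(2) by (metis mult_le_cancel_left_pos)
  moreover have "c * h \<ge> c' * h'"
    using 2 g'(3) g(1) c(1) by (metis mult_le_cancel_left_pos)
  ultimately show "c * h = c' * h'" by simp
qed


section \<open>Two-block data and their families\<close>

definition block_alpha :: "'p::finite + 'q::finite \<Rightarrow> real" where
  "block_alpha = case_sum (\<lambda>_. real CARD('p)) (\<lambda>_. real CARD('q))"

lemma two_blocks_card: "two_blocks CARD('p::finite) CARD('q::finite)"
  by unfold_locales (simp_all add: zero_less_card_finite)

lemma block_datum_exists:
  fixes E :: real
  defines "Ub \<equiv> two_blocks.U CARD('p::finite) CARD('q::finite)"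
  assumes E: "E > 0" and q: "q \<in> \<rat>" "two_blocks.J CARD('p) CARD('q) E = pi * q"
  shows "\<exists>u \<theta> T. periodic_datum (block_alpha :: 'p + 'q \<Rightarrow> real) (two_blocks.Amp CARD('p) CARD('q) E) u \<theta> \<and>
    periodic_evolution (datum_w (block_alpha :: 'p + 'q \<Rightarrow> real) u \<theta>) T \<and>
    (\<forall>i k t. datum_w (block_alpha :: 'p + 'q \<Rightarrow> real) u \<theta> (Inl i) t = datum_w block_alpha u \<theta> (Inl k) t) \<and>
    (\<forall>t. Ub (- E) \<le> u t \<and> u t \<le> Ub E) \<and> (\<exists>t. u t = Ub E) \<and> (\<exists>t. u t = Ub (- E))"
proof -
  interpret two_blocks "CARD('p)" "CARD('q)" by (rule two_blocks_card)
  let ?a = "real CARD('p)" and ?b = "real CARD('q)"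
  obtain u f1 f2 :: "real \<Rightarrow> real" and T where T: "T > 0"
    and "\<forall>t. U (- E) \<le> u t \<and> u t \<le> U E" and ue: "\<exists>t. u t = U E" "\<exists>t. u t = U (- E)"
    and "\<forall>t. sqrt ((?a + u t) ^ CARD('p) * (?b - u t) ^ CARD('q)) * sin (?a * f1 t + ?b * f2 t) = Amp E"
    and "\<forall>t. (u has_real_derivative 2 * sqrt ((?a + u t) ^ CARD('p) * (?b - u t) ^ CARD('q)) * cos (?a * f1 t + ?b * f2 t)) (at t)"
    and "\<forall>t. (f1 has_real_derivative - Amp E / (?a + u t)) (at t)"
    and "\<forall>t. (f2 has_real_derivative Amp E / (?b - u t)) (at t)"
    and "\<forall>t. u (t + T) = u t" "\<forall>t. f1 (t + T) = f1 t - J E" "\<forall>t. f2 (t + T) = f2 t + ?a * J E / ?b"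
    using orbit_exists[OF E]
    by (elim exE conjE) (rule that, (assumption | (rule exI, assumption))+)
  note ub = this(2)[rule_format] and A = this(5)[rule_format] and du = this(6)[rule_format]
    and d1 = this(7)[rule_format] and d2 = this(8)[rule_format] and per = this(9-11)[rule_format]
  define \<theta> :: "'p + 'q \<Rightarrow> real \<Rightarrow> real" where "\<theta> = case_sum (\<lambda>_. f1) (\<lambda>_. f2)"
  let ?\<alpha> = "block_alpha :: 'p + 'q \<Rightarrow> real"
  have \<alpha>: "?\<alpha> (Inl i) = ?a" "?\<alpha> (Inr k) = ?b" for i k by (simp_all add: block_alpha_def)
  have \<theta>: "\<theta> (Inl i) = f1" "\<theta> (Inr k) = f2" for i k by (simp_all add: \<theta>_def)
  have sum\<theta>: "(\<Sum>j\<in>UNIV. \<theta> j t) = ?a * f1 t + ?b * f2 t" for t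
    by (simp add: sum_UNIV_sum \<theta>)
  have Q: "Q_poly ?\<alpha> x = (?a + x) ^ CARD('p) * (?b - x) ^ CARD('q)" for x
    by (simp add: Q_poly_def \<alpha>)
  have qc: "sqrt (\<Prod>j\<in>UNIV. ?\<alpha> j) = qc"
    by (simp add: prod_UNIV_sum \<alpha> qc_def)
  have bounds: "?a + u t > 0" "?b - u t > 0" for t
    using ub[of t] U_bounds(1)[of "- E"] U_bounds(2)[of E] by simp_all
  have ed: "evolution_datum ?\<alpha> (Amp E) u \<theta>"
    unfolding evolution_datum_def sum\<theta> Q qc
  proof (intro conjI allI)
    show "?\<alpha> j > 0" for j using a b by (cases j) (simp_all add: \<alpha>)
    show "(\<Sum>j\<in>UNIV. 1 / ?\<alpha> (Inl j)) = (\<Sum>j\<in>UNIV. 1 / ?\<alpha> (Inr j))"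
      using a b by (simp add: \<alpha>)
    show "Amp E < qc" using qc_pos E by (simp add: Amp_def)
  qed (use A du d1 d2 bounds Amp_pos[of E] in \<open>simp_all add: \<alpha> \<theta>\<close>)
  define \<beta> :: "'p + 'q \<Rightarrow> real" where "\<beta> = case_sum (\<lambda>_. - J E) (\<lambda>_. ?a * J E / ?b)"
  have pd: "periodic_datum ?\<alpha> (Amp E) u \<theta>"
    unfolding periodic_datum_def
  proof (intro conjI exI[of _ T] exI[of _ \<beta>] allI ed T)
    show "u (t + T) = u t" for t by (rule per)
    show "(\<Sum>j\<in>UNIV. \<theta> j (t + T)) = (\<Sum>j\<in>UNIV. \<theta> j t)" for t
      unfolding sum\<theta> per using b by (simp add: algebra_simps)
    show "\<theta> j (t + T) = \<theta> j t + \<beta> j" for j t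
      by (cases j) (simp_all add: \<theta> \<beta>_def per)
    show "\<exists>q\<in>\<rat>. \<beta> j = pi * q" for j
    proof (cases j)
      case (Inl i)
      then show ?thesis using q by (intro bexI[of _ "- q"]) (simp_all add: \<beta>_def)
    next
      case (Inr k)
      then show ?thesis using q by (intro bexI[of _ "?a * q / ?b"]) (simp_all add: \<beta>_def)
    qed
  qed
  interpret quadric_evolution quadric_sign "datum_w ?\<alpha> u \<theta>"
    by (rule evolution_datum_quadric_evolution[OF ed])
  obtain n :: int and d :: nat where nd: "d > 0" "q = of_int n / of_nat d"
    using q(1) by (metis Rats_cases' of_nat_0_less_iff of_int_of_nat_eq zero_less_imp_eq_int)
  \<comment> \<open>After this many periods the angles have changed by integer multiples of 2\<pi>:
    \<open>d\<close> clears the denominator of \<open>q\<close>, \<open>CARD('q)\<close> that of the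
    second increment, and 2 turns multiples of \<pi> into multiples of 2\<pi>.\<close>
  define N where "N = 2 * (d * CARD('q))"
  have N: "N > 0" using nd b by (simp add: N_def)
  have shift: "u (t + real N * T) = u t" "f1 (t + real N * T) = f1 t + 2 * pi * of_int (- n * int CARD('q))"
    "f2 (t + real N * T) = f2 t + 2 * pi * of_int (n * int CARD('p))" for t
  proof -
    show "u (t + real N * T) = u t" using iterate_shift[of u T 0 t N] per(1) by simp
    have "f1 (t + real N * T) = f1 t + real N * (- J E)"
      by (rule iterate_shift) (simp add: per)
    also have "real N * (- J E) = 2 * pi * of_int (- n * int CARD('q))"
      using nd by (simp add: q(2) N_def)
    finally show "f1 (t + real N * T) = f1 t + 2 * pi * of_int (- n * int CARD('q))" .
    have "f2 (t + real N * T) = f2 t + real N * (?a * J E / ?b)"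
      by (rule iterate_shift) (simp add: per)
    also have "real N * (?a * J E / ?b) = 2 * pi * of_int (n * int CARD('p))"
      using nd b by (simp add: q(2) N_def)
    finally show "f2 (t + real N * T) = f2 t + 2 * pi * of_int (n * int CARD('p))" .
  qed
  have cis_int: "cis (x + 2 * pi * of_int k) = cis x" for x k
    by (simp add: cis_mult[symmetric] cis_multiple_2pi)
  have pe: "periodic_evolution (datum_w ?\<alpha> u \<theta>) (real N * T)"
  proof
    show "real N * T > 0" using N T by simp
    show "datum_w ?\<alpha> u \<theta> j (t + real N * T) = datum_w ?\<alpha> u \<theta> j t" for j t
      unfolding datum_w_def datum_r_def shift(1)
      by (cases j) (simp_all only: \<theta> shift cis_int)
  qed
  have same: "datum_w ?\<alpha> u \<theta> (Inl i) t = datum_w ?\<alpha> u \<theta> (Inl k) t" for i k t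
    by (simp add: datum_w_def datum_r_def \<alpha> \<theta>)
  show ?thesis
    unfolding Ub_def using pd pe same ub ue by blast
qed

text \<open>Emptiness and positivity of the norms on an axis of each block reveal the sign of c. For
  c \<noteq> 0 the two end points of the range of norms determine both c and E; for c = 0 the
  largest ratio in a mixed coordinate plane determines E.\<close>

lemma block_family_inj:
  fixes E E' :: real and u u' :: "real \<Rightarrow> real" and \<theta> \<theta>' :: "'p::finite + 'q::finite \<Rightarrow> real \<Rightarrow> real"
  defines "Ub \<equiv> two_blocks.U CARD('p) CARD('q)"
  assumes ed: "evolution_datum block_alpha A u \<theta>" "evolution_datum block_alpha A' u' \<theta>'"
    and u: "\<And>t. Ub (- E) \<le> u t \<and> u t \<le> Ub E" "\<exists>t. u t = Ub E" "\<exists>t. u t = Ub (- E)"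
    and u': "\<And>t. Ub (- E') \<le> u' t \<and> u' t \<le> Ub E'" "\<exists>t. u' t = Ub E'" "\<exists>t. u' t = Ub (- E')"
    and eq: "w_family (datum_w block_alpha u \<theta>) c = w_family (datum_w block_alpha u' \<theta>') c'"
  shows "E = E' \<and> c = c'"
proof -
  interpret two_blocks "CARD('p)" "CARD('q)" by (rule two_blocks_card)
  let ?a = "real CARD('p)" and ?b = "real CARD('q)"
  let ?w = "datum_w block_alpha u \<theta>" and ?w' = "datum_w block_alpha u' \<theta>'"
  define i :: 'p where "i = undefined"
  define k :: 'q where "k = undefined"
  have nz: "?w j t \<noteq> 0" "?w' j t \<noteq> 0" for j t
    using evolution_datum_quadric_evolution[OF ed(1)] evolution_datum_quadric_evolution[OF ed(2)]
    by (simp_all add: quadric_evolution.w_nz)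
  have n: "(cmod (?w (Inl i) t))\<^sup>2 = ?a + u t" "(cmod (?w' (Inl i) t))\<^sup>2 = ?a + u' t"
    "(cmod (?w (Inr k) t))\<^sup>2 = ?b - u t" "(cmod (?w' (Inr k) t))\<^sup>2 = ?b - u' t" for t
    unfolding norm_datum_w[OF ed(1)] norm_datum_w[OF ed(2)] by (simp_all add: block_alpha_def)
  have mono: "Ub x < Ub y \<longleftrightarrow> x < y" for x y
    unfolding Ub_def using U_strict_mono[of x y] U_strict_mono[of y x] by (cases x y rule: linorder_cases) auto
  have UE: "?a + Ub x > 0" "?b - Ub x > 0" for x
    unfolding Ub_def by (rule U_bounds)+
  have bd: "?a + u t > 0" "?b - u t > 0" "?a + u' t > 0" "?b - u' t > 0" for t
    using u(1)[of t] u'(1)[of t] UE[of "- E"] UE[of E] UE[of "- E'"] UE[of E'] by linarith+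
  have P: "{c * (?a + u t) | t. c \<ge> 0} = {c' * (?a + u' t) | t. c' \<ge> 0}"
    using axis_norms_family[of ?w c "Inl i"] axis_norms_family[of ?w' c' "Inl i"] nz eq by (simp add: n)
  have M: "{- c * (?b - u t) | t. c \<le> 0} = {- c' * (?b - u' t) | t. c' \<le> 0}"
    using axis_norms_family[of ?w c "Inr k"] axis_norms_family[of ?w' c' "Inr k"] nz eq by (simp add: n)
  have sgn_pos: "c > 0 \<longleftrightarrow> c' > 0"
  proof
    assume "c > 0"
    then have "c * (?a + u 0) \<in> {c * (?a + u t) | t. c \<ge> 0}" by auto
    then obtain t where "c' \<ge> 0" "c * (?a + u 0) = c' * (?a + u' t)" unfolding P by blast
    moreover have "c * (?a + u 0) > 0" using \<open>c > 0\<close> bd by simp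
    ultimately show "c' > 0" by (cases "c' = 0") auto
  next
    assume "c' > 0"
    then have "c' * (?a + u' 0) \<in> {c' * (?a + u' t) | t. c' \<ge> 0}" by auto
    then obtain t where "c \<ge> 0" "c' * (?a + u' 0) = c * (?a + u t)" unfolding P[symmetric] by blast
    moreover have "c' * (?a + u' 0) > 0" using \<open>c' > 0\<close> bd by simp
    ultimately show "c > 0" by (cases "c = 0") auto
  qed
  have sgn_neg: "c < 0 \<longleftrightarrow> c' < 0"
  proof
    assume "c < 0"
    then have "- c * (?b - u 0) \<in> {- c * (?b - u t) | t. c \<le> 0}" by auto
    then obtain t where "c' \<le> 0" "- c * (?b - u 0) = - c' * (?b - u' t)" unfolding M by blast
    moreover have "- c * (?b - u 0) > 0" using \<open>c < 0\<close> bd by (intro mult_pos_pos) auto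
    ultimately show "c' < 0" by (cases "c' = 0") auto
  next
    assume "c' < 0"
    then have "- c' * (?b - u' 0) \<in> {- c' * (?b - u' t) | t. c' \<le> 0}" by auto
    then obtain t where "c \<le> 0" "- c' * (?b - u' 0) = - c * (?b - u t)" unfolding M[symmetric] by blast
    moreover have "- c' * (?b - u' 0) > 0" using \<open>c' < 0\<close> bd by (intro mult_pos_pos) auto
    ultimately show "c < 0" by (cases "c = 0") auto
  qed
  consider "c > 0" | "c < 0" | "c = 0" by linarith
  then show ?thesis
  proof cases
    case 1
    then have c': "c' > 0" using sgn_pos by simp
    have eqn: "{c * (?a + u t) | t. True} = {c' * (?a + u' t) | t. True}" using P 1 c' by simp
    have r: "\<And>t. ?a + Ub (- E) \<le> ?a + u t \<and> ?a + u t \<le> ?a + Ub E"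
      "\<exists>t. ?a + u t = ?a + Ub (- E)" "\<exists>t. ?a + u t = ?a + Ub E"
      using u by simp_all
    have r': "\<And>t. ?a + Ub (- E') \<le> ?a + u' t \<and> ?a + u' t \<le> ?a + Ub E'"
      "\<exists>t. ?a + u' t = ?a + Ub (- E')" "\<exists>t. ?a + u' t = ?a + Ub E'"
      using u' by simp_all
    note e = scaled_range_eq[OF eqn 1 c' r r']
    \<comment> \<open>Equality of both end points would give E' < E from the upper one and -E' < -E
      from the lower one.\<close>
    have "\<not> c < c'"
    proof
      assume cc: "c < c'"
      have "c * (?a + Ub E') < c * (?a + Ub E)" "c * (?a + Ub (- E')) < c * (?a + Ub (- E))"
        unfolding e by (rule mult_strict_right_mono[OF cc]; rule UE)+
      then have "Ub E' < Ub E" "Ub (- E') < Ub (- E)" using 1 by simp_all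
      then show False by (simp add: mono)
    qed
    moreover have "\<not> c' < c"
    proof
      assume cc: "c' < c"
      have "c' * (?a + Ub E) < c' * (?a + Ub E')" "c' * (?a + Ub (- E)) < c' * (?a + Ub (- E'))"
        unfolding e[symmetric] by (rule mult_strict_right_mono[OF cc]; rule UE)+
      then have "Ub E < Ub E'" "Ub (- E) < Ub (- E')" using c' by simp_all
      then show False by (simp add: mono)
    qed
    ultimately have "c = c'" by simp
    then have "Ub E = Ub E'" using e(2) 1 by simp
    then have "E = E'" using mono[of E E'] mono[of E' E] by linarith
    with \<open>c = c'\<close> show ?thesis by simp
  next
    case 2
    then have c': "c' < 0" using sgn_neg by simp
    have eqn: "{- c * (?b - u t) | t. True} = {- c' * (?b - u' t) | t. True}" using M 2 c' by simp
    have r: "\<And>t. ?b - Ub E \<le> ?b - u t \<and> ?b - u t \<le> ?b - Ub (- E)"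
      "\<exists>t. ?b - u t = ?b - Ub E" "\<exists>t. ?b - u t = ?b - Ub (- E)"
      using u by simp_all
    have r': "\<And>t. ?b - Ub E' \<le> ?b - u' t \<and> ?b - u' t \<le> ?b - Ub (- E')"
      "\<exists>t. ?b - u' t = ?b - Ub E'" "\<exists>t. ?b - u' t = ?b - Ub (- E')"
      using u' by simp_all
    have "- c > 0" "- c' > 0" using 2 c' by simp_all
    note e = scaled_range_eq[OF eqn this r r']
    have "\<not> - c < - c'"
    proof
      assume cc: "- c < - c'"
      have "- c * (?b - Ub E') < - c * (?b - Ub E)" "- c * (?b - Ub (- E')) < - c * (?b - Ub (- E))"
        unfolding e by (rule mult_strict_right_mono[OF cc]; rule UE)+
      then have "Ub E < Ub E'" "Ub (- E) < Ub (- E')" using 2 by simp_all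
      then show False by (simp add: mono)
    qed
    moreover have "\<not> - c' < - c"
    proof
      assume cc: "- c' < - c"
      have "- c' * (?b - Ub E) < - c' * (?b - Ub E')" "- c' * (?b - Ub (- E)) < - c' * (?b - Ub (- E'))"
        unfolding e[symmetric] by (rule mult_strict_right_mono[OF cc]; rule UE)+
      then have "Ub E' < Ub E" "Ub (- E') < Ub (- E)" using c' by simp_all
      then show False by (simp add: mono)
    qed
    ultimately have "c = c'" by simp
    then have "Ub E = Ub E'" using e(1) 2 by simp
    then have "E = E'" using mono[of E E'] mono[of E' E] by linarith
    with \<open>c = c'\<close> show ?thesis by simp
  next
    case 3
    then have c': "c' = 0" using sgn_pos sgn_neg by linarith
    \<comment> \<open>The ratio of squared norms in the plane of \<open>Inl i\<close> and
      \<open>Inr k\<close> is this increasing function of u, so its maximum determines U(E).\<close>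
    define g where "g x = (?a + x) / (?b - x)" for x
    have R: "{1 * g (u t) | t. True} = {1 * g (u' t) | t. True}"
      using plane_ratios_family[of ?w i k] plane_ratios_family[of ?w' i k] nz eq 3 c' by (simp add: n g_def)
    have g_mono: "g x \<le> g y" if "x \<le> y" "?a + x > 0" "?b - y > 0" for x y
      unfolding g_def using that by (intro frac_le) auto
    have "1 * g (Ub E) = 1 * g (Ub E')"
    proof (rule scaled_range_eq(2)[OF R])
      show "g (Ub (- E)) \<le> g (u t) \<and> g (u t) \<le> g (Ub E)" for t
        using u(1)[of t] bd[of t] UE by (intro conjI g_mono) auto
      show "g (Ub (- E')) \<le> g (u' t) \<and> g (u' t) \<le> g (Ub E')" for t
        using u'(1)[of t] bd[of t] UE by (intro conjI g_mono) auto
      show "\<exists>t. g (u t) = g (Ub (- E))" "\<exists>t. g (u t) = g (Ub E)"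
        using u(2,3) by metis+
      show "\<exists>t. g (u' t) = g (Ub (- E'))" "\<exists>t. g (u' t) = g (Ub E')"
        using u'(2,3) by metis+
    qed simp_all
    then have "(?a + Ub E) * (?b - Ub E') = (?a + Ub E') * (?b - Ub E)"
      using UE[of E] UE[of E'] by (simp add: g_def frac_eq_eq)
    then have "(?a + ?b) * (Ub E - Ub E') = 0" by (simp add: algebra_simps)
    then have "Ub E = Ub E'" using a by simp
    then have "E = E'" using mono[of E E'] mono[of E' E] by linarith
    with 3 c' show ?thesis by simp
  qed
qed

theorem theorem5p9:
  fixes m a :: nat
  assumes "m \<ge> 3" and "1 \<le> a" and "a < m"
    and "CARD('p::finite) = a" and "CARD('q::finite) = m - a"
  shows "\<exists>\<F> :: (real \<Rightarrow> (complex ^ ('p + 'q)) set) set.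
    countable \<F> \<and> infinite \<F> \<and>
    (\<forall>F\<in>\<F>. \<exists>\<alpha> A u \<theta>. periodic_datum \<alpha> A u \<theta> \<and> F = quadric_family \<alpha> u \<theta>) \<and>
    inj_on (\<lambda>(F, c). F c) (\<F> \<times> UNIV) \<and>
    (\<forall>F\<in>\<F>. \<forall>c.
      (c > 0 \<longrightarrow> closed (F c) \<and>
        SL_immersed_image
          (sphere (0 :: real ^ 'p) 1 \<times> (UNIV :: (real ^ 'q) set) \<times> sphere (0 :: complex) 1) (F c)) \<and>
      (c < 0 \<longrightarrow> closed (F c) \<and>
        SL_immersed_image
          ((UNIV :: (real ^ 'p) set) \<times> sphere (0 :: real ^ 'q) 1 \<times> sphere (0 :: complex) 1) (F c)) \<and>
      (c = 0 \<longrightarrow> closed (F c) \<and> cone (F c) \<and> isolated_singular_point (F c) 0 \<and>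
        SL_immersed_cone
          (sphere (0 :: real ^ 'p) 1 \<times> sphere (0 :: real ^ 'q) 1 \<times> sphere (0 :: complex) 1) (F c)))"
proof -
  have card: "CARD('p) + CARD('q) \<ge> 3" using assms by simp
  interpret two_blocks "CARD('p)" "CARD('q)" by (rule two_blocks_card)
  let ?\<alpha> = "block_alpha :: 'p + 'q \<Rightarrow> real"
  \<comment> \<open>Keeping only a sequence of radii makes the collection countable by
    construction.\<close>
  obtain e :: "nat \<Rightarrow> real" where e: "inj e" "range e \<subseteq> {E. E > 0 \<and> (\<exists>q\<in>\<rat>. J E = pi * q)}"
    using infinite_countable_subset[OF infinitely_many_rational_angles[OF card]] by (elim exE conjE)
  define good where "good n u \<theta> T \<longleftrightarrow> periodic_datum ?\<alpha> (Amp (e n)) u \<theta> \<and>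
    periodic_evolution (datum_w ?\<alpha> u \<theta>) T \<and>
    (\<forall>i k t. datum_w ?\<alpha> u \<theta> (Inl i) t = datum_w ?\<alpha> u \<theta> (Inl k) t) \<and>
    (\<forall>t. U (- e n) \<le> u t \<and> u t \<le> U (e n)) \<and> (\<exists>t. u t = U (e n)) \<and> (\<exists>t. u t = U (- e n))" for n u \<theta> T
  have "\<exists>u \<theta> T. good n u \<theta> T" for n
  proof -
    have "e n \<in> {E. E > 0 \<and> (\<exists>q\<in>\<rat>. J E = pi * q)}" using e(2) by blast
    then obtain q where "e n > 0" "q \<in> \<rat>" "J (e n) = pi * q" by blast
    from block_datum_exists[OF this] show ?thesis unfolding good_def .
  qed
  then obtain u \<theta> T where good: "\<And>n. good n (u n) (\<theta> n) (T n)" by metis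
  have ed: "evolution_datum ?\<alpha> (Amp (e n)) (u n) (\<theta> n)" for n
    using good[of n] by (simp add: good_def periodic_datum_def)
  define F where "F n = quadric_family ?\<alpha> (u n) (\<theta> n)" for n
  have F_eq: "F n = w_family (datum_w ?\<alpha> (u n) (\<theta> n))" for n
    by (simp add: F_def quadric_family_eq fun_eq_iff)
  have F_inj: "x = y \<and> c = c'" if "F x c = F y c'" for x y c c'
  proof -
    have "e x = e y \<and> c = c'"
      using good[of x] good[of y] that unfolding good_def F_eq
      by (intro block_family_inj[OF ed ed]) auto
    then show ?thesis using e(1) by (simp add: inj_eq)
  qed
  then have "inj F" by (metis injI)
  let ?P = "\<lambda>(G :: real \<Rightarrow> (complex ^ ('p + 'q)) set) c.
      (c > 0 \<longrightarrow> closed (G c) \<and>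
        SL_immersed_image
          (sphere (0 :: real ^ 'p) 1 \<times> (UNIV :: (real ^ 'q) set) \<times> sphere (0 :: complex) 1) (G c)) \<and>
      (c < 0 \<longrightarrow> closed (G c) \<and>
        SL_immersed_image
          ((UNIV :: (real ^ 'p) set) \<times> sphere (0 :: real ^ 'q) 1 \<times> sphere (0 :: complex) 1) (G c)) \<and>
      (c = 0 \<longrightarrow> closed (G c) \<and> cone (G c) \<and> isolated_singular_point (G c) 0 \<and>
        SL_immersed_cone
          (sphere (0 :: real ^ 'p) 1 \<times> sphere (0 :: real ^ 'q) 1 \<times> sphere (0 :: complex) 1) (G c))"
  have "\<forall>G\<in>range F. \<forall>c. ?P G c"
  proof (intro ballI allI)
    fix G c assume "G \<in> range F"
    then obtain n where n: "G = F n" by blast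
    interpret periodic_evolution "datum_w ?\<alpha> (u n) (\<theta> n)" "T n"
      using good[of n] by (simp add: good_def)
    have G: "G = family" unfolding n F_eq family_eq ..
    have "\<not> immersed_near (family 0) 0"
      using good[of n] card by (intro not_immersed_near_zero) (simp_all add: good_def)
    then have "isolated_singular_point (family 0) 0"
      unfolding isolated_singular_point_def using zero_in_family immersed_near_nonzero
      by (intro conjI exI[of _ 1]) auto
    then show "?P G c"
      unfolding G
      using closed_family cone_family_zero SL_immersed_image_pos SL_immersed_image_neg SL_immersed_cone_zero
      by (intro conjI impI) simp_all
  qed
  moreover have "\<exists>\<alpha> A u \<theta>. periodic_datum \<alpha> A u \<theta> \<and> G = quadric_family \<alpha> u \<theta>" if "G \<in> range F" for G
  proof -
    obtain n where "G = F n" using \<open>G \<in> range F\<close> by blast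
    then show ?thesis using good[of n] unfolding good_def F_def by blast
  qed
  moreover have "inj_on (\<lambda>(F, c). F c) (range F \<times> UNIV)"
  proof (rule inj_onI)
    fix X Y :: "(real \<Rightarrow> (complex ^ ('p + 'q)) set) \<times> real"
    assume "X \<in> range F \<times> UNIV" "Y \<in> range F \<times> UNIV"
      and XY: "(\<lambda>(F, c). F c) X = (\<lambda>(F, c). F c) Y"
    then obtain x y c d where "X = (F x, c)" "Y = (F y, d)" by auto
    then show "X = Y" using F_inj[of x c y d] XY by simp
  qed
  moreover have "infinite (range F)" using \<open>inj F\<close> by (rule range_inj_infinite)
  moreover have "countable (range F)" by simp
  ultimately show ?thesis
    by (intro exI[of _ "range F"] conjI ballI) blast+
qed

end
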